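(* Let $d\ge 3$. For a non-empty, open, bounded set $\Omega\subset\mathbb{R}^d$ and $q\in\mathbb{R}$ let $$G_q(\Omega)=\frac{\mathrm{cap}(\overline{\Omega})\,T(\Omega)^q}{|\Omega|^{1+q+2(q-1)/d}},$$ where $\mathrm{cap}$ is Newtonian capacity and $T$ is torsional rigidity. Let $B_1$ be an open ball of radius $1$ in $\mathbb{R}^d$, and let $$I_q=\inf\{G_q(\Omega)\ :\ \Omega\subset\mathbb{R}^d\text{ non-empty, open, bounded and convex}\}.$$ (i) If $q>\frac{d-2}{2(d-1)}$, then $I_q=0$. (ii) If $0<q\le\frac{d-2}{2(d-1)}$, then $$I_q\ge\frac{1}{2d^{\,d+(d+2)q}}\,G_q(B_1).$$ If $0<q<\frac{d-2}{2(d-1)}$, then the variational problem defining $I_q$ has a convex minimiser, i.e. there is a non-empty, open, bounded, convex set $\Omega^-\subset\mathbb{R}^d$ with $G_q(\Omega^-)=I_q$, and any such minimiser $\Omega^-$ satisfies $$\frac{\mathrm{diam}(\Omega^-)}{r(\Omega^-)}\le 2d\big(2d^{\,d+(d+2)q}\big)^{\frac{d(d-1)}{d-2-2q(d-1)}}.$$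
   Context: $|\cdot|$ denotes Lebesgue measure on $\mathbb{R}^d$ and $\overline{\Omega}$ the closure of $\Omega$. For $A\subset\mathbb{R}^d$, $\mathrm{diam}(A)=\sup\{|x-y|:x,y\in A\}$ is the diameter and $r(A)=\sup\{r\ge 0:\exists x\in A,\ B_r(x)\subset A\}$ is the inradius, where $B_r(x)=\{y\in\mathbb{R}^d:|x-y|<r\}$. Torsional rigidity: for an open set $\Omega\subset\mathbb{R}^d$ of finite measure, the torsion function $u_\Omega$ is the (weak) solution of $-\Delta u=1$, $u\in H_0^1(\Omega)$; it is non-negative, and $T(\Omega)=\|u_\Omega\|_{L^1(\Omega)}=\int_\Omega u_\Omega\,dx$. Newtonian capacity: for a compact set $K\subset\mathbb{R}^d$, $d\ge3$, $$\mathrm{cap}(K)=\inf\Big\{\int_{\mathbb{R}^d}|D\varphi|^2\,dx\ :\ \varphi\in C_0^1(\mathbb{R}^d),\ \varphi\ge 1\text{ on }K_\varepsilon\text{ for some }\varepsilon>0\Big\},$$ where $K_\varepsilon=\{x\in\mathbb{R}^d:\mathrm{dist}(x,K)<\varepsilon\}$. The functional $G_q$ is invariant under homotheties $\Omega\mapsto t\Omega$, $t>0$. *)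

theory Defs
  imports "HOL-Analysis.Analysis"
begin

primrec Ck :: "nat \<Rightarrow> ('a::euclidean_space \<Rightarrow> real) \<Rightarrow> bool" where
  "Ck 0 f \<longleftrightarrow> continuous_on UNIV f"
| "Ck (Suc k) f \<longleftrightarrow>
     (\<forall>x. f differentiable at x) \<and> (\<forall>b\<in>Basis. Ck k (\<lambda>x. frechet_derivative f (at x) b))"

definition grad :: "('a::euclidean_space \<Rightarrow> real) \<Rightarrow> 'a \<Rightarrow> 'a" where
  "grad f x = (\<Sum>b\<in>Basis. frechet_derivative f (at x) b *\<^sub>R b)"

definition compact_support_in :: "'a::euclidean_space set \<Rightarrow> ('a \<Rightarrow> real) \<Rightarrow> bool" where
  "compact_support_in \<Omega> f \<longleftrightarrow> compact (closure {x. f x \<noteq> 0}) \<and> closure {x. f x \<noteq> 0} \<subseteq> \<Omega>"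

definition test_function :: "'a::euclidean_space set \<Rightarrow> ('a \<Rightarrow> real) \<Rightarrow> bool" where
  "test_function \<Omega> f \<longleftrightarrow> (\<forall>k. Ck k f) \<and> compact_support_in \<Omega> f"

definition L2_on :: "'a::euclidean_space set \<Rightarrow> ('a \<Rightarrow> 'b::euclidean_space) \<Rightarrow> bool" where
  "L2_on \<Omega> f \<longleftrightarrow>
     set_borel_measurable lborel \<Omega> f \<and> set_integrable lborel \<Omega> (\<lambda>x. (norm (f x))\<^sup>2)"

(* Sobolev functions are represented by arbitrary functions on the whole space of which only
   the values on \<Omega>, up to null sets, matter. *)

definition has_weak_gradient ::
  "'a::euclidean_space set \<Rightarrow> ('a \<Rightarrow> real) \<Rightarrow> ('a \<Rightarrow> 'a) \<Rightarrow> bool" where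
  "has_weak_gradient \<Omega> u g \<longleftrightarrow>
     (\<forall>\<phi>. test_function \<Omega> \<phi> \<longrightarrow>
        (LINT x:\<Omega>|lborel. u x *\<^sub>R grad \<phi> x) = - (LINT x:\<Omega>|lborel. \<phi> x *\<^sub>R g x))"

(* H1 \<Omega> u g: u belongs to the Sobolev space of order one and g is its weak gradient. *)
definition H1 :: "'a::euclidean_space set \<Rightarrow> ('a \<Rightarrow> real) \<Rightarrow> ('a \<Rightarrow> 'a) \<Rightarrow> bool" where
  "H1 \<Omega> u g \<longleftrightarrow> L2_on \<Omega> u \<and> L2_on \<Omega> g \<and> has_weak_gradient \<Omega> u g"

(* The closure of the test functions in the Sobolev norm. *)
definition H01 :: "'a::euclidean_space set \<Rightarrow> ('a \<Rightarrow> real) \<Rightarrow> ('a \<Rightarrow> 'a) \<Rightarrow> bool" where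
  "H01 \<Omega> u g \<longleftrightarrow> H1 \<Omega> u g \<and>
     (\<exists>\<phi>. (\<forall>n. test_function \<Omega> (\<phi> n)) \<and>
        (\<lambda>n. LINT x:\<Omega>|lborel. (\<phi> n x - u x)\<^sup>2 + (norm (grad (\<phi> n) x - g x))\<^sup>2) \<longlonglongrightarrow> 0)"

definition is_torsion_function :: "'a::euclidean_space set \<Rightarrow> ('a \<Rightarrow> real) \<Rightarrow> bool" where
  "is_torsion_function \<Omega> u \<longleftrightarrow>
     (\<exists>g. H01 \<Omega> u g \<and>
        (\<forall>\<phi>. test_function \<Omega> \<phi> \<longrightarrow>
           (LINT x:\<Omega>|lborel. g x \<bullet> grad \<phi> x) = (LINT x:\<Omega>|lborel. \<phi> x)))"

(* For an open set of finite measure the weak solution exists and is unique up to null sets,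
   so the value does not depend on the representative chosen. *)
definition torsional_rigidity :: "'a::euclidean_space set \<Rightarrow> real" where
  "torsional_rigidity \<Omega> = (LINT x:\<Omega>|lborel. \<bar>(SOME u. is_torsion_function \<Omega> u) x\<bar>)"

(* The inner union is the set of points at distance less than \<epsilon> from K. *)
definition newtonian_capacity :: "'a::euclidean_space set \<Rightarrow> real" where
  "newtonian_capacity K =
     Inf {(LINT x|lborel. (norm (grad \<phi> x))\<^sup>2) | \<phi>.
            Ck 1 \<phi> \<and> compact_support_in UNIV \<phi> \<and>
            (\<exists>\<epsilon>>0. \<forall>x\<in>(\<Union>y\<in>K. ball y \<epsilon>). \<phi> x \<ge> 1)}"

definition inradius :: "'a::euclidean_space set \<Rightarrow> real" where
  "inradius A = Sup {r. 0 \<le> r \<and> (\<exists>x\<in>A. ball x r \<subseteq> A)}"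

definition G :: "real \<Rightarrow> 'a::euclidean_space set \<Rightarrow> real" where
  "G q \<Omega> = newtonian_capacity (closure \<Omega>) * torsional_rigidity \<Omega> powr q /
     measure lborel \<Omega> powr (1 + q + 2 * (q - 1) / real DIM('a))"

definition convex_domain :: "'a::euclidean_space set \<Rightarrow> bool" where
  "convex_domain \<Omega> \<longleftrightarrow> \<Omega> \<noteq> {} \<and> open \<Omega> \<and> bounded \<Omega> \<and> convex \<Omega>"

definition I_inf :: "'a::euclidean_space itself \<Rightarrow> real \<Rightarrow> real" where
  "I_inf _ q = Inf {G q \<Omega> | \<Omega> :: 'a set. convex_domain \<Omega>}"

end

theory Submission
  imports Defs "HOL-Complex_Analysis.Great_Picard"
begin

text \<open>
  The torsional rigidity \<open>T(\<Omega>)\<close> is the supremum of \<open>2 \<integral>\<phi> - \<integral>|\<nabla>\<phi>|\<^sup>2\<close> over test functions, and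
  a multiple of the distance to the complement shows \<open>T(\<Omega>) \<ge> 4\<^sup>-\<^sup>d\<^sup>-\<^sup>1 \<rho>\<^sup>2 |\<Omega>|\<close> for a convex \<open>\<Omega>\<close> of
  inradius \<open>\<rho>\<close>. For a positive superharmonic \<open>U\<close> one has \<open>\<integral>|\<nabla>\<phi>|\<^sup>2 \<ge> \<integral>\<phi>\<^sup>2 (-\<Delta>U)/U\<close>; with \<open>U\<close> the
  regularised Newton potential of \<open>\<Omega>\<close> this bounds the capacity of \<open>\<Omega>\<close> from below by
  \<open>d (d - 2) \<omega> |\<Omega>| / sup U\<close>, \<open>\<omega>\<close> the volume of the unit ball. By Helly's theorem \<open>\<Omega>\<close> lies in a slab
  of width \<open>(d + 1) \<rho>\<close>, which bounds \<open>U\<close>. Together,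
  \<open>G(\<Omega>) \<ge> d\<^bsup>-d-(d+2)q\<^esup> (\<rho>/s)\<^bsup>2q-(d-2)/(d-1)\<^esup> G(B)\<close> where \<open>|\<Omega>| = \<omega> s\<^sup>d\<close>.
  Since \<open>\<rho> \<le> s\<close>, the lower bound in (ii) follows. Below the critical \<open>q\<close> the exponent is negative, so
  that \<open>G\<close> controls \<open>s/\<rho>\<close> and with it the ratio of diameter and inradius. Hence normalised minimising
  sequences are bounded; a subsequence converges up to dilations close to \<open>1\<close>, under which \<open>G\<close> changes
  little. Thin boxes give (i).
\<close>

section \<open>Functions of class \<open>C\<^sup>k\<close> and mollification\<close>

text \<open>Capacity and torsional rigidity of the ball are never computed. They are only bounded
  from above, by \<open>2 ^ d * \<omega>\<close> and \<open>\<omega> / d\<^sup>2\<close>, and the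
  loss against the lower bounds for convex sets is absorbed into the factors \<open>d powr d\<close>
  and \<open>d powr (d + 2)\<close>; this is the origin of the constant. The exponent of \<rho>/s
  records a competition: flattening at fixed volume raises the capacity bound like
  \<open>(s / \<rho>) powr ((d - 2) / (d - 1))\<close> and lowers the torsion bound like
  \<open>(\<rho> / s)\<^sup>2\<close>, and the two balance exactly at the critical q. The
  definitions shape the rest. Torsional rigidity integrates the absolute value of an arbitrarily
  chosen weak solution, so existence has to be shown and the integral must be found for every
  solution, whose sign is not known in advance. Capacity is an infimum over competitors, so its
  lower bound needs an inequality valid for each of them. Regularising the kernel makes U twice
  continuously differentiable and its Laplacian an explicit function instead of a measure.\<close>

lemma Ck_Suc_intro:
  assumes "\<And>x. (f has_derivative f' x) (at x)" "\<And>b. b \<in> Basis \<Longrightarrow> Ck k (\<lambda>x. f' x b)"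
  shows "Ck (Suc k) f"
proof -
  have "frechet_derivative f (at x) = f' x" for x
    using assms(1)[of x] by (simp add: frechet_derivative_at[symmetric])
  moreover have "f differentiable at x" for x
    using assms(1) differentiable_def by blast
  ultimately show ?thesis using assms(2) by simp
qed

lemma Ck_Suc_has_derivative:
  assumes "Ck (Suc k) f"
  shows "(f has_derivative frechet_derivative f (at x)) (at x)"
  using assms by (simp add: frechet_derivative_works)

lemma Ck_Suc_imp_Ck: "Ck (Suc k) f \<Longrightarrow> Ck k f"
proof (induction k arbitrary: f)
  case 0
  then show ?case
    by (auto simp: continuous_on_eq_continuous_at intro: differentiable_imp_continuous_within)
qed auto

lemma Ck_const: "Ck k (\<lambda>x. c)"
proof (induction k arbitrary: c)
  case (Suc k)
  show ?case by (rule Ck_Suc_intro[where f' = "\<lambda>x h. 0"]) (auto simp del: Ck.simps simp: Suc)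
qed auto

lemma Ck_inner: "Ck k (\<lambda>x. x \<bullet> a)"
proof (cases k)
  case (Suc j)
  show ?thesis unfolding Suc
    by (rule Ck_Suc_intro[where f' = "\<lambda>x h. h \<bullet> a"]) (auto intro!: derivative_eq_intros Ck_const)
qed (auto intro!: continuous_intros)

lemma Ck_add: "Ck k f \<Longrightarrow> Ck k g \<Longrightarrow> Ck k (\<lambda>x. f x + g x)"
proof (induction k arbitrary: f g)
  case (Suc k)
  show ?case
  proof (rule Ck_Suc_intro)
    show "((\<lambda>x. f x + g x) has_derivative
        (\<lambda>h. frechet_derivative f (at x) h + frechet_derivative g (at x) h)) (at x)" for x
      using Suc.prems by (intro has_derivative_add Ck_Suc_has_derivative)
  qed (use Suc in auto)
qed (auto intro: continuous_intros)

lemma Ck_mult: "Ck k f \<Longrightarrow> Ck k g \<Longrightarrow> Ck k (\<lambda>x. f x * g x)"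
proof (induction k arbitrary: f g)
  case (Suc k)
  show ?case
  proof (rule Ck_Suc_intro)
    show "((\<lambda>x. f x * g x) has_derivative
        (\<lambda>h. f x * frechet_derivative g (at x) h + frechet_derivative f (at x) h * g x)) (at x)" for x
      using Suc.prems by (intro has_derivative_mult Ck_Suc_has_derivative)
    show "Ck k (\<lambda>x. f x * frechet_derivative g (at x) b + frechet_derivative f (at x) b * g x)"
      if "b \<in> Basis" for b
      using Suc.prems that
      by (intro Ck_add Suc.IH Ck_Suc_imp_Ck[OF Suc.prems(1)] Ck_Suc_imp_Ck[OF Suc.prems(2)]) auto
  qed
qed (auto intro: continuous_intros)

lemma Ck_cmult: "Ck k f \<Longrightarrow> Ck k (\<lambda>x. c * f x)"
  by (intro Ck_mult Ck_const)

lemma Ck_diff: "Ck k f \<Longrightarrow> Ck k g \<Longrightarrow> Ck k (\<lambda>x. f x - g x)"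
  using Ck_add[of k f "\<lambda>x. (-1) * g x"] Ck_cmult[of k g "-1"] by simp

lemma Ck_sum: "(\<And>i. i \<in> A \<Longrightarrow> Ck k (f i)) \<Longrightarrow> Ck k (\<lambda>x. \<Sum>i\<in>A. f i x)"
  by (induction A rule: infinite_finite_induct) (auto intro: Ck_const Ck_add)

lemma Ck_prod: "(\<And>i. i \<in> A \<Longrightarrow> Ck k (f i)) \<Longrightarrow> Ck k (\<lambda>x. \<Prod>i\<in>A. f i x)"
  by (induction A rule: infinite_finite_induct) (auto intro: Ck_const Ck_mult)

lemma Ck_norm_square: "Ck k (\<lambda>x::'a::euclidean_space. (norm x)\<^sup>2)"
  unfolding power2_norm_eq_inner by (subst euclidean_inner) (intro Ck_sum Ck_mult Ck_inner)

text \<open>The exponent is generalised in the induction because each derivative lowers it by one;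
  positivity of \<open>f\<close> keeps every real exponent admissible.\<close>

lemma Ck_powr: "Ck k f \<Longrightarrow> (\<And>x. f x > 0) \<Longrightarrow> Ck k (\<lambda>x. f x powr a)"
proof (induction k arbitrary: a)
  case (Suc k)
  show ?case
  proof (rule Ck_Suc_intro)
    show "((\<lambda>x. f x powr a) has_derivative
       (\<lambda>h. a * (f x powr (a - 1) * frechet_derivative f (at x) h))) (at x)" for x
    proof -
      have "((\<lambda>t. t powr a) has_real_derivative a * f x powr (a - 1)) (at (f x))"
        using Suc.prems(2)[of x] by (rule has_real_derivative_powr)
      from DERIV_compose_FDERIV[OF this Ck_Suc_has_derivative[OF Suc.prems(1)]]
      show ?thesis by (simp add: mult_ac)
    qed
    show "Ck k (\<lambda>x. a * (f x powr (a - 1) * frechet_derivative f (at x) b))" if "b \<in> Basis" for b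
      using Suc.prems that by (intro Ck_cmult Ck_mult Suc.IH Ck_Suc_imp_Ck[OF Suc.prems(1)]) auto
  qed
next
  case 0
  then have "\<forall>x\<in>UNIV. f x \<noteq> 0" by (metis less_irrefl)
  with 0 show ?case by (auto intro!: continuous_intros)
qed

lemma Ck_affine: "Ck k f \<Longrightarrow> Ck k (\<lambda>x. f (a + c *\<^sub>R x))"
proof (induction k arbitrary: f)
  case (Suc k)
  show ?case
  proof (rule Ck_Suc_intro)
    show "((\<lambda>x. f (a + c *\<^sub>R x)) has_derivative
       (\<lambda>h. frechet_derivative f (at (a + c *\<^sub>R x)) (c *\<^sub>R h))) (at x)" for x
      by (rule has_derivative_compose[where f = "\<lambda>x. a + c *\<^sub>R x" and f' = "\<lambda>h. c *\<^sub>R h"])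
         (auto intro!: derivative_eq_intros Ck_Suc_has_derivative[OF Suc.prems])
    show "Ck k (\<lambda>x. frechet_derivative f (at (a + c *\<^sub>R x)) (c *\<^sub>R b))" if "b \<in> Basis" for b
    proof -
      have "linear (frechet_derivative f (at y))" for y
        using Suc.prems by (simp add: linear_frechet_derivative)
      then have "frechet_derivative f (at y) (c *\<^sub>R b) = c * frechet_derivative f (at y) b" for y
        by (simp add: linear_scale)
      moreover have "Ck k (\<lambda>x. c * frechet_derivative f (at (a + c *\<^sub>R x)) b)"
        using Suc that by (intro Ck_cmult Suc.IH[of "\<lambda>x. frechet_derivative f (at x) b"]) auto
      ultimately show ?thesis by simp
    qed
  qed
qed (auto intro!: continuous_intros intro: continuous_on_compose2)

lemma grad_eqI:
  assumes "(f has_derivative (\<lambda>h. g \<bullet> h)) (at x)"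
  shows "grad f x = g"
  using assms frechet_derivative_at[OF assms, symmetric] by (simp add: grad_def euclidean_representation)

lemma has_derivative_grad:
  assumes "f differentiable at x"
  shows "(f has_derivative (\<lambda>h. grad f x \<bullet> h)) (at x)"
proof -
  have D: "(f has_derivative frechet_derivative f (at x)) (at x)"
    using assms frechet_derivative_works by blast
  have "frechet_derivative f (at x) h = grad f x \<bullet> h" for h
  proof -
    have "linear (frechet_derivative f (at x))" using D has_derivative_linear by blast
    then have "frechet_derivative f (at x) (\<Sum>b\<in>Basis. (h \<bullet> b) *\<^sub>R b) =
        (\<Sum>b\<in>Basis. (h \<bullet> b) * frechet_derivative f (at x) b)"
      by (simp add: linear_sum linear_scale)
    then show ?thesis
      unfolding euclidean_representation grad_def inner_sum_left
      by (simp add: inner_commute[of h] mult.commute)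
  qed
  then show ?thesis using D by presburger
qed

lemma frechet_derivative_eq_grad:
  "f differentiable at x \<Longrightarrow> frechet_derivative f (at x) h = grad f x \<bullet> h"
  by (metis frechet_derivative_at has_derivative_grad)

lemma grad_zero_nbhd:
  assumes "\<And>y. y \<in> S \<Longrightarrow> f y = 0" "open S" "x \<in> S"
  shows "grad f x = 0"
proof (rule grad_eqI)
  have "((\<lambda>x. 0::real) has_derivative (\<lambda>h. 0 \<bullet> h)) (at x)" by auto
  then show "(f has_derivative (\<lambda>h. 0 \<bullet> h)) (at x)"
    by (rule has_derivative_transform_within_open) (use assms in auto)
qed

lemma grad_outside_support:
  assumes "x \<notin> closure {x. f x \<noteq> 0}"
  shows "grad f x = 0"
proof (rule grad_zero_nbhd[of "- closure {x. f x \<noteq> 0}"])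
  show "f y = 0" if "y \<in> - closure {x. f x \<noteq> 0}" for y
    using that closure_subset[of "{x. f x \<noteq> 0}"] by auto
qed (use assms in auto)

text \<open>Trades the coordinatewise recursion of \<open>Ck\<close> for the gradient, the form in
  which all integral estimates are made.\<close>

lemma Ck_1_iff: "Ck 1 f \<longleftrightarrow> (\<forall>x. f differentiable at x) \<and> continuous_on UNIV (grad f)"
proof -
  have "continuous_on UNIV (grad f)"
    if "\<forall>b\<in>Basis. continuous_on UNIV (\<lambda>x. frechet_derivative f (at x) b)"
    unfolding grad_def using that by (intro continuous_intros) auto
  moreover have "continuous_on UNIV (\<lambda>x. frechet_derivative f (at x) b)"
    if "\<forall>x. f differentiable at x" "continuous_on UNIV (grad f)" for b
    using that by (simp add: frechet_derivative_eq_grad continuous_intros)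
  ultimately show ?thesis unfolding One_nat_def Ck.simps by blast
qed

lemma Ck_1_differentiable: "Ck 1 f \<Longrightarrow> f differentiable at x"
  and Ck_1_continuous_grad: "Ck 1 f \<Longrightarrow> continuous_on UNIV (grad f)"
  unfolding Ck_1_iff by blast+

lemma Ck_1_continuous: "Ck 1 f \<Longrightarrow> continuous_on UNIV f"
  using Ck_Suc_imp_Ck[of 0 f] unfolding One_nat_def Ck.simps(1) .

lemma Ck_Suc_grad_inner:
  assumes "Ck (Suc k) f" "b \<in> Basis"
  shows "Ck k (\<lambda>x. grad f x \<bullet> b)"
proof -
  have eq: "frechet_derivative f (at x) b = grad f x \<bullet> b" for x
    using assms(1) by (intro frechet_derivative_eq_grad) simp
  have "Ck k (\<lambda>x. frechet_derivative f (at x) b)" using assms by simp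
  then show ?thesis by (simp only: eq)
qed

lemma Ck_1_has_derivative: "Ck 1 f \<Longrightarrow> (f has_derivative (\<lambda>h. grad f x \<bullet> h)) (at x)"
  using Ck_1_differentiable has_derivative_grad by blast

text \<open>The polynomial factor makes the family closed under differentiation.\<close>

definition flat :: "real poly \<Rightarrow> real \<Rightarrow> real" where
  "flat p t = (if t > 0 then poly p (1 / t) * exp (- (1 / t)) else 0)"

lemma poly_times_exp_tendsto_0: "((\<lambda>s. poly p s * exp (- s)) \<longlongrightarrow> (0::real)) at_top"
proof -
  have "((\<lambda>s. \<Sum>i\<le>degree p. coeff p i * (s ^ i / exp s)) \<longlongrightarrow> (\<Sum>i\<le>degree p. coeff p i * 0)) at_top"
    by (intro tendsto_intros tendsto_power_div_exp_0)
  then show ?thesis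
    by (simp add: poly_altdef sum_distrib_right exp_minus divide_inverse mult.assoc)
qed

lemma flat_tendsto_0: "((\<lambda>t. flat p t) \<longlongrightarrow> 0) (at 0)"
proof (rule filterlim_split_at)
  show "((\<lambda>t. flat p t) \<longlongrightarrow> 0) (at_left 0)"
    by (rule tendsto_eventually) (auto simp: flat_def eventually_at_filter)
  have "filterlim (\<lambda>t::real. inverse t) at_top (at_right 0)"
    by (rule filterlim_inverse_at_top_right)
  then have "((\<lambda>t. poly p (inverse t) * exp (- inverse t)) \<longlongrightarrow> 0) (at_right 0)"
    using poly_times_exp_tendsto_0 filterlim_compose by blast
  then show "((\<lambda>t. flat p t) \<longlongrightarrow> 0) (at_right 0)"
    by (rule tendsto_cong[THEN iffD1, rotated])
       (auto simp: flat_def eventually_at_filter inverse_eq_divide)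
qed

text \<open>With u = 1/t one has d/dt = - u^2 d/du, and p(u) exp(-u) becomes u^2 (p(u) - p'(u))
  exp(-u). Only t = 0 needs a limit.\<close>

lemma flat_has_derivative:
  "(flat p has_real_derivative flat ((p - pderiv p) * [:0, 0, 1:]) t) (at t)"
proof -
  let ?q = "(p - pderiv p) * [:0, 0, 1:]"
  consider "t > 0" | "t < 0" | "t = 0" by linarith
  then show ?thesis
  proof cases
    case 1
    have "((\<lambda>t. poly p (1 / t) * exp (- (1 / t))) has_real_derivative flat ?q t) (at t)"
      using 1 by (auto intro!: derivative_eq_intros DERIV_chain2[OF poly_DERIV]
        simp: flat_def power2_eq_square field_simps)
    then show ?thesis
      by (rule DERIV_cong_ev[OF refl _ refl, THEN iffD1, rotated])
         (use 1 in \<open>auto simp: flat_def intro: eventually_mono[OF order_tendstoD(1)[OF tendsto_ident_at]]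
            intro!: eventually_nhds_in_open[of "{0<..}", simplified, THEN eventually_mono]\<close>)
  next
    case 2
    have "((\<lambda>t. 0) has_real_derivative flat ?q t) (at t)" using 2 by (auto simp: flat_def)
    then show ?thesis
      by (rule DERIV_cong_ev[OF refl _ refl, THEN iffD1, rotated])
         (use 2 in \<open>auto simp: flat_def
            intro!: eventually_nhds_in_open[of "{..<0}", simplified, THEN eventually_mono]\<close>)
  next
    case 3
    \<comment> \<open>The difference quotient at 0 is itself a flat function: dividing by
      \<open>h\<close> multiplies the polynomial in 1/h by its variable.\<close>
    have "((\<lambda>h. flat ([:0, 1:] * p) h) \<longlongrightarrow> 0) (at 0)" by (rule flat_tendsto_0)
    then have "((\<lambda>h. (flat p (0 + h) - flat p 0) / h) \<longlongrightarrow> 0) (at 0)"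
      by (rule tendsto_cong[THEN iffD1, rotated]) (auto simp: flat_def eventually_at_filter)
    then show ?thesis using 3 by (simp add: DERIV_def flat_def)
  qed
qed

lemma Ck_flat: "Ck k (\<lambda>x. flat p (a + c * (x \<bullet> b)))"
proof (induction k arbitrary: p)
  case 0
  have "continuous_on UNIV (flat p)"
    by (rule DERIV_continuous_on) (rule has_field_derivative_at_within[OF flat_has_derivative])
  then show ?case
    by (auto intro!: continuous_on_compose2[of UNIV "flat p"] continuous_intros)
next
  case (Suc k)
  let ?q = "(p - pderiv p) * [:0, 0, 1:]"
  show ?case
  proof (rule Ck_Suc_intro)
    show "((\<lambda>x. flat p (a + c * (x \<bullet> b))) has_derivative
      (\<lambda>h. (c * (h \<bullet> b)) * flat ?q (a + c * (x \<bullet> b)))) (at x)" for x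
      by (rule DERIV_compose_FDERIV[OF flat_has_derivative]) (auto intro!: derivative_eq_intros)
    show "Ck k (\<lambda>x. c * (i \<bullet> b) * flat ?q (a + c * (x \<bullet> b)))" for i
      by (intro Ck_cmult Suc.IH)
  qed
qed


lemma integrable_compact_support:
  fixes f :: "'a::euclidean_space \<Rightarrow> 'b::{banach, second_countable_topology}"
  assumes "continuous_on UNIV f" "compact K" "\<And>x. x \<notin> K \<Longrightarrow> f x = 0"
  shows "integrable lborel f"
proof -
  have "integrable lborel (\<lambda>x. indicator K x *\<^sub>R f x)"
    by (intro borel_integrable_compact assms(2) continuous_on_subset[OF assms(1)]) auto
  moreover have "(\<lambda>x. indicator K x *\<^sub>R f x) = f"
    using assms(3) by (auto simp: fun_eq_iff indicator_def)
  ultimately show ?thesis by simp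
qed

text \<open>A product of one-dimensional bumps, one for each coordinate, is positive exactly on a
  cube; it is then divided by its integral.\<close>

lemma mollifier_exists:
  assumes "\<delta> > 0"
  obtains \<eta> :: "'a::euclidean_space \<Rightarrow> real"
  where "\<And>k. Ck k \<eta>" "\<And>x. \<eta> x \<ge> 0" "\<And>x. norm x \<ge> \<delta> \<Longrightarrow> \<eta> x = 0"
    "integral\<^sup>L lborel \<eta> = 1"
proof -
  \<comment> \<open>With this half-width the cube lies inside the ball of radius \<delta>: if all
    coordinates are below \<open>e\<close> in absolute value, their sum, which dominates the norm,
    is below \<delta>.\<close>
  define e where "e = \<delta> / DIM('a)"
  have e: "e > 0" using assms by (simp add: e_def)
  define h :: "'a \<Rightarrow> real" where
    "h x = (\<Prod>b\<in>Basis. flat 1 (1 + (1 / e) * (x \<bullet> b)) * flat 1 (1 + (- 1 / e) * (x \<bullet> b)))" for x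
  have Ck_h: "Ck k h" for k
    unfolding h_def by (intro Ck_prod Ck_mult Ck_flat)
  have h_nonneg: "h x \<ge> 0" for x
    unfolding h_def by (intro prod_nonneg) (simp add: flat_def)
  have h_eq_0: "h x = 0" if "norm x \<ge> \<delta>" for x
  proof -
    have "\<exists>b\<in>Basis. \<bar>x \<bullet> b\<bar> \<ge> e"
    proof (rule ccontr)
      assume "\<not> ?thesis"
      then have "(\<Sum>b\<in>Basis. \<bar>x \<bullet> b\<bar>) < (\<Sum>b\<in>(Basis::'a set). e)"
        by (intro sum_strict_mono) auto
      also have "\<dots> = \<delta>" by (simp add: e_def)
      finally show False using norm_le_l1[of x] that by simp
    qed
    then obtain b where b: "b \<in> Basis" "\<bar>x \<bullet> b\<bar> \<ge> e" by auto
    then have "1 + (1 / e) * (x \<bullet> b) \<le> 0 \<or> 1 + (- 1 / e) * (x \<bullet> b) \<le> 0"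
      using e by (auto simp: abs_if field_simps split: if_splits)
    then have "flat 1 (1 + (1 / e) * (x \<bullet> b)) * flat 1 (1 + (- 1 / e) * (x \<bullet> b)) = 0"
      by (auto simp: flat_def)
    then show ?thesis unfolding h_def using b(1) by (intro prod_zero) auto
  qed
  have h_pos: "h x > 0" if "x \<in> box (- e *\<^sub>R One) (e *\<^sub>R One)" for x
    unfolding h_def
  proof (intro prod_pos mult_pos_pos ballI)
    fix b :: 'a assume b: "b \<in> Basis"
    then have "- e < x \<bullet> b" "x \<bullet> b < e" using that by (auto simp: mem_box)
    then have "1 + (1 / e) * (x \<bullet> b) > 0" "1 + (- 1 / e) * (x \<bullet> b) > 0"
      using e by (auto simp: field_simps)
    then show "flat 1 (1 + (1 / e) * (x \<bullet> b)) > 0" "flat 1 (1 + (- 1 / e) * (x \<bullet> b)) > 0"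
      by (auto simp: flat_def)
  qed
  have cont: "continuous_on UNIV h" using Ck_h[of 0] by simp
  have int: "integrable lborel h"
    by (rule integrable_compact_support[OF cont compact_cball[of 0 \<delta>]]) (auto intro: h_eq_0)
  have "integral\<^sup>L lborel h \<noteq> 0"
  proof
    assume "integral\<^sup>L lborel h = 0"
    then have "AE x in lborel. h x = 0"
      using integral_nonneg_eq_0_iff_AE[OF int] h_nonneg by simp
    then have "AE x in lborel. x \<notin> box (- e *\<^sub>R One) (e *\<^sub>R One :: 'a)"
      by eventually_elim (use h_pos in force)
    then have "emeasure lborel (box (- e *\<^sub>R One) (e *\<^sub>R One :: 'a)) = 0"
      by (subst (asm) AE_iff_measurable[OF _ refl]) auto
    then have "(\<Prod>b\<in>(Basis::'a set). (e *\<^sub>R One - (- e) *\<^sub>R One) \<bullet> b) \<le> 0"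
      using e by (simp add: emeasure_lborel_box_eq ennreal_eq_0_iff)
    moreover have "(\<Prod>b\<in>(Basis::'a set). (e *\<^sub>R One - (- e) *\<^sub>R One) \<bullet> b) > 0"
      using e by (intro prod_pos) (auto simp: inner_add_left)
    ultimately show False by simp
  qed
  moreover have "integral\<^sup>L lborel h \<ge> 0" using h_nonneg by simp
  ultimately have I: "integral\<^sup>L lborel h > 0" by simp
  show thesis
  proof
    show "Ck k (\<lambda>x. (1 / integral\<^sup>L lborel h) * h x)" for k by (intro Ck_cmult Ck_h)
    show "integral\<^sup>L lborel (\<lambda>x. (1 / integral\<^sup>L lborel h) * h x) = 1" using I by simp
  qed (use h_nonneg h_eq_0 I in auto)
qed

section \<open>Affine changes of variables\<close>

lemma integral_lborel_affine:
  fixes f :: "'a::euclidean_space \<Rightarrow> 'b::{banach, second_countable_topology}"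
  assumes "c \<noteq> 0" and f: "f \<in> borel_measurable borel"
  shows "integral\<^sup>L lborel (\<lambda>x. f (a + c *\<^sub>R x)) = (1 / \<bar>c\<bar> ^ DIM('a)) *\<^sub>R integral\<^sup>L lborel f"
proof -
  let ?D = "distr lborel borel (\<lambda>x. a + c *\<^sub>R x)"
  have L: "lborel = density ?D (\<lambda>_. ennreal (\<bar>c\<bar> ^ DIM('a)))"
    using lborel_affine[OF assms(1), of a] by (simp add: ennreal_power)
  have "integral\<^sup>L lborel f = integral\<^sup>L ?D (\<lambda>x. (\<bar>c\<bar> ^ DIM('a)) *\<^sub>R f x)"
    by (subst L, rule integral_density) (use f in auto)
  also have "\<dots> = (\<bar>c\<bar> ^ DIM('a)) *\<^sub>R integral\<^sup>L lborel (\<lambda>x. f (a + c *\<^sub>R x))"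
    by (subst integral_distr) (use f in auto)
  finally show ?thesis using assms(1) by simp
qed

lemma measure_affine_image:
  fixes A :: "'a::euclidean_space set"
  assumes "c > 0" "A \<in> sets borel"
  shows "(\<lambda>x. a + c *\<^sub>R x) ` A \<in> sets borel"
    and "measure lborel ((\<lambda>x. a + c *\<^sub>R x) ` A) = c ^ DIM('a) * measure lborel A"
proof -
  let ?B = "(\<lambda>x. a + c *\<^sub>R x) ` A"
  have B: "?B = (\<lambda>x. (- (1 / c)) *\<^sub>R a + (1 / c) *\<^sub>R x) -` A"
  proof (intro set_eqI iffI)
    fix y assume "y \<in> (\<lambda>x. (- (1 / c)) *\<^sub>R a + (1 / c) *\<^sub>R x) -` A"
    moreover have "y = a + c *\<^sub>R ((- (1 / c)) *\<^sub>R a + (1 / c) *\<^sub>R y)"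
      using assms(1) by (simp add: algebra_simps)
    ultimately show "y \<in> ?B" by blast
  qed (use assms in \<open>auto simp: algebra_simps\<close>)
  have "(\<lambda>x. (- (1 / c)) *\<^sub>R a + (1 / c) *\<^sub>R x) \<in> borel_measurable borel" by measurable
  from measurable_sets[OF this assms(2)] show S: "?B \<in> sets borel" by (simp add: B)
  have "measure lborel ?B = integral\<^sup>L lborel (\<lambda>x. indicat_real A ((- (1 / c)) *\<^sub>R a + (1 / c) *\<^sub>R x))"
  proof -
    have "measure lborel ?B = integral\<^sup>L lborel (indicat_real ?B)" by simp
    also have "indicat_real ?B = (\<lambda>x. indicat_real A ((- (1 / c)) *\<^sub>R a + (1 / c) *\<^sub>R x))"
      unfolding B by (auto simp: indicator_def)
    finally show ?thesis .
  qed
  also have "\<dots> = c ^ DIM('a) * measure lborel A"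
    using assms by (subst integral_lborel_affine) (auto simp: power_divide)
  finally show "measure lborel ?B = c ^ DIM('a) * measure lborel A" .
qed

lemma compact_support_bounded:
  fixes f :: "'a::euclidean_space \<Rightarrow> 'b::real_normed_vector"
  assumes "continuous_on UNIV f" "compact K" "\<And>x. x \<notin> K \<Longrightarrow> f x = 0"
  obtains B where "B \<ge> 0" "\<And>x. norm (f x) \<le> B"
proof -
  have "bounded (f ` K)"
    by (intro compact_imp_bounded compact_continuous_image continuous_on_subset[OF assms(1)] assms(2)) auto
  then obtain B where "B > 0" "\<And>x. x \<in> K \<Longrightarrow> norm (f x) \<le> B" unfolding bounded_pos by auto
  with that[of B] assms(3) show ?thesis by (metis less_imp_le norm_zero)
qed

lemma abs_inner_le: "norm v \<le> L \<Longrightarrow> \<bar>v \<bullet> h\<bar> \<le> L * norm h"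
  using Cauchy_Schwarz_ineq2[of v h] mult_right_mono[of "norm v" L "norm h"] by simp

lemma Ck_1_lipschitz:
  fixes f :: "'a::euclidean_space \<Rightarrow> real"
  assumes "Ck 1 f" "\<And>x. norm (grad f x) \<le> L"
  shows "\<bar>f x - f y\<bar> \<le> L * norm (x - y)"
proof -
  have "norm (f x - f y) \<le> L * norm (x - y)"
  proof (rule differentiable_bound[of UNIV])
    show "(f has_derivative (\<lambda>h. grad f z \<bullet> h)) (at z within UNIV)" for z
      using assms(1) by (simp add: Ck_1_has_derivative)
    show "onorm (\<lambda>h. grad f z \<bullet> h) \<le> L" for z
      using assms(2)[of z] by (intro onorm_le) (auto intro: abs_inner_le)
  qed auto
  then show ?thesis by simp
qed

section \<open>Differentiation of convolutions\<close>

lemma convolution_integrable: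
  fixes k f :: "'a::euclidean_space \<Rightarrow> real"
  assumes "continuous_on UNIV k" "\<And>x. \<bar>k x\<bar> \<le> B" "integrable lborel f"
  shows "integrable lborel (\<lambda>y. k (x - y) * f y)"
proof (rule Bochner_Integration.integrable_bound)
  show "integrable lborel (\<lambda>y. B * f y)" using assms(3) by simp
  have [measurable]: "k \<in> borel_measurable borel" using assms(1) by (rule borel_measurable_continuous_onI)
  have [measurable]: "f \<in> borel_measurable borel" using assms(3) by simp
  show "(\<lambda>y. k (x - y) * f y) \<in> borel_measurable lborel" by measurable
  show "AE y in lborel. norm (k (x - y) * f y) \<le> norm (B * f y)"
  proof (intro AE_I2)
    fix y show "norm (k (x - y) * f y) \<le> norm (B * f y)"
      using assms(2)[of "x - y"] by (simp add: abs_mult mult_right_mono)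
  qed
qed

text \<open>Dominated convergence: \<open>k\<close> is \<open>L\<close>-Lipschitz, so the remainder
  of the first-order expansion, divided by the norm of the increment, is at most
  \<open>2 * L\<close>. Compact support of \<open>k\<close> is not assumed, because the Newton
  kernel is to be inserted as well as mollifiers.\<close>

lemma convolution_has_derivative:
  fixes k f :: "'a::euclidean_space \<Rightarrow> real"
  assumes k: "Ck 1 k" and B: "\<And>x. \<bar>k x\<bar> \<le> B" and L: "\<And>x. norm (grad k x) \<le> L"
    and f: "integrable lborel f"
  shows "((\<lambda>x. \<integral>y. k (x - y) * f y \<partial>lborel) has_derivative
           (\<lambda>h. \<integral>y. (grad k (x - y) \<bullet> h) * f y \<partial>lborel)) (at x)"
proof -
  have kc: "continuous_on UNIV k" and gc: "continuous_on UNIV (grad k)"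
    using k by (auto simp: Ck_1_continuous Ck_1_continuous_grad)
  have [measurable]: "k \<in> borel_measurable borel" "grad k \<in> borel_measurable borel" "f \<in> borel_measurable borel"
    using kc gc f by (auto intro: borel_measurable_continuous_onI)
  have L0: "L \<ge> 0" using L[of 0] norm_ge_zero order_trans by blast
  have int: "integrable lborel (\<lambda>y. k (z - y) * f y)" for z
    by (rule convolution_integrable[OF kc B f])
  have gb: "\<bar>grad k z \<bullet> h\<bar> \<le> L * norm h" for z h
    using L[of z] by (rule abs_inner_le)
  have intg: "integrable lborel (\<lambda>y. (grad k (x - y) \<bullet> h) * f y)" for h
    by (rule convolution_integrable[of "\<lambda>z. grad k z \<bullet> h", OF _ gb f]) (intro continuous_intros gc)
  have lin: "bounded_linear (\<lambda>h. \<integral>y. (grad k (x - y) \<bullet> h) * f y \<partial>lborel)"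
  proof (rule bounded_linear_intro[where K = "\<integral>y. L * \<bar>f y\<bar> \<partial>lborel"])
    show "norm (\<integral>y. grad k (x - y) \<bullet> h * f y \<partial>lborel) \<le> norm h * (\<integral>y. L * \<bar>f y\<bar> \<partial>lborel)" for h
    proof -
      have "norm (\<integral>y. grad k (x - y) \<bullet> h * f y \<partial>lborel) \<le> (\<integral>y. norm h * (L * \<bar>f y\<bar>) \<partial>lborel)"
      proof (intro order_trans[OF integral_norm_bound] integral_mono)
        show "norm (grad k (x - y) \<bullet> h * f y) \<le> norm h * (L * \<bar>f y\<bar>)" for y
          using mult_right_mono[OF gb[of "x - y" h], of "\<bar>f y\<bar>"] by (simp add: abs_mult mult_ac)
      qed (use intg f in auto)
      then show ?thesis by simp
    qed
  qed (use intg in \<open>simp_all add: inner_add_right distrib_right mult.assoc\<close>)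
  have lim: "((\<lambda>h. \<integral>y. (k (x + h - y) - k (x - y) - grad k (x - y) \<bullet> h) / norm h * f y \<partial>lborel) \<longlongrightarrow> 0) (at 0)"
    unfolding tendsto_at_iff_sequentially comp_def
  proof (intro allI impI)
    fix X :: "nat \<Rightarrow> 'a" assume X: "\<forall>i. X i \<in> UNIV - {0}" "X \<longlonglongrightarrow> 0"
    have X': "filterlim X (at 0) sequentially"
      using X by (auto simp: filterlim_at)
    have "(\<lambda>i. \<integral>y. (k (x + X i - y) - k (x - y) - grad k (x - y) \<bullet> X i) / norm (X i) * f y \<partial>lborel)
        \<longlonglongrightarrow> (\<integral>y. 0 \<partial>(lborel::'a measure))"
    proof (rule integral_dominated_convergence)
      show "integrable lborel (\<lambda>y. 2 * L * \<bar>f y\<bar>)" using f by simp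
      show "AE y in lborel. (\<lambda>i. (k (x + X i - y) - k (x - y) - grad k (x - y) \<bullet> X i) / norm (X i) * f y) \<longlonglongrightarrow> 0"
      proof (intro AE_I2 tendsto_mult_left_zero)
        fix y
        have "((\<lambda>h. norm (k (x - y + h) - k (x - y) - grad k (x - y) \<bullet> h) / norm h) \<longlongrightarrow> 0) (at 0)"
          using Ck_1_has_derivative[OF k, of "x - y"] by (simp add: has_derivative_at)
        then have "((\<lambda>i. norm (k (x - y + X i) - k (x - y) - grad k (x - y) \<bullet> X i) / norm (X i)) \<longlonglongrightarrow> 0)"
          using X' filterlim_compose by blast
        then have "((\<lambda>i. norm ((k (x + X i - y) - k (x - y) - grad k (x - y) \<bullet> X i) / norm (X i))) \<longlonglongrightarrow> 0)"
          by (simp add: algebra_simps)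
        then show "(\<lambda>i. (k (x + X i - y) - k (x - y) - grad k (x - y) \<bullet> X i) / norm (X i)) \<longlonglongrightarrow> 0"
          by (rule tendsto_norm_zero_cancel)
      qed
      show "AE y in lborel. norm ((k (x + X i - y) - k (x - y) - grad k (x - y) \<bullet> X i) / norm (X i) * f y) \<le> 2 * L * \<bar>f y\<bar>" for i
      proof (intro AE_I2)
        fix y
        have "X i \<noteq> 0" using X by auto
        have "\<bar>k (x + X i - y) - k (x - y)\<bar> \<le> L * norm (X i)"
          using Ck_1_lipschitz[OF k L, of "x + X i - y" "x - y"] by simp
        with gb[of "x - y" "X i"] have "\<bar>k (x + X i - y) - k (x - y) - grad k (x - y) \<bullet> X i\<bar> \<le> 2 * L * norm (X i)"
          by linarith
        then have "\<bar>k (x + X i - y) - k (x - y) - grad k (x - y) \<bullet> X i\<bar> / norm (X i) \<le> 2 * L"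
          using \<open>X i \<noteq> 0\<close> by (simp add: field_simps)
        then show "norm ((k (x + X i - y) - k (x - y) - grad k (x - y) \<bullet> X i) / norm (X i) * f y) \<le> 2 * L * \<bar>f y\<bar>"
          by (simp only: real_norm_def abs_mult abs_divide abs_norm_cancel) (rule mult_right_mono, auto)
      qed
    qed measurable
    then show "(\<lambda>i. \<integral>y. (k (x + X i - y) - k (x - y) - grad k (x - y) \<bullet> X i) / norm (X i) * f y \<partial>lborel) \<longlonglongrightarrow> 0"
      by simp
  qed
  have eq: "((\<integral>y. k (x + h - y) * f y \<partial>lborel) - (\<integral>y. k (x - y) * f y \<partial>lborel) -
      (\<integral>y. (grad k (x - y) \<bullet> h) * f y \<partial>lborel)) / norm h =
      (\<integral>y. (k (x + h - y) - k (x - y) - grad k (x - y) \<bullet> h) / norm h * f y \<partial>lborel)" for h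
  proof -
    have "(\<integral>y. (k (x + h - y) - k (x - y) - grad k (x - y) \<bullet> h) / norm h * f y \<partial>lborel) =
       (\<integral>y. (k (x + h - y) * f y - k (x - y) * f y - (grad k (x - y) \<bullet> h) * f y) / norm h \<partial>lborel)"
      by (intro Bochner_Integration.integral_cong) (auto simp: algebra_simps diff_divide_distrib)
    also have "\<dots> = ((\<integral>y. k (x + h - y) * f y \<partial>lborel) - (\<integral>y. k (x - y) * f y \<partial>lborel) -
      (\<integral>y. (grad k (x - y) \<bullet> h) * f y \<partial>lborel)) / norm h"
      using int intg by simp
    finally show ?thesis by (rule sym)
  qed
  have "((\<lambda>h. norm ((\<integral>y. k (x + h - y) * f y \<partial>lborel) - (\<integral>y. k (x - y) * f y \<partial>lborel) -
      (\<integral>y. (grad k (x - y) \<bullet> h) * f y \<partial>lborel)) / norm h) \<longlongrightarrow> 0) (at 0)"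
    using tendsto_norm_zero[OF lim] unfolding eq[symmetric] by simp
  then show ?thesis unfolding has_derivative_at using lin by blast
qed

lemma compact_support_derivative_bounds:
  fixes \<eta> :: "'a::euclidean_space \<Rightarrow> real"
  assumes "Ck 1 \<eta>" "compact K" "\<And>x. x \<notin> K \<Longrightarrow> \<eta> x = 0"
  obtains B L where "\<And>x. \<bar>\<eta> x\<bar> \<le> B" "\<And>x. norm (grad \<eta> x) \<le> L"
proof -
  have "grad \<eta> x = 0" if "x \<notin> K" for x
    using grad_zero_nbhd[of "- K" \<eta> x] assms(2,3) that compact_imp_closed by blast
  from compact_support_bounded[OF Ck_1_continuous_grad[OF assms(1)] assms(2) this]
  obtain L where L: "\<And>x. norm (grad \<eta> x) \<le> L" by blast
  from compact_support_bounded[OF Ck_1_continuous[OF assms(1)] assms(2,3)]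
  obtain B where "\<And>x. norm (\<eta> x) \<le> B" by blast
  with L that show ?thesis by auto
qed

lemma convolution_compact_support_has_derivative:
  fixes \<eta> f :: "'a::euclidean_space \<Rightarrow> real"
  assumes "Ck 1 \<eta>" "compact K" "\<And>x. x \<notin> K \<Longrightarrow> \<eta> x = 0" "integrable lborel f"
  shows "((\<lambda>x. \<integral>y. \<eta> (x - y) * f y \<partial>lborel) has_derivative
           (\<lambda>h. \<integral>y. (grad \<eta> (x - y) \<bullet> h) * f y \<partial>lborel)) (at x)"
proof -
  from compact_support_derivative_bounds[OF assms(1-3)] obtain B L
    where "\<And>x. \<bar>\<eta> x\<bar> \<le> B" "\<And>x. norm (grad \<eta> x) \<le> L" by blast
  from convolution_has_derivative[OF assms(1) this assms(4)] show ?thesis .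
qed

text \<open>All derivatives fall on \<eta>. They are again smooth and vanish outside
  \<open>K\<close>, so the induction runs over \<eta> with \<open>f\<close> merely
  integrable.\<close>

lemma convolution_Ck:
  fixes \<eta> f :: "'a::euclidean_space \<Rightarrow> real"
  assumes "\<And>j. Ck j \<eta>" "compact K" "\<And>x. x \<notin> K \<Longrightarrow> \<eta> x = 0" and f: "integrable lborel f"
  shows "Ck n (\<lambda>x. \<integral>y. \<eta> (x - y) * f y \<partial>lborel)"
  using assms(1,3)
proof (induction n arbitrary: \<eta>)
  case 0
  show ?case unfolding Ck.simps continuous_on_eq_continuous_at[OF open_UNIV]
    using convolution_compact_support_has_derivative[OF 0(1) assms(2) 0(2) f] has_derivative_continuous
    by blast
next
  case (Suc n)
  show ?case
  proof (rule Ck_Suc_intro[OF convolution_compact_support_has_derivative[OF Suc(2) assms(2) Suc(3) f]])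
    fix b :: 'a assume b: "b \<in> Basis"
    show "Ck n (\<lambda>x. \<integral>y. (grad \<eta> (x - y) \<bullet> b) * f y \<partial>lborel)"
    proof (rule Suc.IH[of "\<lambda>z. grad \<eta> z \<bullet> b"])
      show "Ck j (\<lambda>z. grad \<eta> z \<bullet> b)" for j
        using Suc(2) b by (intro Ck_Suc_grad_inner)
      show "grad \<eta> x \<bullet> b = 0" if "x \<notin> K" for x
        using grad_zero_nbhd[of "- K" \<eta> x] assms(2) Suc(3) that compact_imp_closed by fastforce
    qed
  qed
qed

text \<open>The integrals of \<open>f (x - y)\<close> over a large ball do not depend on \<open>x\<close> near \<open>0\<close>,
  and may be differentiated under the integral sign.\<close>

lemma integral_grad_eq_0:
  fixes f :: "'a::euclidean_space \<Rightarrow> real"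
  assumes f: "Ck 1 f" and K: "compact K" "\<And>x. x \<notin> K \<Longrightarrow> f x = 0"
  shows "(\<integral>x. grad f x \<bullet> h \<partial>lborel) = 0"
proof -
  have g0: "grad f x = 0" if "x \<notin> K" for x
    using grad_zero_nbhd[of "- K" f x] K that compact_imp_closed by blast
  obtain R where R: "R > 0" "\<And>x. x \<in> K \<Longrightarrow> norm x \<le> R"
    using compact_imp_bounded[OF K(1)] unfolding bounded_pos by auto
  \<comment> \<open>An integrable substitute for the constant 1: with radius \<open>R + 1\<close> it
    equals 1 wherever \<open>f (x - y)\<close> can be nonzero for \<open>norm x < 1\<close>.\<close>
  define w where "w = indicat_real (cball (0::'a) (R + 1))"
  have w: "integrable lborel w"
    unfolding w_def using emeasure_lborel_cball_finite[of "0::'a" "R + 1"] by (intro integrable_real_indicator) auto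
  have [measurable]: "f \<in> borel_measurable borel" "grad f \<in> borel_measurable borel"
    using Ck_1_continuous[OF f] Ck_1_continuous_grad[OF f] by (auto intro: borel_measurable_continuous_onI)
  have D: "((\<lambda>x. \<integral>y. f (x - y) * w y \<partial>lborel) has_derivative
           (\<lambda>h. \<integral>y. (grad f (0 - y) \<bullet> h) * w y \<partial>lborel)) (at 0)"
    by (rule convolution_compact_support_has_derivative[OF f K w])
  have wf: "w y = 1" if "x - y \<in> K" "norm x < 1" for x y
    using R(2)[OF that(1)] that(2) norm_triangle_ineq2[of y x]
    by (auto simp: w_def norm_minus_commute)
  have "(\<integral>y. f (x - y) * w y \<partial>lborel) = integral\<^sup>L lborel f" if "norm x < 1" for x
  proof -
    have "f (x - y) * w y = f (x + (-1) *\<^sub>R y)" for y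
      using wf[of x y] K(2)[of "x - y"] that by (cases "x - y \<in> K") auto
    then show ?thesis by (simp only:) (subst integral_lborel_affine, auto)
  qed
  then have "((\<lambda>x. integral\<^sup>L lborel f) has_derivative
           (\<lambda>h. \<integral>y. (grad f (0 - y) \<bullet> h) * w y \<partial>lborel)) (at 0)"
    by (intro has_derivative_transform_within_open[OF D, of "ball 0 1"]) auto
  from has_derivative_unique[OF this has_derivative_const]
  have "(\<integral>y. (grad f (0 - y) \<bullet> h) * w y \<partial>lborel) = 0" by metis
  also have "(\<lambda>y. (grad f (0 - y) \<bullet> h) * w y) = (\<lambda>y. grad f (0 + (-1) *\<^sub>R y) \<bullet> h)"
  proof
    show "(grad f (0 - y) \<bullet> h) * w y = grad f (0 + (-1) *\<^sub>R y) \<bullet> h" for y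
      using wf[of 0 y] g0[of "0 - y"] by (cases "0 - y \<in> K") auto
  qed
  also have "(\<integral>y. grad f (0 + (-1) *\<^sub>R y) \<bullet> h \<partial>lborel) = (\<integral>x. grad f x \<bullet> h \<partial>lborel)"
    by (subst integral_lborel_affine[where f = "\<lambda>z. grad f z \<bullet> h"]) auto
  finally show ?thesis .
qed

section \<open>Integration by parts\<close>

lemma grad_mult:
  assumes "f differentiable at x" "g differentiable at x"
  shows "grad (\<lambda>x. f x * g x) x = f x *\<^sub>R grad g x + g x *\<^sub>R grad f x"
  by (rule grad_eqI)
     (auto intro!: derivative_eq_intros has_derivative_grad assms simp: inner_add_left)

text \<open>The product inherits compact support from \<open>f\<close> alone, and the integral of
  its gradient vanishes. So \<open>g\<close> may be a coordinate function or a partial derivative of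
  a potential.\<close>

lemma integration_by_parts:
  fixes f :: "'a::euclidean_space \<Rightarrow> real"
  assumes "Ck 1 f" "Ck 1 g" "compact K" "\<And>x. x \<notin> K \<Longrightarrow> f x = 0"
  shows "(\<integral>x. f x * (grad g x \<bullet> h) \<partial>lborel) = - (\<integral>x. g x * (grad f x \<bullet> h) \<partial>lborel)"
proof -
  have g0: "grad f x = 0" if "x \<notin> K" for x
    using grad_zero_nbhd[of "- K" f x] assms(3,4) that compact_imp_closed by blast
  have c: "continuous_on UNIV f" "continuous_on UNIV g" "continuous_on UNIV (grad f)" "continuous_on UNIV (grad g)"
    using assms by (auto simp: Ck_1_continuous Ck_1_continuous_grad)
  have "integrable lborel (\<lambda>x. f x * (grad g x \<bullet> h))" "integrable lborel (\<lambda>x. g x * (grad f x \<bullet> h))"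
    by (rule integrable_compact_support[OF _ assms(3)], auto intro!: continuous_intros c simp: assms(4) g0)+
  moreover have "(\<integral>x. grad (\<lambda>x. f x * g x) x \<bullet> h \<partial>lborel) = 0"
    by (rule integral_grad_eq_0[OF Ck_mult[OF assms(1,2)] assms(3)]) (simp add: assms(4))
  ultimately show ?thesis
    using Ck_1_differentiable[OF assms(1)] Ck_1_differentiable[OF assms(2)]
    by (simp add: grad_mult inner_add_left)
qed

text \<open>The derivative in the direction of the gradient is the squared norm of the gradient,
  while the Lipschitz bound allows at most \<open>L\<close> times its norm.\<close>

lemma norm_grad_le_lipschitz:
  assumes "f differentiable at x" "\<And>y. \<bar>f y - f x\<bar> \<le> L * norm (y - x)"
  shows "norm (grad f x) \<le> L"
proof (cases "grad f x = 0")
  case True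
  obtain b :: 'a where "b \<in> Basis" using nonempty_Basis by blast
  with assms(2)[of "x + b"] show ?thesis using True by (simp add: order_trans[OF abs_ge_zero])
next
  case False
  define v where "v = grad f x"
  have "((\<lambda>t. f (x + t *\<^sub>R v)) has_derivative (\<lambda>t. v \<bullet> (t *\<^sub>R v))) (at 0)"
    by (rule has_derivative_compose[where f = "\<lambda>t. x + t *\<^sub>R v" and f' = "\<lambda>t. t *\<^sub>R v"])
       (auto intro!: derivative_eq_intros has_derivative_grad assms(1) simp: v_def)
  then have "((\<lambda>t. f (x + t *\<^sub>R v)) has_real_derivative v \<bullet> v) (at 0)"
    by (simp add: has_field_derivative_def mult_commute_abs)
  then have "((\<lambda>t. (f (x + t *\<^sub>R v) - f x) / t) \<longlongrightarrow> v \<bullet> v) (at 0)"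
    by (simp add: DERIV_def)
  then have "v \<bullet> v \<le> L * norm v"
  proof (rule tendsto_upperbound)
    show "\<forall>\<^sub>F t in at 0. (f (x + t *\<^sub>R v) - f x) / t \<le> L * norm v"
      unfolding eventually_at_filter
    proof (intro always_eventually allI impI)
      fix t :: real assume "t \<noteq> 0"
      have "\<bar>(f (x + t *\<^sub>R v) - f x) / t\<bar> \<le> L * norm v"
        using assms(2)[of "x + t *\<^sub>R v"] \<open>t \<noteq> 0\<close> by (simp add: abs_divide field_simps)
      then show "(f (x + t *\<^sub>R v) - f x) / t \<le> L * norm v" by (rule abs_le_D1)
    qed
  qed auto
  moreover have "norm v > 0" using False by (simp add: v_def)
  ultimately show ?thesis by (simp add: v_def dot_square_norm power2_eq_square)
qed

text \<open>Turns distance functions into smooth competitors without increasing the Lipschitz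
  constant. Averaging against a probability density supported in the \<delta>-ball preserves
  constant bounds holding on that ball; the last two conclusions are used to locate the support of
  \<open>g\<close> and to bound it from below.\<close>

lemma lipschitz_mollification:
  fixes f :: "'a::euclidean_space \<Rightarrow> real"
  assumes lip: "\<And>x y. \<bar>f x - f y\<bar> \<le> L * norm (x - y)"
    and K: "compact K" "\<And>x. x \<notin> K \<Longrightarrow> f x = 0" and "\<delta> > 0"
  obtains g where "\<And>k. Ck k g" "\<And>x. norm (grad g x) \<le> L"
    "\<And>x c. (\<And>y. norm (y - x) < \<delta> \<Longrightarrow> f y \<ge> c) \<Longrightarrow> g x \<ge> c"
    "\<And>x c. (\<And>y. norm (y - x) < \<delta> \<Longrightarrow> f y \<le> c) \<Longrightarrow> g x \<le> c"
proof -
  obtain \<eta> :: "'a \<Rightarrow> real" where \<eta>: "\<And>k. Ck k \<eta>" "\<And>x. \<eta> x \<ge> 0" "\<And>x. norm x \<ge> \<delta> \<Longrightarrow> \<eta> x = 0"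
    and I: "integral\<^sup>L lborel \<eta> = 1"
    using mollifier_exists[OF \<open>\<delta> > 0\<close>] by metis
  obtain b :: 'a where b: "b \<in> Basis" using nonempty_Basis by blast
  have L: "L \<ge> 0" using lip[of 0 b] b by (simp add: order_trans[OF abs_ge_zero])
  have cont: "continuous_on UNIV f"
    by (rule lipschitz_on_continuous_on[of L]) (use lip L in \<open>auto simp: lipschitz_on_def dist_norm dist_real_def\<close>)
  have int_f: "integrable lborel f" by (rule integrable_compact_support[OF cont K])
  have int_\<eta>: "integrable lborel \<eta>"
    using not_integrable_integral_eq I by fastforce
  have [measurable]: "f \<in> borel_measurable borel" "\<eta> \<in> borel_measurable borel" using int_f int_\<eta> by auto
  obtain B where B: "\<And>x. \<bar>f x\<bar> \<le> B"
    using compact_support_bounded[OF cont K] by (metis real_norm_def)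
  define g where "g x = (\<integral>y. \<eta> (x - y) * f y \<partial>lborel)" for x
  have int: "integrable lborel (\<lambda>z. f (x - z) * \<eta> z)" for x
    by (rule convolution_integrable[OF cont B int_\<eta>])
  \<comment> \<open>Smoothness needs the variable \<open>x\<close> in \<eta>, the Lipschitz estimate
    and the bounds need it in \<open>f\<close>.\<close>
  have g: "g x = (\<integral>z. f (x - z) * \<eta> z \<partial>lborel)" for x
  proof -
    have "g x = (\<integral>y. (\<lambda>z. f (x - z) * \<eta> z) (x + (-1) *\<^sub>R y) \<partial>lborel)"
      by (simp add: g_def mult.commute)
    also have "\<dots> = (\<integral>z. f (x - z) * \<eta> z \<partial>lborel)"
      by (subst integral_lborel_affine) auto
    finally show ?thesis .
  qed
  have const: "(\<integral>z. c * \<eta> z \<partial>lborel) = c" for c using I by simp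
  have int_c: "integrable lborel (\<lambda>z. c * \<eta> z)" for c using int_\<eta> by simp
  have Ck: "Ck k g" for k
    unfolding g_def by (rule convolution_Ck[OF \<eta>(1) compact_cball[of 0 \<delta>] _ int_f]) (use \<eta>(3) in auto)
  have "norm (grad g x) \<le> L" for x
  proof (rule norm_grad_le_lipschitz)
    show "g differentiable at x" using Ck[of 1] by (rule Ck_1_differentiable)
    fix y
    have "g y - g x = (\<integral>z. f (y - z) * \<eta> z - f (x - z) * \<eta> z \<partial>lborel)"
      unfolding g using int by simp
    also have "\<bar>\<dots>\<bar> \<le> (\<integral>z. (L * norm (y - x)) * \<eta> z \<partial>lborel)"
    proof (rule order_trans[OF integral_abs_bound], rule integral_mono)
      fix z
      have "\<bar>f (y - z) - f (x - z)\<bar> * \<eta> z \<le> (L * norm (y - x)) * \<eta> z"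
        using lip[of "y - z" "x - z"] \<eta>(2)[of z] by (intro mult_right_mono) auto
      then show "\<bar>f (y - z) * \<eta> z - f (x - z) * \<eta> z\<bar> \<le> (L * norm (y - x)) * \<eta> z"
        using \<eta>(2)[of z] by (simp add: abs_mult flip: left_diff_distrib)
    qed (use int int_c in auto)
    finally show "\<bar>g y - g x\<bar> \<le> L * norm (y - x)" unfolding const .
  qed
  moreover have "g x \<ge> c" if c: "\<And>y. norm (y - x) < \<delta> \<Longrightarrow> f y \<ge> c" for x c
  proof -
    have "c * \<eta> z \<le> f (x - z) * \<eta> z" for z
      using \<eta>(2,3)[of z] c[of "x - z"] by (cases "norm z < \<delta>") (auto intro: mult_right_mono)
    then have "(\<integral>z. c * \<eta> z \<partial>lborel) \<le> g x" unfolding g using int int_c by (intro integral_mono) auto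
    then show ?thesis unfolding const .
  qed
  moreover have "g x \<le> c" if c: "\<And>y. norm (y - x) < \<delta> \<Longrightarrow> f y \<le> c" for x c
  proof -
    have "f (x - z) * \<eta> z \<le> c * \<eta> z" for z
      using \<eta>(2,3)[of z] c[of "x - z"] by (cases "norm z < \<delta>") (auto intro: mult_right_mono)
    then have "g x \<le> (\<integral>z. c * \<eta> z \<partial>lborel)" unfolding g using int int_c by (intro integral_mono) auto
    then show ?thesis unfolding const .
  qed
  ultimately show thesis using that Ck by blast
qed

section \<open>Convergence in \<open>L\<^sup>2\<close>\<close>

text \<open>With increments of size \<open>4\<^sup>-\<^sup>n\<close> in \<open>L\<^sup>2\<close>, the function
  \<open>S = \<Sum>n. 4^n * \<bar>F (n + 1) - F n\<bar>\<^sup>2\<close> is integrable and \<open>2\<^sup>-\<^sup>n * sqrt S\<close> bounds the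
  increments pointwise.\<close>

lemma L2_rapid_Cauchy_converges:
  fixes F :: "nat \<Rightarrow> 'a \<Rightarrow> 'b::euclidean_space"
  assumes meas: "\<And>n. F n \<in> borel_measurable M"
    and int0: "integrable M (\<lambda>x. (norm (F 0 x))\<^sup>2)"
    and int: "\<And>n. integrable M (\<lambda>x. (norm (F (Suc n) x - F n x))\<^sup>2)"
    and bound: "\<And>n. (\<integral>x. (norm (F (Suc n) x - F n x))\<^sup>2 \<partial>M) \<le> C * (1 / 16) ^ n"
  obtains G where "G \<in> borel_measurable M" "integrable M (\<lambda>x. (norm (G x))\<^sup>2)"
    "\<And>n. integrable M (\<lambda>x. (norm (F n x - G x))\<^sup>2)"
    "(\<lambda>n. \<integral>x. (norm (F n x - G x))\<^sup>2 \<partial>M) \<longlonglongrightarrow> 0"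
    "\<And>x. (\<And>n. F n x = 0) \<Longrightarrow> G x = 0"
proof -
  note [measurable] = meas
  define a where "a n x = 4 ^ n * (norm (F (Suc n) x - F n x))\<^sup>2" for n x
  have a_nonneg: "a n x \<ge> 0" for n x by (simp add: a_def)
  have a_int: "integrable M (a n)" for n unfolding a_def using int by simp
  have a_bound: "(\<integral>x. a n x \<partial>M) \<le> C * (1 / 4) ^ n" for n
  proof -
    have "(\<integral>x. a n x \<partial>M) \<le> 4 ^ n * (C * (1 / 16) ^ n)"
      unfolding a_def using bound[of n] by simp
    also have "\<dots> = C * (4 * (1 / 16)) ^ n" by (simp only: power_mult_distrib mult_ac)
    finally show ?thesis by simp
  qed
  have summ: "summable (\<lambda>n. \<integral>x. a n x \<partial>M)"
  proof (rule summable_comparison_test')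
    show "summable (\<lambda>n. C * (1 / 4 :: real) ^ n)" by (intro summable_mult summable_geometric) auto
    show "norm (\<integral>x. a n x \<partial>M) \<le> C * (1 / 4) ^ n" if "n \<ge> 0" for n
      using a_bound[of n] a_nonneg by (simp add: integral_nonneg_AE)
  qed
  have "(\<integral>\<^sup>+x. (\<Sum>n. ennreal (a n x)) \<partial>M) = (\<Sum>n. \<integral>\<^sup>+x. ennreal (a n x) \<partial>M)"
    by (rule nn_integral_suminf) (auto simp: a_def)
  also have "\<dots> = (\<Sum>n. ennreal (\<integral>x. a n x \<partial>M))"
    by (intro arg_cong[of _ _ suminf] ext nn_integral_eq_integral a_int) (simp add: a_nonneg)
  also have "\<dots> = ennreal (\<Sum>n. \<integral>x. a n x \<partial>M)"
    using summ by (intro suminf_ennreal2) (auto simp: a_nonneg)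
  also have "\<dots> \<noteq> \<infinity>" by simp
  finally have "AE x in M. (\<Sum>n. ennreal (a n x)) \<noteq> \<infinity>"
    by (intro nn_integral_PInf_AE) (auto simp: a_def)
  then have AE_summ: "AE x in M. summable (\<lambda>n. a n x)"
    by eventually_elim (auto intro!: summable_suminf_not_top a_nonneg)
  define S where "S x = (\<Sum>n. a n x)" for x
  have S_int: "integrable M S"
    unfolding S_def using AE_summ summ a_nonneg by (intro integrable_suminf a_int) auto
  \<comment> \<open>On the null set of divergence this is whatever \<open>lim\<close> returns. It is
    measurable in any case, and it is 0 where all \<open>F n\<close> vanish, which keeps limits of
    test functions supported in their domain.\<close>
  define G where "G x = lim (\<lambda>n. F n x)" for x
  have G_meas: "G \<in> borel_measurable M" unfolding G_def by measurable
  have AE_bound: "AE x in M. (\<forall>n. (norm (F n x - G x))\<^sup>2 \<le> 4 * (1 / 4) ^ n * S x)"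
    using AE_summ
  proof eventually_elim
    case (elim x)
    define s where "s = sqrt (S x)"
    have S0: "S x \<ge> 0" unfolding S_def using elim a_nonneg by (intro suminf_nonneg) auto
    have inc: "norm (F (Suc n) x - F n x) \<le> (1 / 2) ^ n * s" for n
    proof -
      have "a n x \<le> S x" unfolding S_def using sum_le_suminf[OF elim, of "{n}"] a_nonneg by auto
      then have "(2 ^ n * norm (F (Suc n) x - F n x))\<^sup>2 \<le> S x"
        by (simp add: a_def power_mult_distrib power_even_eq[symmetric] mult.commute[of n 2] power_mult)
      then have "2 ^ n * norm (F (Suc n) x - F n x) \<le> s" unfolding s_def by (rule real_le_rsqrt)
      then show ?thesis by (simp add: field_simps)
    qed
    have geo: "summable (\<lambda>n. (1 / 2) ^ n * s)" by (intro summable_mult2 summable_geometric) auto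
    have sum_inc: "summable (\<lambda>n. F (Suc n) x - F n x)"
      by (rule summable_comparison_test'[OF geo]) (rule inc)
    then have "convergent (\<lambda>n. F 0 x + (\<Sum>i<n. F (Suc i) x - F i x))"
      unfolding summable_iff_convergent by (intro convergent_add convergent_const)
    moreover have "F 0 x + (\<Sum>i<n. F (Suc i) x - F i x) = F n x" for n
      using sum_lessThan_telescope[of "\<lambda>i. F i x" n] by simp
    ultimately have "convergent (\<lambda>n. F n x)" by simp
    then have lim: "(\<lambda>n. F n x) \<longlonglongrightarrow> G x" unfolding G_def by (simp add: convergent_LIMSEQ_iff)
    show ?case
    proof
      fix n
      have le: "norm (F n x - F (n + m) x) \<le> (1 / 2) ^ n * 2 * s" for m
      proof -
        have "F n x - F (n + m) x = - (\<Sum>i<m. F (Suc (n + i)) x - F (n + i) x)"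
          using sum_lessThan_telescope[of "\<lambda>i. F (n + i) x" m] by simp
        also have "norm \<dots> \<le> (\<Sum>i<m. norm (F (Suc (n + i)) x - F (n + i) x))"
          by (simp add: norm_sum)
        also have "\<dots> \<le> (\<Sum>i<m. (1 / 2) ^ (n + i) * s)" by (intro sum_mono inc)
        also have "\<dots> = (1 / 2) ^ n * s * (\<Sum>i<m. (1 / 2) ^ i)"
          by (simp add: power_add sum_distrib_left mult_ac)
        also have "\<dots> \<le> (1 / 2) ^ n * s * 2"
          using S0 sum_gp_strict[of "1 / 2 :: real" m] by (intro mult_left_mono) (auto simp: s_def)
        finally show ?thesis by (simp add: mult_ac)
      qed
      have "(\<lambda>m. norm (F n x - F (n + m) x)) \<longlonglongrightarrow> norm (F n x - G x)"
        using LIMSEQ_ignore_initial_segment[OF lim, of n]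
        by (intro tendsto_intros) (simp add: add.commute)
      then have "norm (F n x - G x) \<le> (1 / 2) ^ n * 2 * s"
        by (rule LIMSEQ_le_const2) (use le in auto)
      then have "(norm (F n x - G x))\<^sup>2 \<le> ((1 / 2) ^ n * 2 * s)\<^sup>2" by (intro power_mono) auto
      also have "\<dots> = 4 * (1 / 4) ^ n * S x"
      proof -
        have "((1 / 2) ^ n)\<^sup>2 = (1 / 4 :: real) ^ n" by (simp add: power2_eq_square flip: power_mult_distrib)
        moreover have "s\<^sup>2 = S x" using S0 by (simp add: s_def)
        ultimately show ?thesis by (simp add: power_mult_distrib)
      qed
      finally show "(norm (F n x - G x))\<^sup>2 \<le> 4 * (1 / 4) ^ n * S x" .
    qed
  qed
  note [measurable] = G_meas
  have int_diff: "integrable M (\<lambda>x. (norm (F n x - G x))\<^sup>2)" for n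
  proof (rule Bochner_Integration.integrable_bound)
    show "integrable M (\<lambda>x. 4 * (1 / 4) ^ n * S x)" using S_int by simp
    show "AE x in M. norm ((norm (F n x - G x))\<^sup>2) \<le> norm (4 * (1 / 4) ^ n * S x)"
      using AE_bound by eventually_elim (force intro: order_trans[OF _ abs_ge_self])
  qed measurable
  have "(\<lambda>n. \<integral>x. (norm (F n x - G x))\<^sup>2 \<partial>M) \<longlonglongrightarrow> 0"
  proof (rule tendsto_sandwich[OF _ _ tendsto_const])
    have "(\<integral>x. (norm (F n x - G x))\<^sup>2 \<partial>M) \<le> (\<integral>x. 4 * (1 / 4) ^ n * S x \<partial>M)" for n
      using AE_bound S_int int_diff[of n] by (intro integral_mono_AE) auto
    then show "\<forall>\<^sub>F n in sequentially. (\<integral>x. (norm (F n x - G x))\<^sup>2 \<partial>M) \<le> 4 * (1 / 4) ^ n * (\<integral>x. S x \<partial>M)"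
      by simp
    have "(\<lambda>n. 4 * (1 / 4) ^ n * (\<integral>x. S x \<partial>M)) \<longlonglongrightarrow> 4 * 0 * (\<integral>x. S x \<partial>M)"
      by (intro tendsto_intros LIMSEQ_realpow_zero) auto
    then show "(\<lambda>n. 4 * (1 / 4) ^ n * (\<integral>x. S x \<partial>M)) \<longlonglongrightarrow> 0" by simp
  qed simp
  moreover have "integrable M (\<lambda>x. (norm (G x))\<^sup>2)"
  proof (rule Bochner_Integration.integrable_bound)
    show "integrable M (\<lambda>x. 2 * (norm (F 0 x))\<^sup>2 + 2 * (norm (F 0 x - G x))\<^sup>2)"
      using int0 int_diff[of 0] by simp
    show "AE x in M. norm ((norm (G x))\<^sup>2) \<le> norm (2 * (norm (F 0 x))\<^sup>2 + 2 * (norm (F 0 x - G x))\<^sup>2)"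
    proof (intro AE_I2)
      fix x
      have "norm (G x) \<le> norm (F 0 x) + norm (F 0 x - G x)"
        using norm_triangle_ineq4[of "F 0 x" "F 0 x - G x"] by simp
      then have "(norm (G x))\<^sup>2 \<le> (norm (F 0 x) + norm (F 0 x - G x))\<^sup>2" by (intro power_mono) auto
      also have "\<dots> \<le> 2 * (norm (F 0 x))\<^sup>2 + 2 * (norm (F 0 x - G x))\<^sup>2"
        using sum_squares_bound[of "norm (F 0 x)" "norm (F 0 x - G x)"] by (simp add: power2_sum)
      finally show "norm ((norm (G x))\<^sup>2) \<le> norm (2 * (norm (F 0 x))\<^sup>2 + 2 * (norm (F 0 x - G x))\<^sup>2)"
        by simp
    qed
  qed measurable
  moreover have "G x = 0" if "\<And>n. F n x = 0" for x using that by (simp add: G_def)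
  ultimately show thesis using that G_meas int_diff by blast
qed

lemma integrable_inner_L2:
  fixes f g :: "'a \<Rightarrow> 'b::euclidean_space"
  assumes [measurable]: "f \<in> borel_measurable M" "g \<in> borel_measurable M"
    and "integrable M (\<lambda>x. (norm (f x))\<^sup>2)" "integrable M (\<lambda>x. (norm (g x))\<^sup>2)"
  shows "integrable M (\<lambda>x. f x \<bullet> g x)"
proof (rule Bochner_Integration.integrable_bound)
  show "integrable M (\<lambda>x. (norm (f x))\<^sup>2 + (norm (g x))\<^sup>2)" using assms by simp
  show "AE x in M. norm (f x \<bullet> g x) \<le> norm ((norm (f x))\<^sup>2 + (norm (g x))\<^sup>2)"
  proof (intro AE_I2)
    fix x
    have "norm (f x) * norm (g x) \<le> (norm (f x))\<^sup>2 + (norm (g x))\<^sup>2"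
      using sum_squares_bound[of "norm (f x)" "norm (g x)"] mult_nonneg_nonneg[OF norm_ge_zero[of "f x"] norm_ge_zero[of "g x"]]
      by linarith
    then show "norm (f x \<bullet> g x) \<le> norm ((norm (f x))\<^sup>2 + (norm (g x))\<^sup>2)"
      using Cauchy_Schwarz_ineq2[of "f x" "g x"] by simp
  qed
qed measurable

lemma integral_Cauchy_Schwarz:
  fixes f g :: "'a \<Rightarrow> 'b::euclidean_space"
  assumes meas: "f \<in> borel_measurable M" "g \<in> borel_measurable M"
    and f: "integrable M (\<lambda>x. (norm (f x))\<^sup>2)" and g: "integrable M (\<lambda>x. (norm (g x))\<^sup>2)"
  shows "(\<integral>x. f x \<bullet> g x \<partial>M)\<^sup>2 \<le> (\<integral>x. (norm (f x))\<^sup>2 \<partial>M) * (\<integral>x. (norm (g x))\<^sup>2 \<partial>M)"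
    (is "?C\<^sup>2 \<le> ?A * ?B")
proof -
  have fg: "integrable M (\<lambda>x. f x \<bullet> g x)" by (rule integrable_inner_L2[OF meas f g])
  have quad: "0 \<le> ?A - 2 * t * ?C + t\<^sup>2 * ?B" for t
  proof -
    have "0 \<le> (\<integral>x. (norm (f x - t *\<^sub>R g x))\<^sup>2 \<partial>M)" by simp
    also have "(\<lambda>x. (norm (f x - t *\<^sub>R g x))\<^sup>2) =
        (\<lambda>x. (norm (f x))\<^sup>2 - 2 * t * (f x \<bullet> g x) + t\<^sup>2 * (norm (g x))\<^sup>2)"
      unfolding power2_norm_eq_inner
      by (auto simp: inner_diff_left inner_diff_right inner_commute power2_eq_square algebra_simps)
    also have "integral\<^sup>L M \<dots> = ?A - 2 * t * ?C + t\<^sup>2 * ?B"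
      using f g fg by simp
    finally show ?thesis .
  qed
  have B: "?B \<ge> 0" by simp
  show ?thesis
  proof (cases "?B = 0")
    case True
    have "?C = 0"
    proof (rule ccontr)
      assume "?C \<noteq> 0"
      \<comment> \<open>For \<open>?B = 0\<close> the polynomial is affine in \<open>t\<close> and
        takes the value -1 here.\<close>
      with quad[of "(?A + 1) / (2 * ?C)"] True show False by simp
    qed
    with True show ?thesis by simp
  next
    case False
    with B have "?B > 0" by linarith
    then show ?thesis using quad[of "?C / ?B"] by (simp add: power2_eq_square field_simps)
  qed
qed

lemma L2_tendsto_inner:
  fixes F :: "nat \<Rightarrow> 'a \<Rightarrow> 'b::euclidean_space"
  assumes meas: "\<And>n. F n \<in> borel_measurable M" "u \<in> borel_measurable M" "h \<in> borel_measurable M"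
    and F: "\<And>n. integrable M (\<lambda>x. (norm (F n x))\<^sup>2)" and u: "integrable M (\<lambda>x. (norm (u x))\<^sup>2)"
    and h: "integrable M (\<lambda>x. (norm (h x))\<^sup>2)"
    and Fu: "\<And>n. integrable M (\<lambda>x. (norm (F n x - u x))\<^sup>2)"
    and lim: "(\<lambda>n. \<integral>x. (norm (F n x - u x))\<^sup>2 \<partial>M) \<longlonglongrightarrow> 0"
  shows "(\<lambda>n. \<integral>x. F n x \<bullet> h x \<partial>M) \<longlonglongrightarrow> (\<integral>x. u x \<bullet> h x \<partial>M)"
proof (rule LIM_zero_cancel, rule tendsto_rabs_zero_cancel, rule tendsto_sandwich[OF _ _ tendsto_const])
  let ?b = "\<lambda>n. sqrt ((\<integral>x. (norm (F n x - u x))\<^sup>2 \<partial>M) * (\<integral>x. (norm (h x))\<^sup>2 \<partial>M))"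
  have "\<bar>(\<integral>x. F n x \<bullet> h x \<partial>M) - (\<integral>x. u x \<bullet> h x \<partial>M)\<bar> \<le> ?b n" for n
  proof (rule real_le_rsqrt)
    have "(\<integral>x. F n x \<bullet> h x \<partial>M) - (\<integral>x. u x \<bullet> h x \<partial>M) = (\<integral>x. (F n x - u x) \<bullet> h x \<partial>M)"
      by (simp add: inner_diff_left integrable_inner_L2 meas F u h)
    then show "\<bar>(\<integral>x. F n x \<bullet> h x \<partial>M) - (\<integral>x. u x \<bullet> h x \<partial>M)\<bar>\<^sup>2 \<le>
        (\<integral>x. (norm (F n x - u x))\<^sup>2 \<partial>M) * (\<integral>x. (norm (h x))\<^sup>2 \<partial>M)"
      using integral_Cauchy_Schwarz[of "\<lambda>x. F n x - u x" M h] meas Fu h by simp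
  qed
  then show "\<forall>\<^sub>F n in sequentially. \<bar>(\<integral>x. F n x \<bullet> h x \<partial>M) - (\<integral>x. u x \<bullet> h x \<partial>M)\<bar> \<le> ?b n" by simp
  have "?b \<longlonglongrightarrow> sqrt (0 * (\<integral>x. (norm (h x))\<^sup>2 \<partial>M))" by (intro tendsto_intros lim)
  then show "?b \<longlonglongrightarrow> 0" by simp
qed simp

lemma L2_tendsto_norm:
  fixes F :: "nat \<Rightarrow> 'a \<Rightarrow> 'b::euclidean_space"
  assumes meas: "\<And>n. F n \<in> borel_measurable M" "u \<in> borel_measurable M"
    and F: "\<And>n. integrable M (\<lambda>x. (norm (F n x))\<^sup>2)" and u: "integrable M (\<lambda>x. (norm (u x))\<^sup>2)"
    and Fu: "\<And>n. integrable M (\<lambda>x. (norm (F n x - u x))\<^sup>2)"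
    and lim: "(\<lambda>n. \<integral>x. (norm (F n x - u x))\<^sup>2 \<partial>M) \<longlonglongrightarrow> 0"
  shows "(\<lambda>n. \<integral>x. (norm (F n x))\<^sup>2 \<partial>M) \<longlonglongrightarrow> (\<integral>x. (norm (u x))\<^sup>2 \<partial>M)"
proof -
  have "(norm (F n x))\<^sup>2 = (norm (F n x - u x))\<^sup>2 + 2 * (F n x \<bullet> u x) - (norm (u x))\<^sup>2" for n x
    by (simp add: power2_norm_eq_inner inner_diff_left inner_diff_right inner_commute)
  then have "(\<integral>x. (norm (F n x))\<^sup>2 \<partial>M) =
      (\<integral>x. (norm (F n x - u x))\<^sup>2 + 2 * (F n x \<bullet> u x) - (norm (u x))\<^sup>2 \<partial>M)" for n
    by presburger
  moreover have "(\<integral>x. (norm (F n x - u x))\<^sup>2 + 2 * (F n x \<bullet> u x) - (norm (u x))\<^sup>2 \<partial>M) =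
      (\<integral>x. (norm (F n x - u x))\<^sup>2 \<partial>M) + 2 * (\<integral>x. F n x \<bullet> u x \<partial>M)
      - (\<integral>x. (norm (u x))\<^sup>2 \<partial>M)" for n
    using integrable_inner_L2[OF meas(1)[of n] meas(2) F u] u Fu by simp
  moreover have "(\<lambda>n. (\<integral>x. (norm (F n x - u x))\<^sup>2 \<partial>M) + 2 * (\<integral>x. F n x \<bullet> u x \<partial>M) - (\<integral>x. (norm (u x))\<^sup>2 \<partial>M))
      \<longlonglongrightarrow> 0 + 2 * (\<integral>x. u x \<bullet> u x \<partial>M) - (\<integral>x. (norm (u x))\<^sup>2 \<partial>M)"
    by (intro tendsto_intros lim L2_tendsto_inner[OF meas meas(2) F u u Fu lim])
  ultimately show ?thesis by (simp add: power2_norm_eq_inner)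
qed

section \<open>The torsion function\<close>

lemma grad_lincomb:
  assumes "f differentiable at x" "g differentiable at x"
  shows "grad (\<lambda>x. a * f x + b * g x) x = a *\<^sub>R grad f x + b *\<^sub>R grad g x"
  by (rule grad_eqI)
     (auto intro!: derivative_eq_intros has_derivative_grad assms simp: inner_add_left)

lemma compact_support_inI:
  assumes "compact K" "K \<subseteq> \<Omega>" "\<And>x. x \<notin> K \<Longrightarrow> f x = 0"
  shows "compact_support_in \<Omega> f"
proof -
  have "closure {x. f x \<noteq> 0} \<subseteq> K"
    using assms by (intro closure_minimal compact_imp_closed) auto
  then show ?thesis
    using assms compact_closure bounded_subset[OF compact_imp_bounded[OF assms(1)]] closure_subset
    unfolding compact_support_in_def by (metis compact_eq_bounded_closed closed_closure order_trans)
qed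

lemma compact_support_inE:
  assumes "compact_support_in \<Omega> f"
  obtains K where "compact K" "K \<subseteq> \<Omega>" "\<And>x. x \<notin> K \<Longrightarrow> f x = 0" "\<And>x. x \<notin> K \<Longrightarrow> grad f x = 0"
proof
  show "f x = 0" if "x \<notin> closure {x. f x \<noteq> 0}" for x
    using that closure_subset[of "{x. f x \<noteq> 0}"] by auto
qed (use assms grad_outside_support in \<open>auto simp: compact_support_in_def\<close>)

lemma test_function_Ck: "test_function \<Omega> \<phi> \<Longrightarrow> Ck k \<phi>"
  by (simp add: test_function_def)

lemma test_function_support:
  assumes "test_function \<Omega> \<phi>"
  obtains K where "compact K" "K \<subseteq> \<Omega>" "\<And>x. x \<notin> K \<Longrightarrow> \<phi> x = 0" "\<And>x. x \<notin> K \<Longrightarrow> grad \<phi> x = 0"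
  using assms compact_support_inE unfolding test_function_def by metis

lemma test_function_outside: "test_function \<Omega> \<phi> \<Longrightarrow> x \<notin> \<Omega> \<Longrightarrow> \<phi> x = 0"
  and grad_test_function_outside: "test_function \<Omega> \<phi> \<Longrightarrow> x \<notin> \<Omega> \<Longrightarrow> grad \<phi> x = 0"
  by (metis subsetD test_function_support)+

lemma test_function_lincomb:
  assumes "test_function \<Omega> \<phi>" "test_function \<Omega> \<psi>"
  shows "test_function \<Omega> (\<lambda>x. a * \<phi> x + b * \<psi> x)"
proof -
  obtain K L where "compact K" "K \<subseteq> \<Omega>" "\<And>x. x \<notin> K \<Longrightarrow> \<phi> x = 0"
    "compact L" "L \<subseteq> \<Omega>" "\<And>x. x \<notin> L \<Longrightarrow> \<psi> x = 0"
    using test_function_support[OF assms(1)] test_function_support[OF assms(2)] by metis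
  then have "compact_support_in \<Omega> (\<lambda>x. a * \<phi> x + b * \<psi> x)"
    by (intro compact_support_inI[of "K \<union> L"]) auto
  with assms show ?thesis unfolding test_function_def by (intro conjI allI Ck_add Ck_cmult) blast+
qed

lemma test_function_0: "test_function \<Omega> (\<lambda>x. 0)"
  unfolding test_function_def by (auto intro: Ck_const compact_support_inI[of "{}"])

lemma
  assumes "Ck 1 \<phi>" "compact_support_in \<Omega> \<phi>"
  shows C1c_integrable: "integrable lborel \<phi>"
    and C1c_integrable_square: "integrable lborel (\<lambda>x. (\<phi> x)\<^sup>2)"
    and C1c_integrable_grad_square: "integrable lborel (\<lambda>x. (norm (grad \<phi> x))\<^sup>2)"
    and C1c_measurable: "\<phi> \<in> borel_measurable borel"
    and C1c_grad_measurable: "grad \<phi> \<in> borel_measurable borel"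
proof -
  obtain K where K: "compact K" "\<And>x. x \<notin> K \<Longrightarrow> \<phi> x = 0" "\<And>x. x \<notin> K \<Longrightarrow> grad \<phi> x = 0"
    using compact_support_inE[OF assms(2)] by metis
  have c: "continuous_on UNIV \<phi>" "continuous_on UNIV (grad \<phi>)"
    using assms by (auto intro: Ck_1_continuous Ck_1_continuous_grad)
  show "integrable lborel \<phi>" "integrable lborel (\<lambda>x. (\<phi> x)\<^sup>2)" "integrable lborel (\<lambda>x. (norm (grad \<phi> x))\<^sup>2)"
    by (rule integrable_compact_support[OF _ K(1)], auto intro!: continuous_intros c simp: K)+
  show "\<phi> \<in> borel_measurable borel" "grad \<phi> \<in> borel_measurable borel"
    using c by (auto intro: borel_measurable_continuous_onI)
qed

lemma test_function_C1c: "test_function \<Omega> \<phi> \<Longrightarrow> Ck 1 \<phi>" "test_function \<Omega> \<phi> \<Longrightarrow> compact_support_in \<Omega> \<phi>"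
  by (simp_all add: test_function_def del: Ck.simps)

lemma
  assumes "test_function \<Omega> \<phi>"
  shows test_function_integrable: "integrable lborel \<phi>" "integrable lborel (\<lambda>x. (\<phi> x)\<^sup>2)"
      "integrable lborel (\<lambda>x. (norm (grad \<phi> x))\<^sup>2)"
    and test_function_measurable: "\<phi> \<in> borel_measurable borel" "grad \<phi> \<in> borel_measurable borel"
  using C1c_integrable C1c_integrable_square C1c_integrable_grad_square C1c_measurable C1c_grad_measurable
    test_function_C1c[OF assms] by blast+

section \<open>Dirichlet integral and torsion energy\<close>

definition dirichlet :: "('a::euclidean_space \<Rightarrow> real) \<Rightarrow> real" where
  "dirichlet \<phi> = (\<integral>x. (norm (grad \<phi> x))\<^sup>2 \<partial>lborel)"

text \<open>Normalised so that the maximum is the rigidity itself: for the torsion function the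
  integral equals the Dirichlet integral, and the difference leaves the integral once.\<close>

definition torsion_energy :: "('a::euclidean_space \<Rightarrow> real) \<Rightarrow> real" where
  "torsion_energy \<phi> = 2 * integral\<^sup>L lborel \<phi> - dirichlet \<phi>"

lemma dirichlet_nonneg: "dirichlet \<phi> \<ge> 0"
  by (simp add: dirichlet_def)

lemma grad_inner_coordinate: "grad (\<lambda>x. x \<bullet> b) x = b"
  by (rule grad_eqI) (auto intro!: derivative_eq_intros simp: inner_commute)

text \<open>The field \<open>V x = (\<Sum>b. w b * (x \<bullet> b) * b)\<close> has divergence one, so the integral of \<open>\<phi>\<close>
  is minus that of \<open>V \<bullet> grad \<phi>\<close>.\<close>

lemma torsion_energy_le:
  fixes \<phi> :: "'a::euclidean_space \<Rightarrow> real"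
  assumes \<phi>: "Ck 1 \<phi>" "compact_support_in \<Omega> \<phi>" and \<Omega>: "\<Omega> \<in> sets borel" "bounded \<Omega>"
    and w: "(\<Sum>b\<in>Basis. w b) = 1"
    and h: "\<And>x. x \<in> \<Omega> \<Longrightarrow> norm (\<Sum>b\<in>Basis. (w b * (x \<bullet> b)) *\<^sub>R b) \<le> h"
  shows "torsion_energy \<phi> \<le> h\<^sup>2 * measure lborel \<Omega>"
proof -
  obtain K where K: "compact K" "K \<subseteq> \<Omega>" "\<And>x. x \<notin> K \<Longrightarrow> \<phi> x = 0" "\<And>x. x \<notin> K \<Longrightarrow> grad \<phi> x = 0"
    using compact_support_inE[OF \<phi>(2)] by metis
  define V where "V x = (\<Sum>b\<in>Basis. (w b * (x \<bullet> b)) *\<^sub>R b)" for x :: 'a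
  have c: "continuous_on UNIV (grad \<phi>)" "continuous_on UNIV V"
    unfolding V_def by (intro continuous_intros Ck_1_continuous_grad \<phi>)+
  have intV: "integrable lborel (\<lambda>x. V x \<bullet> grad \<phi> x)"
    by (rule integrable_compact_support[OF _ K(1)]) (auto intro!: continuous_intros c simp: K)
  have ib: "integrable lborel (\<lambda>x. w b * ((x \<bullet> b) * (grad \<phi> x \<bullet> b)))" for b
    by (rule integrable_compact_support[OF _ K(1)]) (auto intro!: continuous_intros c simp: K)
  have "integral\<^sup>L lborel \<phi> = (\<Sum>b\<in>Basis. w b * (\<integral>x. \<phi> x * (grad (\<lambda>x. x \<bullet> b) x \<bullet> b) \<partial>lborel))"
    by (simp add: grad_inner_coordinate inner_same_Basis w flip: sum_distrib_right)
  also have "\<dots> = (\<Sum>b\<in>Basis. - (\<integral>x. w b * ((x \<bullet> b) * (grad \<phi> x \<bullet> b)) \<partial>lborel))"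
    using integration_by_parts[OF \<phi>(1) Ck_inner K(1,3)] by simp
  also have "\<dots> = - (\<integral>x. (\<Sum>b\<in>Basis. w b * ((x \<bullet> b) * (grad \<phi> x \<bullet> b))) \<partial>lborel)"
    using ib by (subst Bochner_Integration.integral_sum) (auto simp: sum_negf)
  also have "(\<lambda>x. \<Sum>b\<in>Basis. w b * ((x \<bullet> b) * (grad \<phi> x \<bullet> b))) = (\<lambda>x. V x \<bullet> grad \<phi> x)"
    by (simp only: V_def inner_sum_left inner_scaleR_left) (simp add: inner_commute mult.assoc)
  finally have I: "integral\<^sup>L lborel \<phi> = - (\<integral>x. V x \<bullet> grad \<phi> x \<partial>lborel)" .
  have fin: "emeasure lborel \<Omega> < \<infinity>" using \<Omega>(2) by (rule emeasure_bounded_finite)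
  have int_ind: "integrable lborel (\<lambda>x. h\<^sup>2 * indicat_real \<Omega> x)"
    using fin \<Omega> by (intro integrable_mult_right integrable_real_indicator) auto
  have "torsion_energy \<phi> = (\<integral>x. - 2 * (V x \<bullet> grad \<phi> x) - (norm (grad \<phi> x))\<^sup>2 \<partial>lborel)"
    using intV C1c_integrable_grad_square[OF \<phi>] by (simp add: torsion_energy_def dirichlet_def I)
  also have "\<dots> \<le> (\<integral>x. h\<^sup>2 * indicat_real \<Omega> x \<partial>lborel)"
  proof (rule integral_mono)
    fix x
    show "- 2 * (V x \<bullet> grad \<phi> x) - (norm (grad \<phi> x))\<^sup>2 \<le> h\<^sup>2 * indicat_real \<Omega> x"
    proof (cases "x \<in> \<Omega>")
      case True
      have "0 \<le> (norm (V x + grad \<phi> x))\<^sup>2" by simp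
      then have "- 2 * (V x \<bullet> grad \<phi> x) - (norm (grad \<phi> x))\<^sup>2 \<le> (norm (V x))\<^sup>2"
        by (simp add: power2_norm_eq_inner inner_add_left inner_add_right inner_commute)
      also have "\<dots> \<le> h\<^sup>2" using h[OF True] by (intro power_mono) (auto simp: V_def)
      finally show ?thesis using True by simp
    next
      case False
      then have "grad \<phi> x = 0" using K by blast
      then show ?thesis using False by simp
    qed
  qed (use intV int_ind C1c_integrable_grad_square[OF \<phi>] in auto)
  also have "\<dots> = h\<^sup>2 * measure lborel \<Omega>" using \<Omega> by simp
  finally show ?thesis .
qed

text \<open>Integration by parts against the coordinate \<open>x \<bullet> b\<close> expresses the
  integral of \<phi>^2 by that of -2 (x.b) \<phi> (grad \<phi>.b). Young's inequality, here the
  square of \<phi> + 2 s t, bounds this by half of the left side plus \<open>2 * h\<^sup>2\<close>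
  times the Dirichlet integral.\<close>

lemma poincare_inequality:
  fixes \<phi> :: "'a::euclidean_space \<Rightarrow> real"
  assumes \<phi>: "Ck 1 \<phi>" "compact_support_in \<Omega> \<phi>" and b: "b \<in> Basis"
    and h: "\<And>x. x \<in> \<Omega> \<Longrightarrow> \<bar>x \<bullet> b\<bar> \<le> h"
  shows "(\<integral>x. (\<phi> x)\<^sup>2 \<partial>lborel) \<le> 4 * h\<^sup>2 * dirichlet \<phi>"
proof -
  obtain K where K: "compact K" "K \<subseteq> \<Omega>" "\<And>x. x \<notin> K \<Longrightarrow> \<phi> x = 0" "\<And>x. x \<notin> K \<Longrightarrow> grad \<phi> x = 0"
    using compact_support_inE[OF \<phi>(2)] by metis
  have c: "continuous_on UNIV \<phi>" "continuous_on UNIV (grad \<phi>)"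
    using \<phi> by (auto intro: Ck_1_continuous Ck_1_continuous_grad)
  have g2: "grad (\<lambda>x. \<phi> x * \<phi> x) x = (2 * \<phi> x) *\<^sub>R grad \<phi> x" for x
    using Ck_1_differentiable[OF \<phi>(1)] by (simp add: grad_mult flip: scaleR_add_left)
  have int: "integrable lborel (\<lambda>x. (x \<bullet> b) * (2 * \<phi> x * (grad \<phi> x \<bullet> b)))"
    by (rule integrable_compact_support[OF _ K(1)]) (auto intro!: continuous_intros c simp: K)
  have "(\<integral>x. (\<phi> x)\<^sup>2 \<partial>lborel) = (\<integral>x. (\<phi> x * \<phi> x) * (grad (\<lambda>x. x \<bullet> b) x \<bullet> b) \<partial>lborel)"
    using b by (simp add: grad_inner_coordinate power2_eq_square)
  also have "\<dots> = - (\<integral>x. (x \<bullet> b) * (grad (\<lambda>x. \<phi> x * \<phi> x) x \<bullet> b) \<partial>lborel)"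
    by (rule integration_by_parts[OF Ck_mult[OF \<phi>(1) \<phi>(1)] Ck_inner K(1)]) (simp add: K)
  also have "\<dots> = (\<integral>x. - ((x \<bullet> b) * (2 * \<phi> x * (grad \<phi> x \<bullet> b))) \<partial>lborel)"
    by (simp add: g2)
  also have "\<dots> \<le> (\<integral>x. (1 / 2) * (\<phi> x)\<^sup>2 + 2 * h\<^sup>2 * (norm (grad \<phi> x))\<^sup>2 \<partial>lborel)"
  proof (rule integral_mono)
    fix x
    show "- ((x \<bullet> b) * (2 * \<phi> x * (grad \<phi> x \<bullet> b))) \<le> (1 / 2) * (\<phi> x)\<^sup>2 + 2 * h\<^sup>2 * (norm (grad \<phi> x))\<^sup>2"
    proof (cases "x \<in> \<Omega>")
      case True
      define s t where "s = x \<bullet> b" and "t = grad \<phi> x \<bullet> b"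
      have "0 \<le> (\<phi> x + 2 * s * t)\<^sup>2" by simp
      then have "- (s * (2 * \<phi> x * t)) \<le> (1 / 2) * (\<phi> x)\<^sup>2 + 2 * (s\<^sup>2 * t\<^sup>2)"
        by (simp add: power2_eq_square algebra_simps)
      also have "s\<^sup>2 * t\<^sup>2 \<le> h\<^sup>2 * (norm (grad \<phi> x))\<^sup>2"
        using h[OF True] Basis_le_norm[OF b, of "grad \<phi> x"]
        by (intro mult_mono) (auto simp: s_def t_def abs_le_square_iff[symmetric] power2_le_iff_abs_le)
      finally show ?thesis by (simp add: s_def t_def)
    next
      case False
      then have "x \<notin> K" using K by blast
      then show ?thesis by (simp add: K)
    qed
  qed (use int C1c_integrable_square[OF \<phi>] C1c_integrable_grad_square[OF \<phi>] in auto)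
  also have "\<dots> = (1 / 2) * (\<integral>x. (\<phi> x)\<^sup>2 \<partial>lborel) + 2 * h\<^sup>2 * dirichlet \<phi>"
    using C1c_integrable_square[OF \<phi>] C1c_integrable_grad_square[OF \<phi>] by (simp add: dirichlet_def)
  finally show ?thesis by simp
qed

text \<open>The variational value of the torsional rigidity. Monotonicity, scaling and lower bounds
  by competitors are immediate for it; it is identified with \<open>torsional_rigidity\<close> on
  bounded open sets.\<close>

definition tors :: "'a::euclidean_space set \<Rightarrow> real" where
  "tors \<Omega> = Sup {torsion_energy \<phi> | \<phi>. test_function \<Omega> \<phi>}"

lemma bounded_slab:
  fixes \<Omega> :: "'a::euclidean_space set"
  assumes "bounded \<Omega>" "b \<in> Basis"
  obtains h where "h > 0" "\<And>x. x \<in> \<Omega> \<Longrightarrow> \<bar>x \<bullet> b\<bar> \<le> h"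
proof -
  obtain h where "h > 0" "\<And>x. x \<in> \<Omega> \<Longrightarrow> norm x \<le> h" using assms(1) unfolding bounded_pos by auto
  with that[of h] Basis_le_norm[OF assms(2)] show ?thesis by (meson order_trans)
qed

text \<open>All weight is put on the single coordinate \<open>b\<close>, so that the field of
  divergence one is (x.b) b and its norm is at most \<open>h\<close> on the slab.\<close>

lemma torsion_energy_le_slab:
  fixes \<phi> :: "'a::euclidean_space \<Rightarrow> real"
  assumes "Ck 1 \<phi>" "compact_support_in \<Omega> \<phi>" "\<Omega> \<in> sets borel" "bounded \<Omega>" "b \<in> Basis"
    "\<And>x. x \<in> \<Omega> \<Longrightarrow> \<bar>x \<bullet> b\<bar> \<le> h"
  shows "torsion_energy \<phi> \<le> h\<^sup>2 * measure lborel \<Omega>"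
proof (rule torsion_energy_le[OF assms(1-4), where w = "\<lambda>i. if i = b then 1 else 0"])
  show "(\<Sum>i\<in>Basis. if i = b then 1 else 0 :: real) = 1" using assms(5) by simp
  fix x assume x: "x \<in> \<Omega>"
  have "(\<Sum>i\<in>Basis. ((if i = b then 1 else 0) * (x \<bullet> i)) *\<^sub>R i) = (\<Sum>i\<in>Basis. if i = b then (x \<bullet> b) *\<^sub>R b else 0)"
    by (intro sum.cong) auto
  then show "norm (\<Sum>i\<in>Basis. ((if i = b then 1 else 0) * (x \<bullet> i)) *\<^sub>R i) \<le> h"
    using assms(5) assms(6)[OF x] by simp
qed

lemma tors_bdd_above:
  fixes \<Omega> :: "'a::euclidean_space set"
  assumes "open \<Omega>" "bounded \<Omega>"
  shows "bdd_above {torsion_energy \<phi> | \<phi>. test_function \<Omega> \<phi>}"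
proof -
  obtain b :: 'a where b: "b \<in> Basis" using nonempty_Basis by blast
  obtain h where h: "\<And>x. x \<in> \<Omega> \<Longrightarrow> \<bar>x \<bullet> b\<bar> \<le> h" using bounded_slab[OF assms(2) b] by metis
  show ?thesis
  proof (rule bdd_aboveI)
    fix e assume "e \<in> {torsion_energy \<phi> | \<phi>. test_function \<Omega> \<phi>}"
    then obtain \<phi> where \<phi>: "e = torsion_energy \<phi>" "test_function \<Omega> \<phi>" by blast
    show "e \<le> h\<^sup>2 * measure lborel \<Omega>"
      unfolding \<phi>(1) using assms(1) by (intro torsion_energy_le_slab[OF test_function_C1c[OF \<phi>(2)] _ assms(2) b h]) auto
  qed
qed

lemma torsion_energy_le_tors:
  assumes "open \<Omega>" "bounded \<Omega>" "test_function \<Omega> \<phi>"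
  shows "torsion_energy \<phi> \<le> tors \<Omega>"
  unfolding tors_def by (rule cSup_upper) (use assms tors_bdd_above in auto)

lemma tors_le:
  assumes "\<And>\<phi>. test_function \<Omega> \<phi> \<Longrightarrow> torsion_energy \<phi> \<le> c"
  shows "tors \<Omega> \<le> c"
  unfolding tors_def by (rule cSup_least) (use assms test_function_0 in auto)

lemma torsion_energy_near_tors:
  assumes "c < tors \<Omega>"
  obtains \<phi> where "test_function \<Omega> \<phi>" "c < torsion_energy \<phi>"
  using less_cSupD[OF _ assms[unfolded tors_def]] test_function_0 by blast

lemma dirichlet_lincomb:
  assumes "test_function \<Omega> \<phi>" "test_function \<Omega> \<psi>"
  shows "dirichlet (\<lambda>x. a * \<phi> x + b * \<psi> x) =
    a\<^sup>2 * dirichlet \<phi> + 2 * a * b * (\<integral>x. grad \<phi> x \<bullet> grad \<psi> x \<partial>lborel) + b\<^sup>2 * dirichlet \<psi>"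
    and integral_lincomb: "integral\<^sup>L lborel (\<lambda>x. a * \<phi> x + b * \<psi> x) =
      a * integral\<^sup>L lborel \<phi> + b * integral\<^sup>L lborel \<psi>"
proof -
  have d: "\<phi> differentiable at x" "\<psi> differentiable at x" for x
    using assms by (auto intro: Ck_1_differentiable test_function_Ck)
  have int: "integrable lborel (\<lambda>x. grad \<phi> x \<bullet> grad \<psi> x)"
    by (rule integrable_inner_L2) (use test_function_measurable test_function_integrable assms in auto)
  have "(\<lambda>x. (norm (grad (\<lambda>x. a * \<phi> x + b * \<psi> x) x))\<^sup>2) = (\<lambda>x. a\<^sup>2 * (norm (grad \<phi> x))\<^sup>2 +
      2 * a * b * (grad \<phi> x \<bullet> grad \<psi> x) + b\<^sup>2 * (norm (grad \<psi> x))\<^sup>2)"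
    unfolding grad_lincomb[OF d] power2_norm_eq_inner
    by (auto simp: inner_add_left inner_add_right inner_commute power2_eq_square algebra_simps)
  then show "dirichlet (\<lambda>x. a * \<phi> x + b * \<psi> x) =
    a\<^sup>2 * dirichlet \<phi> + 2 * a * b * (\<integral>x. grad \<phi> x \<bullet> grad \<psi> x \<partial>lborel) + b\<^sup>2 * dirichlet \<psi>"
    unfolding dirichlet_def using int test_function_integrable[OF assms(1)] test_function_integrable[OF assms(2)]
    by simp
  show "integral\<^sup>L lborel (\<lambda>x. a * \<phi> x + b * \<psi> x) =
      a * integral\<^sup>L lborel \<phi> + b * integral\<^sup>L lborel \<psi>"
    using test_function_integrable[OF assms(1)] test_function_integrable[OF assms(2)] by simp
qed

lemma set_integral_supported:
  fixes f :: "'a \<Rightarrow> 'b::{banach, second_countable_topology}"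
  assumes "\<And>x. x \<notin> A \<Longrightarrow> f x = 0"
  shows "set_lebesgue_integral M A f = integral\<^sup>L M f"
proof -
  have "(\<lambda>x. indicator A x *\<^sub>R f x) = f" using assms by (auto simp: indicator_def fun_eq_iff)
  then show ?thesis by (simp add: set_lebesgue_integral_def)
qed

lemma set_integrable_supported:
  fixes f :: "'a \<Rightarrow> 'b::{banach, second_countable_topology}"
  assumes "\<And>x. x \<notin> A \<Longrightarrow> f x = 0"
  shows "set_integrable M A f \<longleftrightarrow> integrable M f"
proof -
  have "(\<lambda>x. indicator A x *\<^sub>R f x) = f" using assms by (auto simp: indicator_def fun_eq_iff)
  then show ?thesis by (simp add: set_integrable_def)
qed

lemma set_borel_measurable_supported:
  fixes f :: "'a \<Rightarrow> 'b::{banach, second_countable_topology}"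
  assumes "\<And>x. x \<notin> A \<Longrightarrow> f x = 0"
  shows "set_borel_measurable M A f \<longleftrightarrow> f \<in> borel_measurable M"
proof -
  have "(\<lambda>x. indicator A x *\<^sub>R f x) = f" using assms by (auto simp: indicator_def fun_eq_iff)
  then show ?thesis by (simp add: set_borel_measurable_def)
qed

text \<open>The parallelogram identity makes a rapidly maximising sequence Cauchy in the Dirichlet norm;
  its limit is the torsion function, with the weak equation as Euler--Lagrange equation.\<close>

lemma torsion_function_exists:
  fixes \<Omega> :: "'a::euclidean_space set"
  assumes \<Omega>: "open \<Omega>" "bounded \<Omega>"
  shows "\<exists>u. is_torsion_function \<Omega> u"
proof -
  obtain b :: 'a where b: "b \<in> Basis" using nonempty_Basis by blast
  obtain h where h: "\<And>x. x \<in> \<Omega> \<Longrightarrow> \<bar>x \<bullet> b\<bar> \<le> h" using bounded_slab[OF \<Omega>(2) b] by metis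
  have "\<exists>\<phi>. test_function \<Omega> \<phi> \<and> tors \<Omega> - (1 / 16) ^ n < torsion_energy \<phi>" for n
    using torsion_energy_near_tors[of "tors \<Omega> - (1 / 16) ^ n" \<Omega>] by fastforce
  then obtain \<phi> where \<phi>: "\<And>n. test_function \<Omega> (\<phi> n)" "\<And>n. tors \<Omega> - (1 / 16) ^ n < torsion_energy (\<phi> n)"
    by metis
  have E: "(\<lambda>n. torsion_energy (\<phi> n)) \<longlonglongrightarrow> tors \<Omega>"
  proof (rule tendsto_sandwich[OF _ _ _ tendsto_const])
    have "(\<lambda>n. tors \<Omega> - (1 / 16) ^ n) \<longlonglongrightarrow> tors \<Omega> - 0"
      by (intro tendsto_intros LIMSEQ_realpow_zero) auto
    then show "(\<lambda>n. tors \<Omega> - (1 / 16) ^ n) \<longlonglongrightarrow> tors \<Omega>" by simp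
    show "\<forall>\<^sub>F n in sequentially. tors \<Omega> - (1 / 16) ^ n \<le> torsion_energy (\<phi> n)"
      by (intro always_eventually allI less_imp_le \<phi>)
    show "\<forall>\<^sub>F n in sequentially. torsion_energy (\<phi> n) \<le> tors \<Omega>"
      by (intro always_eventually allI torsion_energy_le_tors \<Omega> \<phi>)
  qed
  have diff: "test_function \<Omega> (\<lambda>x. \<phi> (Suc n) x - \<phi> n x)" for n
    using test_function_lincomb[OF \<phi>(1)[of "Suc n"] \<phi>(1)[of n], of 1 "-1"] by simp
  have grad_diff: "grad (\<lambda>x. \<phi> (Suc n) x - \<phi> n x) x = grad (\<phi> (Suc n)) x - grad (\<phi> n) x" for n x
    using grad_lincomb[of "\<phi> (Suc n)" x "\<phi> n" 1 "-1"]
      Ck_1_differentiable[OF test_function_Ck[OF \<phi>(1)]] by simp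
  \<comment> \<open>The energy at the midpoint exceeds the mean of the two energies by a quarter of
    this Dirichlet integral. It cannot exceed the supremum, and both energies are within
    \<open>(1 / 16) ^ n\<close> of it.\<close>
  have D: "dirichlet (\<lambda>x. \<phi> (Suc n) x - \<phi> n x) \<le> 4 * (1 / 16) ^ n" for n
  proof -
    let ?I = "\<integral>x. grad (\<phi> (Suc n)) x \<bullet> grad (\<phi> n) x \<partial>lborel"
    have "torsion_energy (\<lambda>x. (1 / 2) * \<phi> (Suc n) x + (1 / 2) * \<phi> n x) \<le> tors \<Omega>"
      by (intro torsion_energy_le_tors \<Omega> test_function_lincomb \<phi>)
    moreover have "torsion_energy (\<lambda>x. (1 / 2) * \<phi> (Suc n) x + (1 / 2) * \<phi> n x) =
        integral\<^sup>L lborel (\<phi> (Suc n)) + integral\<^sup>L lborel (\<phi> n) - (1 / 4) * dirichlet (\<phi> (Suc n))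
        - (1 / 2) * ?I - (1 / 4) * dirichlet (\<phi> n)"
      unfolding torsion_energy_def dirichlet_lincomb[OF \<phi>(1) \<phi>(1)] integral_lincomb[OF \<phi>(1) \<phi>(1)]
      by (simp add: power2_eq_square)
    moreover have "dirichlet (\<lambda>x. \<phi> (Suc n) x - \<phi> n x) = dirichlet (\<phi> (Suc n)) - 2 * ?I + dirichlet (\<phi> n)"
      using dirichlet_lincomb[OF \<phi>(1)[of "Suc n"] \<phi>(1)[of n], of 1 "-1"] by simp
    moreover have "tors \<Omega> - (1 / 16) ^ n < torsion_energy (\<phi> n)" by (rule \<phi>)
    moreover have "tors \<Omega> - (1 / 16) ^ n < torsion_energy (\<phi> (Suc n))"
    proof -
      have "(1 / 16 :: real) ^ Suc n \<le> (1 / 16) ^ n" by (intro power_decreasing) auto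
      with \<phi>(2)[of "Suc n"] show ?thesis by linarith
    qed
    ultimately show ?thesis unfolding torsion_energy_def by linarith
  qed
  have meas: "\<phi> n \<in> borel_measurable lborel" "grad (\<phi> n) \<in> borel_measurable lborel" for n
    using test_function_measurable[OF \<phi>(1)[of n]] by auto
  have int: "integrable lborel (\<lambda>x. (norm (\<phi> n x))\<^sup>2)" "integrable lborel (\<lambda>x. (norm (grad (\<phi> n) x))\<^sup>2)" for n
    using test_function_integrable[OF \<phi>(1)[of n]] by auto
  have "(\<integral>x. (norm (\<phi> (Suc n) x - \<phi> n x))\<^sup>2 \<partial>lborel) \<le> (16 * h\<^sup>2) * (1 / 16) ^ n" for n
  proof -
    have "(\<integral>x. (\<phi> (Suc n) x - \<phi> n x)\<^sup>2 \<partial>lborel) \<le> 4 * h\<^sup>2 * dirichlet (\<lambda>x. \<phi> (Suc n) x - \<phi> n x)"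
      by (rule poincare_inequality[OF test_function_C1c[OF diff[of n]] b h])
    also have "\<dots> \<le> 4 * h\<^sup>2 * (4 * (1 / 16) ^ n)" by (intro mult_left_mono D) auto
    finally show ?thesis by simp
  qed
  from L2_rapid_Cauchy_converges[of \<phi> lborel, OF meas(1) int(1) _ this]
  obtain u where u: "u \<in> borel_measurable lborel" "integrable lborel (\<lambda>x. (norm (u x))\<^sup>2)"
    "\<And>n. integrable lborel (\<lambda>x. (norm (\<phi> n x - u x))\<^sup>2)"
    "(\<lambda>n. \<integral>x. (norm (\<phi> n x - u x))\<^sup>2 \<partial>lborel) \<longlonglongrightarrow> 0"
    "\<And>x. (\<And>n. \<phi> n x = 0) \<Longrightarrow> u x = 0"
    using test_function_integrable(2)[OF diff] by auto
  have "(\<integral>x. (norm (grad (\<phi> (Suc n)) x - grad (\<phi> n) x))\<^sup>2 \<partial>lborel) \<le> 4 * (1 / 16) ^ n" for n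
    using D[of n] by (simp add: dirichlet_def grad_diff)
  from L2_rapid_Cauchy_converges[of "\<lambda>n. grad (\<phi> n)" lborel, OF meas(2) int(2) _ this]
  obtain g where g: "g \<in> borel_measurable lborel" "integrable lborel (\<lambda>x. (norm (g x))\<^sup>2)"
    "\<And>n. integrable lborel (\<lambda>x. (norm (grad (\<phi> n) x - g x))\<^sup>2)"
    "(\<lambda>n. \<integral>x. (norm (grad (\<phi> n) x - g x))\<^sup>2 \<partial>lborel) \<longlonglongrightarrow> 0"
    "\<And>x. (\<And>n. grad (\<phi> n) x = 0) \<Longrightarrow> g x = 0"
    using test_function_integrable(3)[OF diff] by (auto simp: grad_diff)
  \<comment> \<open>All \<open>\<phi> n\<close> vanish outside \<Omega>, hence so do the limits;
    integrals over \<Omega> may be taken over the whole space.\<close>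
  have u0: "u x = 0" if "x \<notin> \<Omega>" for x using u(5) test_function_outside[OF \<phi>(1) that] by blast
  have g0: "g x = 0" if "x \<notin> \<Omega>" for x using g(5) grad_test_function_outside[OF \<phi>(1) that] by blast
  have L2: "L2_on \<Omega> u" "L2_on \<Omega> g"
    using u(1,2) g(1,2) u0 g0
    by (simp_all add: L2_on_def set_borel_measurable_supported set_integrable_supported)
  have weak: "has_weak_gradient \<Omega> u g"
    unfolding has_weak_gradient_def
  proof (intro allI impI)
    fix \<psi> assume \<psi>: "test_function \<Omega> \<psi>"
    obtain K where K: "compact K" "\<And>x. x \<notin> K \<Longrightarrow> \<psi> x = 0"
      using test_function_support[OF \<psi>] by metis
    note mp = test_function_measurable[OF \<psi>]
    have ip: "integrable lborel (\<lambda>x. (norm (\<psi> x))\<^sup>2)" "integrable lborel (\<lambda>x. (norm (grad \<psi> x))\<^sup>2)"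
      using test_function_integrable[OF \<psi>] by auto
    have bd: "norm (grad \<psi> x \<bullet> i) \<le> norm (grad \<psi> x)" "norm (g x \<bullet> i) \<le> norm (g x)" if "i \<in> Basis" for i x
      using Basis_le_norm[OF that] by auto
    \<comment> \<open>The identity holds for each \<open>\<phi> n\<close> by integration by parts,
      and both sides are pairings with a fixed square-integrable function, so it passes to the
      limit.\<close>
    have comp: "(\<integral>x. u x * (grad \<psi> x \<bullet> i) \<partial>lborel) = - (\<integral>x. \<psi> x * (g x \<bullet> i) \<partial>lborel)" if i: "i \<in> Basis" for i
    proof -
      have gi: "integrable lborel (\<lambda>x. (norm (grad \<psi> x \<bullet> i))\<^sup>2)"
        by (rule Bochner_Integration.integrable_bound[OF ip(2)])
           (use mp bd(1)[OF i] in \<open>auto intro!: AE_I2 simp: power2_le_iff_abs_le simp flip: abs_le_square_iff\<close>)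
      have i2: "integrable lborel (\<lambda>x. (norm (\<psi> x *\<^sub>R i))\<^sup>2)" using ip(1) i by (simp add: power_mult_distrib)
      have "(\<lambda>n. \<integral>x. \<phi> n x \<bullet> (grad \<psi> x \<bullet> i) \<partial>lborel) \<longlonglongrightarrow> (\<integral>x. u x \<bullet> (grad \<psi> x \<bullet> i) \<partial>lborel)"
        by (rule L2_tendsto_inner[OF meas(1) u(1) _ int(1) u(2) gi u(3,4)]) (use mp in measurable)
      moreover have "(\<lambda>n. \<integral>x. grad (\<phi> n) x \<bullet> (\<psi> x *\<^sub>R i) \<partial>lborel) \<longlonglongrightarrow> (\<integral>x. g x \<bullet> (\<psi> x *\<^sub>R i) \<partial>lborel)"
        by (rule L2_tendsto_inner[OF meas(2) g(1) _ int(2) g(2) i2 g(3,4)]) (use mp in measurable)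
      moreover have "(\<integral>x. \<phi> n x \<bullet> (grad \<psi> x \<bullet> i) \<partial>lborel) = - (\<integral>x. grad (\<phi> n) x \<bullet> (\<psi> x *\<^sub>R i) \<partial>lborel)" for n
        using integration_by_parts[OF test_function_Ck[OF \<psi>] test_function_Ck[OF \<phi>(1)[of n]] K, of i]
        by (simp add: mult.commute)
      ultimately have "(\<lambda>n. - (\<integral>x. grad (\<phi> n) x \<bullet> (\<psi> x *\<^sub>R i) \<partial>lborel)) \<longlonglongrightarrow> (\<integral>x. u x \<bullet> (grad \<psi> x \<bullet> i) \<partial>lborel)"
        "(\<lambda>n. - (\<integral>x. grad (\<phi> n) x \<bullet> (\<psi> x *\<^sub>R i) \<partial>lborel)) \<longlonglongrightarrow> - (\<integral>x. g x \<bullet> (\<psi> x *\<^sub>R i) \<partial>lborel)"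
        by (auto intro: tendsto_minus)
      from LIMSEQ_unique[OF this] show ?thesis by (simp add: mult.commute)
    qed
    have int_u: "integrable lborel (\<lambda>x. u x *\<^sub>R grad \<psi> x)" and int_g: "integrable lborel (\<lambda>x. \<psi> x *\<^sub>R g x)"
    proof -
      have "integrable lborel (\<lambda>x. norm (u x) \<bullet> norm (grad \<psi> x))"
        by (rule integrable_inner_L2) (use u(1,2) mp ip in simp_all)
      then show "integrable lborel (\<lambda>x. u x *\<^sub>R grad \<psi> x)"
        by (rule Bochner_Integration.integrable_bound) (use u(1) mp in simp_all)
      have "integrable lborel (\<lambda>x. norm (\<psi> x) \<bullet> norm (g x))"
        by (rule integrable_inner_L2) (use g(1,2) mp ip in simp_all)
      then show "integrable lborel (\<lambda>x. \<psi> x *\<^sub>R g x)"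
        by (rule Bochner_Integration.integrable_bound) (use g(1) mp in simp_all)
    qed
    have "(\<integral>x. u x *\<^sub>R grad \<psi> x \<partial>lborel) = - (\<integral>x. \<psi> x *\<^sub>R g x \<partial>lborel)"
    proof (rule euclidean_eqI)
      fix i :: 'a assume "i \<in> Basis"
      from comp[OF this] show "(\<integral>x. u x *\<^sub>R grad \<psi> x \<partial>lborel) \<bullet> i = (- (\<integral>x. \<psi> x *\<^sub>R g x \<partial>lborel)) \<bullet> i"
        using integral_inner_left[OF int_u, of i] integral_inner_left[OF int_g, of i] by simp
    qed
    then show "(LINT x:\<Omega>|lborel. u x *\<^sub>R grad \<psi> x) = - (LINT x:\<Omega>|lborel. \<psi> x *\<^sub>R g x)"
      by (simp add: set_integral_supported u0 g0)
  qed
  have "(\<lambda>n. (\<integral>x. (norm (\<phi> n x - u x))\<^sup>2 \<partial>lborel) + (\<integral>x. (norm (grad (\<phi> n) x - g x))\<^sup>2 \<partial>lborel)) \<longlonglongrightarrow> 0 + 0"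
    by (intro tendsto_add u(4) g(4))
  moreover have "(LINT x:\<Omega>|lborel. (\<phi> n x - u x)\<^sup>2 + (norm (grad (\<phi> n) x - g x))\<^sup>2) =
      (\<integral>x. (norm (\<phi> n x - u x))\<^sup>2 \<partial>lborel) + (\<integral>x. (norm (grad (\<phi> n) x - g x))\<^sup>2 \<partial>lborel)" for n
    using u(3)[of n] g(3)[of n]
    by (subst set_integral_supported)
       (auto simp: u0 g0 test_function_outside[OF \<phi>(1)] grad_test_function_outside[OF \<phi>(1)])
  ultimately have "(\<lambda>n. LINT x:\<Omega>|lborel. (\<phi> n x - u x)\<^sup>2 + (norm (grad (\<phi> n) x - g x))\<^sup>2) \<longlonglongrightarrow> 0"
    by simp
  then have H: "H01 \<Omega> u g"
    unfolding H01_def H1_def using L2 weak \<phi>(1) by blast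
  have "(LINT x:\<Omega>|lborel. g x \<bullet> grad \<psi> x) = (LINT x:\<Omega>|lborel. \<psi> x)" if \<psi>: "test_function \<Omega> \<psi>" for \<psi>
  proof -
    define c where "c = integral\<^sup>L lborel \<psi> - (\<integral>x. g x \<bullet> grad \<psi> x \<partial>lborel)"
    have ip: "integrable lborel (\<lambda>x. (norm (grad \<psi> x))\<^sup>2)"
      using test_function_integrable[OF \<psi>] by auto
    have lim: "(\<lambda>n. \<integral>x. grad (\<phi> n) x \<bullet> grad \<psi> x \<partial>lborel) \<longlonglongrightarrow> (\<integral>x. g x \<bullet> grad \<psi> x \<partial>lborel)"
      by (rule L2_tendsto_inner[OF meas(2) g(1) _ int(2) g(2) ip g(3,4)]) (use test_function_measurable[OF \<psi>] in simp)
    \<comment> \<open>The energies of \<open>\<phi> n\<close> perturbed by t \<psi> stay below the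
      supremum while those of \<open>\<phi> n\<close> tend to it. The resulting quadratic inequality
      in \<open>t\<close> forces the linear coefficient \<open>c\<close> to vanish.\<close>
    have quad: "2 * t * c - t\<^sup>2 * dirichlet \<psi> \<le> 0" for t
    proof -
      have "torsion_energy (\<phi> n) + 2 * t * (integral\<^sup>L lborel \<psi> - (\<integral>x. grad (\<phi> n) x \<bullet> grad \<psi> x \<partial>lborel))
          - t\<^sup>2 * dirichlet \<psi> \<le> tors \<Omega>" for n
      proof -
        have "torsion_energy (\<lambda>x. 1 * \<phi> n x + t * \<psi> x) \<le> tors \<Omega>"
          by (intro torsion_energy_le_tors \<Omega> test_function_lincomb \<phi> \<psi>)
        then show ?thesis
          unfolding torsion_energy_def dirichlet_lincomb[OF \<phi>(1) \<psi>] integral_lincomb[OF \<phi>(1) \<psi>]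
          by (simp add: algebra_simps)
      qed
      moreover have "(\<lambda>n. torsion_energy (\<phi> n) + 2 * t * (integral\<^sup>L lborel \<psi> - (\<integral>x. grad (\<phi> n) x \<bullet> grad \<psi> x \<partial>lborel))
          - t\<^sup>2 * dirichlet \<psi>) \<longlonglongrightarrow> tors \<Omega> + 2 * t * c - t\<^sup>2 * dirichlet \<psi>"
        unfolding c_def by (intro tendsto_intros E lim)
      ultimately have "tors \<Omega> + 2 * t * c - t\<^sup>2 * dirichlet \<psi> \<le> tors \<Omega>"
        using LIMSEQ_le_const2 by blast
      then show ?thesis by simp
    qed
    have "c = 0"
    proof (rule ccontr)
      assume "c \<noteq> 0"
      \<comment> \<open>The summand 1 covers a vanishing Dirichlet integral; this
        \<open>t = s\<close> makes the quadratic expression positive if \<open>c\<close> is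
        nonzero.\<close>
      define s where "s = c / (dirichlet \<psi> + 1)"
      have "dirichlet \<psi> + 1 > 0" using dirichlet_nonneg[of \<psi>] by linarith
      then have c: "c = s * (dirichlet \<psi> + 1)" by (simp add: s_def)
      then have "s \<noteq> 0" using \<open>c \<noteq> 0\<close> by auto
      have "2 * s * c - s\<^sup>2 * dirichlet \<psi> = s\<^sup>2 * (dirichlet \<psi> + 2)"
        unfolding c by (simp add: power2_eq_square algebra_simps)
      also have "\<dots> > 0" using \<open>s \<noteq> 0\<close> dirichlet_nonneg[of \<psi>] by (intro mult_pos_pos) auto
      finally show False using quad[of s] by simp
    qed
    then show ?thesis
      using g0 test_function_outside[OF \<psi>] by (simp add: set_integral_supported c_def)
  qed
  with H show ?thesis unfolding is_torsion_function_def by blast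
qed

text \<open>The absolute value of \<phi> is not smooth and is replaced by
  \<open>sqrt ((\<phi> x)\<^sup>2 + e\<^sup>2) - e\<close>. This is a test function, its gradient is
  no larger than that of \<phi>, and it falls short of the absolute value by at most
  \<open>e\<close>, and only on the set \<Omega> of finite measure.\<close>

lemma torsion_energy_abs_le_tors:
  fixes \<Omega> :: "'a::euclidean_space set"
  assumes \<Omega>: "open \<Omega>" "bounded \<Omega>" and \<phi>: "test_function \<Omega> \<phi>"
  shows "2 * (\<integral>x. \<bar>\<phi> x\<bar> \<partial>lborel) - dirichlet \<phi> \<le> tors \<Omega>"
proof -
  let ?m = "measure lborel \<Omega>"
  have fin: "emeasure lborel \<Omega> < \<infinity>" using \<Omega>(2) by (rule emeasure_bounded_finite)
  have int_ind: "integrable lborel (\<lambda>x. e * indicat_real \<Omega> x)" for e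
    using fin \<Omega> by (intro integrable_mult_right integrable_real_indicator) auto
  have int_abs: "integrable lborel (\<lambda>x. \<bar>\<phi> x\<bar>)" using test_function_integrable[OF \<phi>] by simp
  obtain K where K: "compact K" "K \<subseteq> \<Omega>" "\<And>x. x \<notin> K \<Longrightarrow> \<phi> x = 0"
    using test_function_support[OF \<phi>] by metis
  have main: "2 * (\<integral>x. \<bar>\<phi> x\<bar> \<partial>lborel) - 2 * e * ?m - dirichlet \<phi> \<le> tors \<Omega>" if "e > 0" for e
  proof -
    define \<psi> where "\<psi> x = sqrt ((\<phi> x)\<^sup>2 + e\<^sup>2) - e" for x
    have pos: "(\<phi> x)\<^sup>2 + e\<^sup>2 > 0" for x using that by (simp add: add_nonneg_pos)
    have "\<psi> = (\<lambda>x. (\<phi> x * \<phi> x + e\<^sup>2) powr (1 / 2) - e)"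
      using pos by (auto simp: \<psi>_def powr_half_sqrt power2_eq_square less_imp_le)
    moreover have "Ck k (\<lambda>x. (\<phi> x * \<phi> x + e\<^sup>2) powr (1 / 2) - e)" for k
      using pos by (intro Ck_diff Ck_powr Ck_add Ck_mult Ck_const test_function_Ck[OF \<phi>]) (simp add: power2_eq_square)
    moreover have \<psi>0: "\<psi> x = 0" if "x \<notin> K" for x using K(3)[OF that] \<open>e > 0\<close> by (simp add: \<psi>_def)
    ultimately have \<psi>: "test_function \<Omega> \<psi>"
      unfolding test_function_def using compact_support_inI[OF K(1,2), of \<psi>] by simp
    have grad: "norm (grad \<psi> x) \<le> norm (grad \<phi> x)" for x
    proof -
      let ?r = "sqrt ((\<phi> x)\<^sup>2 + e\<^sup>2)"
      have "((\<lambda>s. sqrt (s\<^sup>2 + e\<^sup>2) - e) has_real_derivative \<phi> x / ?r) (at (\<phi> x))"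
        using pos[of x] by (auto intro!: derivative_eq_intros simp: field_simps)
      from DERIV_compose_FDERIV[OF this Ck_1_has_derivative[OF test_function_Ck[OF \<phi>]]]
      have "grad \<psi> x = (\<phi> x / ?r) *\<^sub>R grad \<phi> x"
        by (intro grad_eqI) (simp add: \<psi>_def[abs_def] inner_commute mult.commute)
      moreover have "\<bar>\<phi> x\<bar> \<le> ?r" by (simp add: real_le_rsqrt)
      then have "\<bar>\<phi> x / ?r\<bar> \<le> 1" using pos[of x] by (simp add: abs_divide)
      ultimately show ?thesis
        using mult_left_le_one_le[of "norm (grad \<phi> x)" "\<bar>\<phi> x / ?r\<bar>"] by (simp only: norm_scaleR norm_ge_zero abs_ge_zero)
    qed
    have "dirichlet \<psi> \<le> dirichlet \<phi>"
      unfolding dirichlet_def using grad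
      by (intro integral_mono test_function_integrable(3)[OF \<psi>] test_function_integrable(3)[OF \<phi>]) (simp add: power_mono)
    moreover have "(\<integral>x. \<bar>\<phi> x\<bar> - e * indicat_real \<Omega> x \<partial>lborel) \<le> integral\<^sup>L lborel \<psi>"
    proof (rule integral_mono)
      show "\<bar>\<phi> x\<bar> - e * indicat_real \<Omega> x \<le> \<psi> x" for x
      proof (cases "x \<in> \<Omega>")
        case True
        have "\<bar>\<phi> x\<bar> \<le> sqrt ((\<phi> x)\<^sup>2 + e\<^sup>2)" by (simp add: real_le_rsqrt)
        then show ?thesis using True by (simp add: \<psi>_def)
      next
        case False
        then have "x \<notin> K" using K(2) by blast
        then show ?thesis using False K(3) \<psi>0 by simp
      qed
    qed (use int_abs int_ind test_function_integrable[OF \<psi>] in auto)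
    moreover have "(\<integral>x. \<bar>\<phi> x\<bar> - e * indicat_real \<Omega> x \<partial>lborel) = (\<integral>x. \<bar>\<phi> x\<bar> \<partial>lborel) - e * ?m"
      using int_abs int_ind \<Omega>(1) by simp
    ultimately show ?thesis
      using torsion_energy_le_tors[OF \<Omega> \<psi>] unfolding torsion_energy_def by linarith
  qed
  show ?thesis
  proof (rule field_le_epsilon)
    fix e :: real assume "e > 0"
    define t where "t = e / (2 * ?m + 1)"
    have pos: "2 * ?m + 1 > 0" by (simp add: add_nonneg_pos)
    then have "t > 0" using \<open>e > 0\<close> by (simp add: t_def)
    have "t * (2 * ?m + 1) = e" using pos by (simp add: t_def)
    then have "2 * t * ?m \<le> e" using \<open>t > 0\<close> by (simp add: algebra_simps)
    with main[OF \<open>t > 0\<close>] show "2 * (\<integral>x. \<bar>\<phi> x\<bar> \<partial>lborel) - dirichlet \<phi> \<le> tors \<Omega> + e" by linarith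
  qed
qed

lemma torsion_function_integral_abs:
  fixes \<Omega> :: "'a::euclidean_space set"
  assumes \<Omega>: "open \<Omega>" "bounded \<Omega>" and u: "is_torsion_function \<Omega> u"
  shows "(LINT x:\<Omega>|lborel. \<bar>u x\<bar>) = tors \<Omega>"
proof -
  obtain g where H: "H01 \<Omega> u g"
    and weq: "\<And>\<phi>. test_function \<Omega> \<phi> \<Longrightarrow> (LINT x:\<Omega>|lborel. g x \<bullet> grad \<phi> x) = (LINT x:\<Omega>|lborel. \<phi> x)"
    using u unfolding is_torsion_function_def by blast
  then obtain \<phi> where \<phi>: "\<And>n. test_function \<Omega> (\<phi> n)"
    and lim: "(\<lambda>n. LINT x:\<Omega>|lborel. (\<phi> n x - u x)\<^sup>2 + (norm (grad (\<phi> n) x - g x))\<^sup>2) \<longlonglongrightarrow> 0"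
    unfolding H01_def by blast
  \<comment> \<open>Outside \<Omega> the representatives \<open>u\<close> and \<open>g\<close> are
    arbitrary, so they are cut off before integrating over the whole space.\<close>
  define v w where "v x = indicat_real \<Omega> x *\<^sub>R u x" and "w x = indicat_real \<Omega> x *\<^sub>R g x" for x
  have fin: "emeasure lborel \<Omega> < \<infinity>" using \<Omega>(2) by (rule emeasure_bounded_finite)
  have v: "v \<in> borel_measurable lborel" and w: "w \<in> borel_measurable lborel"
    using H unfolding H01_def H1_def L2_on_def set_borel_measurable_def v_def[abs_def] w_def[abs_def] by auto
  have "(\<lambda>x. (norm (v x))\<^sup>2) = (\<lambda>x. indicat_real \<Omega> x *\<^sub>R (norm (u x))\<^sup>2)"
    "(\<lambda>x. (norm (w x))\<^sup>2) = (\<lambda>x. indicat_real \<Omega> x *\<^sub>R (norm (g x))\<^sup>2)"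
    by (auto simp: v_def w_def indicator_def)
  then have v2: "integrable lborel (\<lambda>x. (norm (v x))\<^sup>2)" and w2: "integrable lborel (\<lambda>x. (norm (w x))\<^sup>2)"
    using H unfolding H01_def H1_def L2_on_def set_integrable_def by simp_all
  have meas: "\<phi> n \<in> borel_measurable lborel" "grad (\<phi> n) \<in> borel_measurable lborel" for n
    using test_function_measurable[OF \<phi>[of n]] by auto
  have int: "integrable lborel (\<lambda>x. (norm (\<phi> n x))\<^sup>2)" "integrable lborel (\<lambda>x. (norm (grad (\<phi> n) x))\<^sup>2)" for n
    using test_function_integrable[OF \<phi>[of n]] by auto
  have d1: "integrable lborel (\<lambda>x. (norm (\<phi> n x - v x))\<^sup>2)" for n
  proof -
    have "(norm (\<phi> n x - v x))\<^sup>2 = (norm (\<phi> n x))\<^sup>2 - 2 * (\<phi> n x \<bullet> v x) + (norm (v x))\<^sup>2" for x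
      by (simp add: power2_eq_square algebra_simps)
    then show ?thesis using int(1)[of n] v2 integrable_inner_L2[OF meas(1)[of n] v int(1) v2] by simp
  qed
  have d2: "integrable lborel (\<lambda>x. (norm (grad (\<phi> n) x - w x))\<^sup>2)" for n
  proof -
    have "(norm (grad (\<phi> n) x - w x))\<^sup>2 = (norm (grad (\<phi> n) x))\<^sup>2 - 2 * (grad (\<phi> n) x \<bullet> w x) + (norm (w x))\<^sup>2" for x
      unfolding power2_norm_eq_inner by (simp add: inner_diff_left inner_diff_right inner_commute)
    then show ?thesis using int(2)[of n] w2 integrable_inner_L2[OF meas(2)[of n] w int(2) w2] by simp
  qed
  have "(LINT x:\<Omega>|lborel. (\<phi> n x - u x)\<^sup>2 + (norm (grad (\<phi> n) x - g x))\<^sup>2) =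
     (\<integral>x. (norm (\<phi> n x - v x))\<^sup>2 \<partial>lborel) + (\<integral>x. (norm (grad (\<phi> n) x - w x))\<^sup>2 \<partial>lborel)" for n
  proof -
    have "(\<lambda>x. indicat_real \<Omega> x *\<^sub>R ((\<phi> n x - u x)\<^sup>2 + (norm (grad (\<phi> n) x - g x))\<^sup>2)) =
        (\<lambda>x. (norm (\<phi> n x - v x))\<^sup>2 + (norm (grad (\<phi> n) x - w x))\<^sup>2)"
      using test_function_outside[OF \<phi>] grad_test_function_outside[OF \<phi>]
      by (auto simp: v_def w_def indicator_def fun_eq_iff)
    then show ?thesis unfolding set_lebesgue_integral_def using d1 d2 by simp
  qed
  with lim have L: "(\<lambda>n. (\<integral>x. (norm (\<phi> n x - v x))\<^sup>2 \<partial>lborel) + (\<integral>x. (norm (grad (\<phi> n) x - w x))\<^sup>2 \<partial>lborel)) \<longlonglongrightarrow> 0"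
    by simp
  have l1: "(\<lambda>n. \<integral>x. (norm (\<phi> n x - v x))\<^sup>2 \<partial>lborel) \<longlonglongrightarrow> 0"
    by (rule tendsto_sandwich[OF _ _ tendsto_const L]) auto
  have l2: "(\<lambda>n. \<integral>x. (norm (grad (\<phi> n) x - w x))\<^sup>2 \<partial>lborel) \<longlonglongrightarrow> 0"
    by (rule tendsto_sandwich[OF _ _ tendsto_const L]) auto
  have wq: "(\<integral>x. grad \<psi> x \<bullet> w x \<partial>lborel) = integral\<^sup>L lborel \<psi>" if \<psi>: "test_function \<Omega> \<psi>" for \<psi>
  proof -
    have "(\<integral>x. grad \<psi> x \<bullet> w x \<partial>lborel) = (LINT x:\<Omega>|lborel. g x \<bullet> grad \<psi> x)"
      unfolding set_lebesgue_integral_def by (simp add: w_def inner_commute)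
    also have "\<dots> = integral\<^sup>L lborel \<psi>"
      unfolding weq[OF \<psi>] by (rule set_integral_supported) (rule test_function_outside[OF \<psi>])
    finally show ?thesis .
  qed
  \<comment> \<open>Pairing with the indicator of \<Omega>, square-integrable because \<Omega> has
    finite measure, turns plain integrals into inner products, so that convergence in mean square
    suffices.\<close>
  let ?h = "indicat_real \<Omega>"
  have h: "?h \<in> borel_measurable lborel" "integrable lborel (\<lambda>x. (norm (?h x))\<^sup>2)"
  proof -
    have "(\<lambda>x. (norm (?h x))\<^sup>2) = ?h" by (auto simp: indicator_def)
    then show "integrable lborel (\<lambda>x. (norm (?h x))\<^sup>2)" using fin \<Omega> by (auto intro!: integrable_real_indicator)
  qed (use \<Omega> in auto)
  define W where "W = (\<integral>x. (norm (w x))\<^sup>2 \<partial>lborel)"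
  have I: "(\<lambda>n. integral\<^sup>L lborel (\<phi> n)) \<longlonglongrightarrow> integral\<^sup>L lborel v"
  proof -
    have eq: "\<phi> n x \<bullet> ?h x = \<phi> n x" "v x \<bullet> ?h x = v x" for n x
      using test_function_outside[OF \<phi>] by (auto simp: indicator_def v_def)
    show ?thesis using L2_tendsto_inner[OF meas(1) v h(1) int(1) v2 h(2) d1 l1] by (simp only: eq)
  qed
  have "(\<lambda>n. \<integral>x. grad (\<phi> n) x \<bullet> w x \<partial>lborel) \<longlonglongrightarrow> (\<integral>x. w x \<bullet> w x \<partial>lborel)"
    by (rule L2_tendsto_inner[OF meas(2) w w int(2) w2 w2 d2 l2])
  then have "(\<lambda>n. integral\<^sup>L lborel (\<phi> n)) \<longlonglongrightarrow> W"
    unfolding wq[OF \<phi>] W_def by (simp add: power2_norm_eq_inner)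
  with I have vW: "integral\<^sup>L lborel v = W" using LIMSEQ_unique by blast
  have D: "(\<lambda>n. dirichlet (\<phi> n)) \<longlonglongrightarrow> W"
    unfolding dirichlet_def W_def by (rule L2_tendsto_norm[OF meas(2) w int(2) w2 d2 l2])
  have "tors \<Omega> \<le> W"
  proof (rule tors_le)
    fix \<psi> assume \<psi>: "test_function \<Omega> \<psi>"
    have m: "grad \<psi> \<in> borel_measurable lborel" and i: "integrable lborel (\<lambda>x. (norm (grad \<psi> x))\<^sup>2)"
      using test_function_measurable[OF \<psi>] test_function_integrable[OF \<psi>] by auto
    have "torsion_energy \<psi> = (\<integral>x. 2 * (grad \<psi> x \<bullet> w x) - (norm (grad \<psi> x))\<^sup>2 \<partial>lborel)"
      unfolding torsion_energy_def dirichlet_def wq[OF \<psi>, symmetric]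
      using integrable_inner_L2[OF m w i w2] i by simp
    also have "\<dots> \<le> W" unfolding W_def
    proof (rule integral_mono)
      fix x
      have "0 \<le> (norm (grad \<psi> x - w x))\<^sup>2" by simp
      then show "2 * (grad \<psi> x \<bullet> w x) - (norm (grad \<psi> x))\<^sup>2 \<le> (norm (w x))\<^sup>2"
        unfolding power2_norm_eq_inner by (simp add: inner_diff_left inner_diff_right inner_commute)
    qed (use integrable_inner_L2[OF m w i w2] i w2 in auto)
    finally show "torsion_energy \<psi> \<le> W" .
  qed
  moreover have "2 * (\<integral>x. \<bar>v x\<bar> \<partial>lborel) - W \<le> tors \<Omega>"
  proof -
    have abs_le: "(norm (\<bar>\<phi> n x\<bar> - \<bar>v x\<bar>))\<^sup>2 \<le> (norm (\<phi> n x - v x))\<^sup>2" for n x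
      by (simp add: abs_le_square_iff[symmetric])
    have ai: "integrable lborel (\<lambda>x. (norm (\<bar>\<phi> n x\<bar> - \<bar>v x\<bar>))\<^sup>2)" for n
      by (rule Bochner_Integration.integrable_bound[OF d1[of n]]) (use abs_le meas v in auto)
    have "(\<lambda>n. \<integral>x. \<bar>\<phi> n x\<bar> \<bullet> ?h x \<partial>lborel) \<longlonglongrightarrow> (\<integral>x. \<bar>v x\<bar> \<bullet> ?h x \<partial>lborel)"
    proof (rule L2_tendsto_inner[OF _ _ h(1) _ _ h(2) ai])
      show "(\<lambda>n. \<integral>x. (norm (\<bar>\<phi> n x\<bar> - \<bar>v x\<bar>))\<^sup>2 \<partial>lborel) \<longlonglongrightarrow> 0"
      proof (rule tendsto_sandwich[OF _ _ tendsto_const l1])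
        show "\<forall>\<^sub>F n in sequentially. (\<integral>x. (norm (\<bar>\<phi> n x\<bar> - \<bar>v x\<bar>))\<^sup>2 \<partial>lborel) \<le> (\<integral>x. (norm (\<phi> n x - v x))\<^sup>2 \<partial>lborel)"
          by (intro always_eventually allI integral_mono ai d1 abs_le)
      qed simp
    qed (use meas v int v2 in auto)
    moreover have eq: "\<bar>\<phi> n x\<bar> \<bullet> ?h x = \<bar>\<phi> n x\<bar>" "\<bar>v x\<bar> \<bullet> ?h x = \<bar>v x\<bar>" for n x
      using test_function_outside[OF \<phi>] by (auto simp: indicator_def v_def)
    ultimately have A: "(\<lambda>n. \<integral>x. \<bar>\<phi> n x\<bar> \<partial>lborel) \<longlonglongrightarrow> (\<integral>x. \<bar>v x\<bar> \<partial>lborel)" by (simp only: eq)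
    have "(\<lambda>n. 2 * (\<integral>x. \<bar>\<phi> n x\<bar> \<partial>lborel) - dirichlet (\<phi> n)) \<longlonglongrightarrow> 2 * (\<integral>x. \<bar>v x\<bar> \<partial>lborel) - W"
      by (intro tendsto_intros A D)
    then show ?thesis
      by (rule LIMSEQ_le_const2) (use torsion_energy_abs_le_tors[OF \<Omega> \<phi>] in blast)
  qed
  moreover have "integral\<^sup>L lborel v \<le> (\<integral>x. \<bar>v x\<bar> \<partial>lborel)"
    using integral_abs_bound[of lborel v] by linarith
  ultimately have "(\<integral>x. \<bar>v x\<bar> \<partial>lborel) = tors \<Omega>" using vW by linarith
  then show ?thesis
    unfolding set_lebesgue_integral_def by (simp add: v_def abs_mult)
qed

lemma torsional_rigidity_eq_tors:
  assumes "open \<Omega>" "bounded \<Omega>"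
  shows "torsional_rigidity \<Omega> = tors \<Omega>"
  unfolding torsional_rigidity_def
  by (rule torsion_function_integral_abs[OF assms someI_ex[OF torsion_function_exists[OF assms]]])

section \<open>Bounds for the torsional rigidity\<close>

lemma fmeasurable_lborel_bounded:
  "A \<in> sets borel \<Longrightarrow> bounded A \<Longrightarrow> A \<in> fmeasurable lborel"
  by (auto intro!: fmeasurableI emeasure_bounded_finite)

lemma tors_nonneg: "open \<Omega> \<Longrightarrow> bounded \<Omega> \<Longrightarrow> tors \<Omega> \<ge> 0"
  using torsion_energy_le_tors[OF _ _ test_function_0, of \<Omega>]
  by (simp add: torsion_energy_def dirichlet_def grad_def frechet_derivative_const)

lemma compact_support_in_mono: "compact_support_in A f \<Longrightarrow> A \<subseteq> B \<Longrightarrow> compact_support_in B f"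
  by (auto simp: compact_support_in_def)

lemma tors_mono:
  assumes "\<Omega> \<subseteq> \<Omega>'" "open \<Omega>'" "bounded \<Omega>'"
  shows "tors \<Omega> \<le> tors \<Omega>'"
  using assms by (intro tors_le torsion_energy_le_tors) (auto simp: test_function_def intro: compact_support_in_mono)

lemma affine_bij:
  fixes a :: "'a::real_vector"
  assumes "c \<noteq> 0"
  shows "(- (1 / c)) *\<^sub>R a + (1 / c) *\<^sub>R (a + c *\<^sub>R x) = x" "a + c *\<^sub>R ((- (1 / c)) *\<^sub>R a + (1 / c) *\<^sub>R x) = x"
  using assms by (simp_all add: algebra_simps)

lemma grad_affine:
  assumes "f differentiable at (a + c *\<^sub>R x)"
  shows "grad (\<lambda>x. f (a + c *\<^sub>R x)) x = c *\<^sub>R grad f (a + c *\<^sub>R x)"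
proof (rule grad_eqI)
  have "((\<lambda>x. a + c *\<^sub>R x) has_derivative (\<lambda>h. c *\<^sub>R h)) (at x)"
    by (auto intro!: derivative_eq_intros)
  from has_derivative_compose[OF this has_derivative_grad[OF assms]]
  show "((\<lambda>x. f (a + c *\<^sub>R x)) has_derivative (\<lambda>h. (c *\<^sub>R grad f (a + c *\<^sub>R x)) \<bullet> h)) (at x)"
    by simp
qed

lemma compact_support_in_affine:
  fixes f :: "'a::euclidean_space \<Rightarrow> real"
  assumes "compact_support_in \<Omega> f" "c > 0"
  shows "compact_support_in ((\<lambda>x. a + c *\<^sub>R x) ` \<Omega>) (\<lambda>x. f ((- (1 / c)) *\<^sub>R a + (1 / c) *\<^sub>R x))"
proof -
  obtain K where K: "compact K" "K \<subseteq> \<Omega>" "\<And>x. x \<notin> K \<Longrightarrow> f x = 0"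
    using compact_support_inE[OF assms(1)] by metis
  show ?thesis
  proof (rule compact_support_inI)
    show "compact ((\<lambda>x. a + c *\<^sub>R x) ` K)"
      by (intro compact_continuous_image continuous_intros K)
    fix y assume y: "y \<notin> (\<lambda>x. a + c *\<^sub>R x) ` K"
    show "f ((- (1 / c)) *\<^sub>R a + (1 / c) *\<^sub>R y) = 0"
    proof (rule K(3), rule notI)
      assume "(- (1 / c)) *\<^sub>R a + (1 / c) *\<^sub>R y \<in> K"
      then have "a + c *\<^sub>R ((- (1 / c)) *\<^sub>R a + (1 / c) *\<^sub>R y) \<in> (\<lambda>x. a + c *\<^sub>R x) ` K" by blast
      with y assms(2) affine_bij(2)[of c a y] show False by simp
    qed
  qed (use K in blast)
qed

lemma dirichlet_affine:
  fixes f :: "'a::euclidean_space \<Rightarrow> real"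
  assumes "Ck 1 f" "c > 0"
  shows "dirichlet (\<lambda>x. f (a + (1 / c) *\<^sub>R x)) = c ^ DIM('a) / c\<^sup>2 * dirichlet f"
proof -
  have [measurable]: "grad f \<in> borel_measurable borel"
    using Ck_1_continuous_grad[OF assms(1)] by (rule borel_measurable_continuous_onI)
  have "dirichlet (\<lambda>x. f (a + (1 / c) *\<^sub>R x)) = (\<integral>x. (1 / c\<^sup>2) * (norm (grad f (a + (1 / c) *\<^sub>R x)))\<^sup>2 \<partial>lborel)"
    unfolding dirichlet_def grad_affine[OF Ck_1_differentiable[OF assms(1)]]
    by (simp add: power_mult_distrib power_divide)
  also have "\<dots> = (1 / c\<^sup>2) * (c ^ DIM('a) * dirichlet f)"
    unfolding dirichlet_def using assms(2)
    by (simp add: integral_lborel_affine[where f = "\<lambda>x. (norm (grad f x))\<^sup>2"] power_divide)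
  finally show ?thesis by simp
qed

lemma open_bounded_affine:
  fixes \<Omega> :: "'a::euclidean_space set"
  assumes "open \<Omega>" "bounded \<Omega>" "c > 0"
  shows "open ((\<lambda>x. a + c *\<^sub>R x) ` \<Omega>)" "bounded ((\<lambda>x. a + c *\<^sub>R x) ` \<Omega>)"
  using assms open_affinity[of \<Omega> c a] bounded_scaling[of \<Omega> c] bounded_translation[of "(\<lambda>x. c *\<^sub>R x) ` \<Omega>" a]
  by (auto simp: image_image)

text \<open>Test functions are transported and multiplied by \<open>c\<^sup>2\<close>, as solutions
  of -\<Delta>u = 1 are; then both terms of the energy acquire the same power of \<open>c\<close>.
  The reverse inequality is this one for the inverse map.\<close>

lemma tors_affine_ge:
  fixes \<Omega> :: "'a::euclidean_space set"
  assumes "open \<Omega>" "bounded \<Omega>" "c > 0"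
  shows "tors ((\<lambda>x. a + c *\<^sub>R x) ` \<Omega>) \<ge> c ^ (DIM('a) + 2) * tors \<Omega>"
proof -
  let ?\<Omega> = "(\<lambda>x. a + c *\<^sub>R x) ` \<Omega>"
  note \<Omega> = open_bounded_affine[OF assms, of a]
  have "tors \<Omega> \<le> tors ?\<Omega> / c ^ (DIM('a) + 2)"
  proof (rule tors_le)
    fix \<phi> assume \<phi>: "test_function \<Omega> \<phi>"
    define \<psi> where "\<psi> x = \<phi> ((- (1 / c)) *\<^sub>R a + (1 / c) *\<^sub>R x)" for x
    have \<psi>: "test_function ?\<Omega> \<psi>"
    proof -
      have "Ck k \<psi>" for k unfolding \<psi>_def[abs_def] by (intro Ck_affine test_function_Ck[OF \<phi>])
      moreover have "compact_support_in ?\<Omega> \<psi>"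
        unfolding \<psi>_def[abs_def] by (rule compact_support_in_affine[OF test_function_C1c(2)[OF \<phi>] assms(3)])
      ultimately show ?thesis by (simp add: test_function_def)
    qed
    have [measurable]: "\<phi> \<in> borel_measurable borel" using test_function_measurable[OF \<phi>] by simp
    have I: "integral\<^sup>L lborel \<psi> = c ^ DIM('a) * integral\<^sup>L lborel \<phi>"
      unfolding \<psi>_def[abs_def] using assms(3) by (subst integral_lborel_affine) (auto simp: power_divide)
    have D: "dirichlet \<psi> = c ^ DIM('a) / c\<^sup>2 * dirichlet \<phi>"
      unfolding \<psi>_def[abs_def] by (rule dirichlet_affine[OF test_function_Ck[OF \<phi>] assms(3)])
    have "torsion_energy (\<lambda>x. c\<^sup>2 * \<psi> x + 0 * \<psi> x) \<le> tors ?\<Omega>"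
      by (intro torsion_energy_le_tors \<Omega> test_function_lincomb \<psi>)
    also have "torsion_energy (\<lambda>x. c\<^sup>2 * \<psi> x + 0 * \<psi> x) = c ^ (DIM('a) + 2) * torsion_energy \<phi>"
      unfolding torsion_energy_def dirichlet_lincomb[OF \<psi> \<psi>] integral_lincomb[OF \<psi> \<psi>] I D
      using assms(3) by (simp add: power_add power2_eq_square field_simps)
    finally show "torsion_energy \<phi> \<le> tors ?\<Omega> / c ^ (DIM('a) + 2)"
      using assms(3) by (simp add: field_simps)
  qed
  then show ?thesis using assms(3) by (simp add: field_simps)
qed

lemma affine_image_inverse:
  fixes \<Omega> :: "'a::real_vector set"
  assumes "c \<noteq> 0"
  shows "(\<lambda>x. (- (1 / c)) *\<^sub>R a + (1 / c) *\<^sub>R x) ` (\<lambda>x. a + c *\<^sub>R x) ` \<Omega> = \<Omega>"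
  unfolding image_image by (simp only: affine_bij(1)[OF assms] image_ident)

lemma tors_affine:
  fixes \<Omega> :: "'a::euclidean_space set"
  assumes "open \<Omega>" "bounded \<Omega>" "c > 0"
  shows "tors ((\<lambda>x. a + c *\<^sub>R x) ` \<Omega>) = c ^ (DIM('a) + 2) * tors \<Omega>"
proof (rule antisym[OF _ tors_affine_ge[OF assms]])
  have "(1 / c) ^ (DIM('a) + 2) * tors ((\<lambda>x. a + c *\<^sub>R x) ` \<Omega>) \<le> tors \<Omega>"
    using tors_affine_ge[OF open_bounded_affine[OF assms], of "1 / c" a "- (1 / c) *\<^sub>R a"] assms(3)
    by (simp only: affine_image_inverse) simp
  then show "tors ((\<lambda>x. a + c *\<^sub>R x) ` \<Omega>) \<le> c ^ (DIM('a) + 2) * tors \<Omega>"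
    using assms(3) by (simp add: field_simps)
qed

lemma tors_le_slab:
  fixes \<Omega> :: "'a::euclidean_space set"
  assumes "open \<Omega>" "bounded \<Omega>" "b \<in> Basis" "\<And>x. x \<in> \<Omega> \<Longrightarrow> \<bar>x \<bullet> b\<bar> \<le> h"
  shows "tors \<Omega> \<le> h\<^sup>2 * measure lborel \<Omega>"
  using assms by (intro tors_le torsion_energy_le_slab[OF test_function_C1c]) auto

text \<open>Equal weights give the field x/d, which has divergence one and norm at most 1/d on the
  unit ball.\<close>

lemma tors_unit_ball_le:
  "tors (ball (0::'a::euclidean_space) 1) \<le> measure lborel (ball (0::'a) 1) / (real DIM('a))\<^sup>2"
proof (rule tors_le)
  fix \<phi> :: "'a \<Rightarrow> real" assume \<phi>: "test_function (ball 0 1) \<phi>"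
  have "torsion_energy \<phi> \<le> (1 / real DIM('a))\<^sup>2 * measure lborel (ball (0::'a) 1)"
  proof (rule torsion_energy_le[OF test_function_C1c[OF \<phi>], where w = "\<lambda>b. 1 / real DIM('a)"])
    fix x :: 'a assume x: "x \<in> ball 0 1"
    have "(\<Sum>b\<in>Basis. (1 / real DIM('a) * (x \<bullet> b)) *\<^sub>R b) = (1 / real DIM('a)) *\<^sub>R (\<Sum>b\<in>Basis. (x \<bullet> b) *\<^sub>R b)"
      by (simp add: scaleR_sum_right)
    also have "\<dots> = (1 / real DIM('a)) *\<^sub>R x" by (simp add: euclidean_representation)
    finally show "norm (\<Sum>b\<in>Basis. (1 / real DIM('a) * (x \<bullet> b)) *\<^sub>R b) \<le> 1 / real DIM('a)"
      using x by (simp add: divide_right_mono)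
  qed auto
  then show "torsion_energy \<phi> \<le> measure lborel (ball (0::'a) 1) / (real DIM('a))\<^sup>2"
    by (simp add: power_divide)
qed

text \<open>The homothety with centre \<open>y\<close> and ratio \<open>t\<close> maps
  \<open>ball x r\<close> onto this ball and, by convexity, \<Omega> into itself.\<close>

lemma convex_shrink_ball:
  fixes \<Omega> :: "'a::real_normed_vector set"
  assumes "convex \<Omega>" "ball x r \<subseteq> \<Omega>" "y \<in> \<Omega>" "0 < t" "t \<le> 1"
  shows "ball (t *\<^sub>R x + (1 - t) *\<^sub>R y) (t * r) \<subseteq> \<Omega>"
proof
  fix z assume z: "z \<in> ball (t *\<^sub>R x + (1 - t) *\<^sub>R y) (t * r)"
  define v where "v = x + (1 / t) *\<^sub>R (z - (t *\<^sub>R x + (1 - t) *\<^sub>R y))"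
  have "v \<in> ball x r"
  proof -
    have "norm (x - v) = norm (z - (t *\<^sub>R x + (1 - t) *\<^sub>R y)) / t" using \<open>0 < t\<close> by (simp add: v_def)
    also have "\<dots> < r" using z \<open>0 < t\<close> by (simp add: dist_norm norm_minus_commute pos_divide_less_eq mult.commute)
    finally show ?thesis by (simp add: dist_norm)
  qed
  then have "t *\<^sub>R v + (1 - t) *\<^sub>R y \<in> \<Omega>"
    using assms by (intro convexD) auto
  also have "t *\<^sub>R v + (1 - t) *\<^sub>R y = z" using \<open>0 < t\<close> by (simp add: v_def algebra_simps)
  finally show "z \<in> \<Omega>" .
qed

text \<open>The competitor is a multiple of the mollified distance to the complement of \<open>\<Omega>\<close>, which is
  \<open>1\<close>-Lipschitz and at least \<open>r / 2\<close> on the copy of \<open>\<Omega>\<close> shrunk by one half towards \<open>x\<close>.\<close>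

lemma tors_ge_convex:
  fixes \<Omega> :: "'a::euclidean_space set"
  assumes \<Omega>: "convex \<Omega>" "open \<Omega>" "bounded \<Omega>" and r: "ball x r \<subseteq> \<Omega>" "r \<ge> 0"
  shows "tors \<Omega> \<ge> r\<^sup>2 * measure lborel \<Omega> / 4 ^ (DIM('a) + 1)"
proof (cases "r = 0 \<or> \<Omega> = {}")
  case True
  then show ?thesis using tors_nonneg[OF \<Omega>(2,3)] by auto
next
  case False
  then have "r > 0" "\<Omega> \<noteq> {}" using r by auto
  let ?m = "measure lborel \<Omega>"
  have ne: "- \<Omega> \<noteq> {}" using \<Omega>(3) not_bounded_UNIV by (metis Compl_empty_eq double_complement)
  have main: "(r / 2 - 3 * \<delta>)\<^sup>2 * ?m / 4 ^ DIM('a) \<le> tors \<Omega>" if \<delta>: "0 < \<delta>" "\<delta> < r / 6" for \<delta>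
  proof -
    \<comment> \<open>Cutting off at \<open>2 * \<delta>\<close> leaves room for mollification at
      scale \<delta>: the result is still supported at distance at least \<delta> from the
      complement.\<close>
    define f where "f z = max 0 (infdist z (- \<Omega>) - 2 * \<delta>)" for z
    have lip: "\<bar>f z - f w\<bar> \<le> 1 * norm (z - w)" for z w
      using infdist_triangle_abs[of z "- \<Omega>" w] by (auto simp: f_def dist_norm)
    define K where "K = {z. \<delta> \<le> infdist z (- \<Omega>)}"
    have "K \<subseteq> \<Omega>"
    proof
      fix z assume "z \<in> K"
      then have "infdist z (- \<Omega>) \<noteq> 0" using \<delta> by (auto simp: K_def)
      then show "z \<in> \<Omega>" by (metis ComplI infdist_zero)
    qed
    moreover have "closed K" unfolding K_def
      by (intro closed_Collect_le continuous_intros)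
    ultimately have K: "compact K" "K \<subseteq> \<Omega>"
      using \<Omega>(3) bounded_subset compact_eq_bounded_closed by blast+
    have f0: "f z = 0" if "z \<notin> K" for z using that \<delta> by (auto simp: f_def K_def)
    obtain g where g: "\<And>k. Ck k g" "\<And>x. norm (grad g x) \<le> 1"
      "\<And>x c. (\<And>y. norm (y - x) < \<delta> \<Longrightarrow> f y \<ge> c) \<Longrightarrow> g x \<ge> c"
      "\<And>x c. (\<And>y. norm (y - x) < \<delta> \<Longrightarrow> f y \<le> c) \<Longrightarrow> g x \<le> c"
      using lipschitz_mollification[OF lip K(1) f0 \<open>0 < \<delta>\<close>] by blast
    have g0: "g z = 0" if "z \<notin> K" for z
    proof -
      have "f y = 0" if "norm (y - z) < \<delta>" for y
        using infdist_triangle_abs[of y "- \<Omega>" z] that \<open>z \<notin> K\<close> by (auto simp: f_def K_def dist_norm)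
      then show ?thesis using g(3)[of z 0] g(4)[of z 0] by force
    qed
    have test: "test_function \<Omega> g"
    proof -
      have "compact_support_in \<Omega> g" by (rule compact_support_inI[OF K]) (rule g0)
      then show ?thesis using g(1) by (simp add: test_function_def del: Ck.simps)
    qed
    have g_nonneg: "g z \<ge> 0" for z by (rule g(3)) (simp add: f_def)
    define A where "A = (\<lambda>y. (1 / 2) *\<^sub>R x + (1 / 2) *\<^sub>R y) ` \<Omega>"
    have A: "A \<in> sets borel" "measure lborel A = (1 / 2) ^ DIM('a) * ?m"
      unfolding A_def by (rule measure_affine_image; use \<Omega> in auto)+
    \<comment> \<open>From the distance r/2 the cut-off takes \<open>2 * \<delta>\<close> and the
      mollification at most another \<delta>.\<close>
    have gA: "g z \<ge> r / 2 - 3 * \<delta>" if "z \<in> A" for z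
    proof (rule g(3))
      fix y assume y: "norm (y - z) < \<delta>"
      obtain v where v: "v \<in> \<Omega>" "z = (1 / 2) *\<^sub>R x + (1 / 2) *\<^sub>R v" using \<open>z \<in> A\<close> by (auto simp: A_def)
      have "ball z (r / 2) \<subseteq> \<Omega>"
        using convex_shrink_ball[OF \<Omega>(1) r(1) v(1), of "1 / 2"] v(2) by simp
      then have "r / 2 \<le> infdist z (- \<Omega>)"
        unfolding infdist_notempty[OF ne] by (intro cINF_greatest ne) (force simp: not_less)
      then show "r / 2 - 3 * \<delta> \<le> f y"
        using infdist_triangle_abs[of y "- \<Omega>" z] y by (auto simp: f_def dist_norm)
    qed
    define s where "s = r / 2 - 3 * \<delta>"
    have s: "s > 0" using \<delta> by (simp add: s_def)
    have fin: "emeasure lborel \<Omega> < \<infinity>" using \<Omega>(3) by (rule emeasure_bounded_finite)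
    have "A \<subseteq> \<Omega>"
    proof -
      have "x \<in> \<Omega>" using r(1) \<open>r > 0\<close> by (meson centre_in_ball subsetD)
      then show ?thesis using convexD[OF \<Omega>(1), of x _ "1 / 2" "1 / 2"] by (auto simp: A_def)
    qed
    then have "emeasure lborel A < \<infinity>" using fin \<Omega>(2) emeasure_mono[of A \<Omega> lborel] by (auto intro: le_less_trans)
    then have intA: "integrable lborel (\<lambda>z. s * indicat_real A z)" and int\<Omega>: "integrable lborel (indicat_real \<Omega>)"
      using A(1) \<Omega>(2) fin by (auto intro!: integrable_real_indicator integrable_mult_right)
    have "(\<integral>z. s * indicat_real A z \<partial>lborel) \<le> integral\<^sup>L lborel g"
    proof (rule integral_mono[OF intA test_function_integrable(1)[OF test]])
      show "s * indicat_real A z \<le> g z" for z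
        using gA[of z] g_nonneg[of z] by (cases "z \<in> A") (auto simp: s_def)
    qed
    then have I: "s * ((1 / 2) ^ DIM('a) * ?m) \<le> integral\<^sup>L lborel g" using A by simp
    have "dirichlet g \<le> (\<integral>z. indicat_real \<Omega> z \<partial>lborel)"
      unfolding dirichlet_def
    proof (rule integral_mono[OF test_function_integrable(3)[OF test] int\<Omega>])
      show "(norm (grad g z))\<^sup>2 \<le> indicat_real \<Omega> z" for z
        using g(2)[of z] grad_test_function_outside[OF test, of z]
        by (cases "z \<in> \<Omega>") (auto simp: power_le_one)
    qed
    then have D: "dirichlet g \<le> ?m" using \<Omega>(2) by simp
    \<comment> \<open>The multiple of \<open>g\<close> that maximises the lower bound 2 t (s 2^(-d)
      |\<Omega>|) - t^2 |\<Omega>| for the energy.\<close>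
    define t where "t = s * (1 / 2) ^ DIM('a)"
    have t: "t > 0" using s by (simp add: t_def)
    have "2 * t * (t * ?m) - t\<^sup>2 * ?m \<le> 2 * t * integral\<^sup>L lborel g - t\<^sup>2 * dirichlet g"
      using t I D by (intro diff_mono mult_left_mono) (auto simp: t_def mult.assoc)
    also have "\<dots> = torsion_energy (\<lambda>z. t * g z + 0 * g z)"
      unfolding torsion_energy_def dirichlet_lincomb[OF test test] integral_lincomb[OF test test] by simp
    also have "\<dots> \<le> tors \<Omega>" by (intro torsion_energy_le_tors \<Omega> test_function_lincomb test)
    finally have "t\<^sup>2 * ?m \<le> tors \<Omega>" by (simp add: power2_eq_square)
    moreover have "t\<^sup>2 = s\<^sup>2 / 4 ^ DIM('a)"
    proof -
      have "((1 / 2) ^ DIM('a))\<^sup>2 = (1 / 4 :: real) ^ DIM('a)"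
        by (simp add: power2_eq_square flip: power_mult_distrib)
      then show ?thesis by (simp add: t_def power_mult_distrib power_divide)
    qed
    ultimately show ?thesis by (simp add: s_def)
  qed
  have "((\<lambda>\<delta>. (r / 2 - 3 * \<delta>)\<^sup>2 * ?m / 4 ^ DIM('a)) \<longlongrightarrow> (r / 2 - 3 * 0)\<^sup>2 * ?m / 4 ^ DIM('a)) (at_right 0)"
    by (intro tendsto_intros) auto
  then have "(r / 2 - 3 * 0)\<^sup>2 * ?m / 4 ^ DIM('a) \<le> tors \<Omega>"
  proof (rule tendsto_upperbound)
    show "\<forall>\<^sub>F \<delta> in at_right 0. (r / 2 - 3 * \<delta>)\<^sup>2 * ?m / 4 ^ DIM('a) \<le> tors \<Omega>"
      unfolding eventually_at_right_field using main \<open>r > 0\<close> by (intro exI[of _ "r / 6"]) auto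
  qed auto
  then show ?thesis by (simp add: power_divide)
qed

section \<open>Newtonian capacity\<close>

definition cap_admissible :: "'a::euclidean_space set \<Rightarrow> ('a \<Rightarrow> real) \<Rightarrow> bool" where
  "cap_admissible K \<phi> \<longleftrightarrow> Ck 1 \<phi> \<and> compact_support_in UNIV \<phi> \<and>
     (\<exists>\<epsilon>>0. \<forall>x\<in>(\<Union>y\<in>K. ball y \<epsilon>). \<phi> x \<ge> 1)"

lemma newtonian_capacity_eq: "newtonian_capacity K = Inf {dirichlet \<phi> | \<phi>. cap_admissible K \<phi>}"
  by (simp add: newtonian_capacity_def dirichlet_def cap_admissible_def)

lemma newtonian_capacity_le: "cap_admissible K \<phi> \<Longrightarrow> newtonian_capacity K \<le> dirichlet \<phi>"
  unfolding newtonian_capacity_eq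
  by (rule cInf_lower) (auto intro!: bdd_belowI[of _ 0] simp: dirichlet_nonneg)

text \<open>The mollification of \<open>max 0 (1 + 2 * \<delta> - infdist x K)\<close> at scale
  \<delta> is at least 1 within distance \<delta> of \<open>K\<close> and has gradient at most 1, so
  the volume of its support bounds the Dirichlet integral. It shows that the infimum defining the
  capacity runs over a nonempty set, without which \<open>Inf\<close> would carry no
  information.\<close>

lemma cap_admissible_exists:
  fixes K :: "'a::euclidean_space set"
  assumes "bounded K" "0 < \<delta>" "\<delta> < 1 / 4"
  obtains \<phi> where "cap_admissible K \<phi>"
    "dirichlet \<phi> \<le> measure lborel {x. infdist x K \<le> 1 + 3 * \<delta>}"
proof (cases "K = {}")
  case True
  have "cap_admissible K (\<lambda>x. 0)"
    using True test_function_0[of UNIV] unfolding cap_admissible_def by (auto intro!: exI[of _ 1] simp: test_function_def simp del: Ck.simps)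
  then show ?thesis by (rule that) (simp add: dirichlet_def grad_def frechet_derivative_const)
next
  case False
  let ?N = "{x. infdist x K \<le> 1 + 3 * \<delta>}"
  define f where "f x = max 0 (1 + 2 * \<delta> - infdist x K)" for x
  have lip: "\<bar>f x - f y\<bar> \<le> 1 * norm (x - y)" for x y
    using infdist_triangle_abs[of x K y] by (auto simp: f_def dist_norm)
  have "bounded ?N"
  proof -
    obtain R where R: "\<And>x. x \<in> K \<Longrightarrow> norm x \<le> R" using assms(1) unfolding bounded_pos by auto
    have "norm x \<le> R + 2" if "infdist x K \<le> 1 + 3 * \<delta>" for x
    proof -
      have "infdist x K < 2" using that assms(3) by simp
      then obtain y where "y \<in> K" "dist x y < 2"
        using infdist_notempty[OF False, of x] cInf_lessD[of "dist x ` K" 2] False by auto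
      then show ?thesis using R[of y] norm_triangle_ineq2[of x y] by (simp add: dist_norm)
    qed
    then show ?thesis by (auto simp: bounded_iff)
  qed
  moreover have "closed ?N" by (intro closed_Collect_le continuous_intros)
  ultimately have N: "compact ?N" using compact_eq_bounded_closed by blast
  have f0: "f x = 0" if "x \<notin> ?N" for x using that assms(2) by (auto simp: f_def)
  obtain g where g: "\<And>k. Ck k g" "\<And>x. norm (grad g x) \<le> 1"
      "\<And>x c. (\<And>y. norm (y - x) < \<delta> \<Longrightarrow> f y \<ge> c) \<Longrightarrow> g x \<ge> c"
      "\<And>x c. (\<And>y. norm (y - x) < \<delta> \<Longrightarrow> f y \<le> c) \<Longrightarrow> g x \<le> c"
    using lipschitz_mollification[OF lip N f0 \<open>0 < \<delta>\<close>] by blast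
  have g0: "g z = 0" if "z \<notin> ?N" for z
  proof -
    have "f y = 0" if "norm (y - z) < \<delta>" for y
      using infdist_triangle_abs[of y K z] that \<open>z \<notin> ?N\<close> by (auto simp: f_def dist_norm)
    then show ?thesis using g(3)[of z 0] g(4)[of z 0] by force
  qed
  have supp: "compact_support_in ?N g" by (rule compact_support_inI[OF N subset_refl]) (rule g0)
  have adm: "cap_admissible K g"
    unfolding cap_admissible_def
  proof (intro conjI exI[of _ \<delta>] ballI)
    fix x assume "x \<in> (\<Union>y\<in>K. ball y \<delta>)"
    then obtain v where v: "v \<in> K" "dist v x < \<delta>" by auto
    show "1 \<le> g x"
    proof (rule g(3))
      fix y assume "norm (y - x) < \<delta>"
      then have "dist y v < 2 * \<delta>" using v(2) dist_triangle[of y v x] by (simp add: dist_norm norm_minus_commute)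
      then have "infdist y K \<le> 2 * \<delta>" using infdist_le[OF v(1), of y] by simp
      then show "1 \<le> f y" by (simp add: f_def)
    qed
  qed (use g(1) assms(2) compact_support_in_mono[OF supp] in auto)
  have test: "test_function ?N g" unfolding test_function_def using g(1) supp by blast
  have "dirichlet g \<le> (\<integral>z. indicat_real ?N z \<partial>lborel)"
    unfolding dirichlet_def
  proof (rule integral_mono[OF test_function_integrable(3)[OF test]])
    show "integrable lborel (indicat_real ?N)"
      using N emeasure_bounded_finite[OF compact_imp_bounded[OF N]]
      by (intro integrable_real_indicator) (auto simp: compact_imp_closed borel_closed)
    show "(norm (grad g z))\<^sup>2 \<le> indicat_real ?N z" for z
      using g(2)[of z] grad_test_function_outside[OF test, of z]
      by (cases "z \<in> ?N") (auto simp: power_le_one)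
  qed
  also have "\<dots> = measure lborel ?N" by simp
  finally show ?thesis using that[OF adm] by blast
qed

lemma newtonian_capacity_ge:
  assumes "bounded K" "\<And>\<phi>. cap_admissible K \<phi> \<Longrightarrow> dirichlet \<phi> \<ge> c"
  shows "newtonian_capacity K \<ge> c"
  unfolding newtonian_capacity_eq
proof (rule cInf_greatest)
  show "{dirichlet \<phi> | \<phi>. cap_admissible K \<phi>} \<noteq> {}"
    using cap_admissible_exists[OF assms(1), of "1 / 8"] by fastforce
qed (use assms(2) in auto)

lemma newtonian_capacity_nonneg: "bounded K \<Longrightarrow> newtonian_capacity K \<ge> 0"
  by (rule newtonian_capacity_ge) (simp_all add: dirichlet_nonneg)

lemma newtonian_capacity_mono:
  assumes "K \<subseteq> L" "bounded L"
  shows "newtonian_capacity K \<le> newtonian_capacity L"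
proof (rule newtonian_capacity_ge[OF assms(2)])
  fix \<phi> assume "cap_admissible L \<phi>"
  then have "cap_admissible K \<phi>" using assms(1) unfolding cap_admissible_def by blast
  then show "newtonian_capacity K \<le> dirichlet \<phi>" by (rule newtonian_capacity_le)
qed

text \<open>Competitors are transported without a factor, to keep them at least 1 near the set; only
  the Dirichlet integral rescales. Equality follows by applying the bound to the inverse
  map.\<close>

lemma newtonian_capacity_affine_le:
  fixes K :: "'a::euclidean_space set"
  assumes "bounded K" "c > 0" "DIM('a) \<ge> 2"
  shows "newtonian_capacity ((\<lambda>x. a + c *\<^sub>R x) ` K) \<le> c ^ (DIM('a) - 2) * newtonian_capacity K"
proof -
  let ?K = "(\<lambda>x. a + c *\<^sub>R x) ` K"
  have "newtonian_capacity ?K / c ^ (DIM('a) - 2) \<le> newtonian_capacity K"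
  proof (rule newtonian_capacity_ge[OF assms(1)])
    fix \<phi> assume adm: "cap_admissible K \<phi>"
    then obtain e where \<phi>: "Ck 1 \<phi>" "compact_support_in UNIV \<phi>" and e: "e > 0" "\<And>x y. y \<in> K \<Longrightarrow> dist y x < e \<Longrightarrow> \<phi> x \<ge> 1"
      unfolding cap_admissible_def by auto
    define \<psi> where "\<psi> x = \<phi> ((- (1 / c)) *\<^sub>R a + (1 / c) *\<^sub>R x)" for x
    have "cap_admissible ?K \<psi>"
      unfolding cap_admissible_def
    proof (intro conjI exI[of _ "c * e"] ballI)
      show "Ck 1 \<psi>" unfolding \<psi>_def[abs_def] by (rule Ck_affine[OF \<phi>(1)])
      show "compact_support_in UNIV \<psi>"
        unfolding \<psi>_def[abs_def] by (rule compact_support_in_mono[OF compact_support_in_affine[OF \<phi>(2) assms(2)]]) simp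
      fix x assume "x \<in> (\<Union>y\<in>?K. ball y (c * e))"
      then obtain y where y: "y \<in> K" "norm (a + c *\<^sub>R y - x) < c * e" by (auto simp: dist_norm)
      have "a + c *\<^sub>R y - x = c *\<^sub>R (y - ((- (1 / c)) *\<^sub>R a + (1 / c) *\<^sub>R x))"
        using assms(2) by (simp add: algebra_simps)
      then have "c * norm (y - ((- (1 / c)) *\<^sub>R a + (1 / c) *\<^sub>R x)) < c * e"
        using y(2) assms(2) by simp
      then have "dist y ((- (1 / c)) *\<^sub>R a + (1 / c) *\<^sub>R x) < e" using assms(2) by (simp add: dist_norm)
      then show "1 \<le> \<psi> x" unfolding \<psi>_def by (rule e(2)[OF y(1)])
    qed (use e assms(2) in auto)
    then have "newtonian_capacity ?K \<le> dirichlet \<psi>" by (rule newtonian_capacity_le)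
    also have "\<dots> = c ^ DIM('a) / c\<^sup>2 * dirichlet \<phi>"
      unfolding \<psi>_def[abs_def] by (rule dirichlet_affine[OF \<phi>(1) assms(2)])
    also have "c ^ DIM('a) / c\<^sup>2 = c ^ (DIM('a) - 2)" using assms by (simp add: power_diff)
    finally show "newtonian_capacity ?K / c ^ (DIM('a) - 2) \<le> dirichlet \<phi>"
      using assms(2) by (simp add: field_simps)
  qed
  then show ?thesis using assms(2) by (simp add: field_simps)
qed

lemma bounded_affine:
  fixes K :: "'a::real_normed_vector set"
  shows "bounded K \<Longrightarrow> bounded ((\<lambda>x. a + c *\<^sub>R x) ` K)"
  using bounded_scaling[of K c] bounded_translation[of "(\<lambda>x. c *\<^sub>R x) ` K" a] by (auto simp: image_image)

lemma newtonian_capacity_affine: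
  fixes K :: "'a::euclidean_space set"
  assumes "bounded K" "c > 0" "DIM('a) \<ge> 2"
  shows "newtonian_capacity ((\<lambda>x. a + c *\<^sub>R x) ` K) = c ^ (DIM('a) - 2) * newtonian_capacity K"
proof (rule antisym[OF newtonian_capacity_affine_le[OF assms]])
  have "newtonian_capacity K \<le> (1 / c) ^ (DIM('a) - 2) * newtonian_capacity ((\<lambda>x. a + c *\<^sub>R x) ` K)"
    using newtonian_capacity_affine_le[OF bounded_affine[OF assms(1)], of "1 / c" "- (1 / c) *\<^sub>R a" a c] assms(2,3)
    by (simp only: affine_image_inverse) simp
  then show "c ^ (DIM('a) - 2) * newtonian_capacity K \<le> newtonian_capacity ((\<lambda>x. a + c *\<^sub>R x) ` K)"
    using assms(2) by (simp add: power_divide field_simps)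
qed

text \<open>In the limit the competitor falls linearly from 1 to 0 over a unit distance outside the
  ball. Its gradient is at most 1 and it is supported in the ball of radius 2, whose volume is the
  bound.\<close>

lemma newtonian_capacity_ball_le:
  assumes "DIM('a::euclidean_space) \<ge> 2"
  shows "newtonian_capacity (cball (0::'a) 1) \<le> 2 ^ DIM('a) * measure lborel (ball (0::'a) 1)"
proof -
  have le: "newtonian_capacity (cball (0::'a) 1) \<le> (2 + 3 * \<delta>) ^ DIM('a) * measure lborel (ball (0::'a) 1)"
    if \<delta>: "0 < \<delta>" "\<delta> < 1 / 4" for \<delta>
  proof -
    obtain \<phi> where \<phi>: "cap_admissible (cball (0::'a) 1) \<phi>"
      "dirichlet \<phi> \<le> measure lborel {x. infdist x (cball (0::'a) 1) \<le> 1 + 3 * \<delta>}"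
      using cap_admissible_exists[OF bounded_cball \<delta>] by metis
    have "{x. infdist x (cball (0::'a) 1) \<le> 1 + 3 * \<delta>} \<subseteq> cball 0 (2 + 3 * \<delta>)"
    proof clarsimp
      fix x :: 'a assume x: "infdist x (cball 0 1) \<le> 1 + 3 * \<delta>"
      have "closed (cball (0::'a) 1)" "cball (0::'a) 1 \<noteq> {}" by auto
      then obtain y where "y \<in> cball 0 1" "infdist x (cball 0 1) = dist x y"
        using infdist_attains_inf by blast
      then show "norm x \<le> 2 + 3 * \<delta>" using x norm_triangle_ineq2[of x y] by (simp add: dist_norm)
    qed
    then have "measure lborel {x. infdist x (cball (0::'a) 1) \<le> 1 + 3 * \<delta>} \<le> measure lborel (cball (0::'a) (2 + 3 * \<delta>))"
      by (intro measure_mono_fmeasurable fmeasurable_lborel_bounded)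
         (auto intro!: borel_closed closed_Collect_le continuous_intros)
    also have "\<dots> = (2 + 3 * \<delta>) ^ DIM('a) * measure lborel (ball (0::'a) 1)"
      using content_ball_conv_unit_ball[of "2 + 3 * \<delta>" "0::'a"] \<delta> by (simp add: content_cball_conv_ball)
    finally show ?thesis using newtonian_capacity_le[OF \<phi>(1)] \<phi>(2) by linarith
  qed
  have "((\<lambda>\<delta>. (2 + 3 * \<delta>) ^ DIM('a) * measure lborel (ball (0::'a) 1)) \<longlongrightarrow>
      (2 + 3 * 0) ^ DIM('a) * measure lborel (ball (0::'a) 1)) (at_right 0)"
    by (intro tendsto_intros)
  then have "newtonian_capacity (cball (0::'a) 1) \<le> (2 + 3 * 0) ^ DIM('a) * measure lborel (ball (0::'a) 1)"
  proof (rule tendsto_lowerbound)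
    show "\<forall>\<^sub>F \<delta> in at_right 0. newtonian_capacity (cball (0::'a) 1) \<le> (2 + 3 * \<delta>) ^ DIM('a) * measure lborel (ball (0::'a) 1)"
      unfolding eventually_at_right_field using le by (intro exI[of _ "1 / 4"]) auto
  qed auto
  then show ?thesis by simp
qed

section \<open>Dirichlet integrals bounded below by superharmonic functions\<close>

lemma convolution_continuous:
  fixes k f :: "'a::euclidean_space \<Rightarrow> real"
  assumes k: "continuous_on UNIV k" and B: "\<And>x. \<bar>k x\<bar> \<le> B" and f: "integrable lborel f"
  shows "continuous_on UNIV (\<lambda>x. \<integral>y. k (x - y) * f y \<partial>lborel)"
  unfolding continuous_on_sequentially comp_def
proof (intro allI ballI impI, elim conjE)
  fix X :: "nat \<Rightarrow> 'a" and x assume X: "X \<longlonglongrightarrow> x"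
  have [measurable]: "k \<in> borel_measurable borel" "f \<in> borel_measurable borel"
    using k f by (auto intro: borel_measurable_continuous_onI)
  show "(\<lambda>n. \<integral>y. k (X n - y) * f y \<partial>lborel) \<longlonglongrightarrow> (\<integral>y. k (x - y) * f y \<partial>lborel)"
  proof (rule integral_dominated_convergence[where w = "\<lambda>y. B * \<bar>f y\<bar>"])
    show "integrable lborel (\<lambda>y. B * \<bar>f y\<bar>)" using f by simp
    show "AE y in lborel. (\<lambda>n. k (X n - y) * f y) \<longlonglongrightarrow> k (x - y) * f y"
    proof (intro AE_I2 tendsto_mult_right)
      fix y
      have "(\<lambda>n. X n - y) \<longlonglongrightarrow> x - y" by (intro tendsto_intros X)
      then show "(\<lambda>n. k (X n - y)) \<longlonglongrightarrow> k (x - y)"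
        using continuous_on_tendsto_compose[OF k] by auto
    qed
    show "AE y in lborel. norm (k (X n - y) * f y) \<le> B * \<bar>f y\<bar>" for n
      by (intro AE_I2) (simp add: abs_mult mult_right_mono B)
  qed measurable
qed

text \<open>Bounded kernels with bounded gradient replace compact support here. Applied to the
  regularised Newton kernel and then to its partial derivatives, it makes the potential twice
  continuously differentiable with derivatives computed under the integral.\<close>

lemma convolution_Ck_1:
  fixes k f :: "'a::euclidean_space \<Rightarrow> real"
  assumes k: "Ck 1 k" and B: "\<And>x. \<bar>k x\<bar> \<le> B" and L: "\<And>x. norm (grad k x) \<le> L" and f: "integrable lborel f"
  shows "Ck 1 (\<lambda>x. \<integral>y. k (x - y) * f y \<partial>lborel)"
    and "grad (\<lambda>x. \<integral>y. k (x - y) * f y \<partial>lborel) x \<bullet> h = (\<integral>y. (grad k (x - y) \<bullet> h) * f y \<partial>lborel)"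
proof -
  note D = convolution_has_derivative[OF k B L f]
  show "Ck 1 (\<lambda>x. \<integral>y. k (x - y) * f y \<partial>lborel)"
    unfolding One_nat_def
  proof (rule Ck_Suc_intro[OF D])
    fix b :: 'a
    have "continuous_on UNIV (\<lambda>x. \<integral>y. (grad k (x - y) \<bullet> b) * f y \<partial>lborel)"
      by (rule convolution_continuous[OF _ abs_inner_le[OF L] f])
         (intro continuous_intros Ck_1_continuous_grad k)
    then show "Ck 0 (\<lambda>x. \<integral>y. (grad k (x - y) \<bullet> b) * f y \<partial>lborel)" by simp
  qed
  from has_derivative_unique[OF Ck_1_has_derivative[OF this] D, of x]
  show "grad (\<lambda>x. \<integral>y. k (x - y) * f y \<partial>lborel) x \<bullet> h = (\<integral>y. (grad k (x - y) \<bullet> h) * f y \<partial>lborel)"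
    by (rule fun_cong)
qed

text \<open>Expanding \<open>grad (\<phi>\<^sup>2 / U) \<bullet> grad U\<close> and completing the square.\<close>

lemma dirichlet_ge_superharmonic:
  fixes \<phi> U :: "'a::euclidean_space \<Rightarrow> real"
  assumes \<phi>: "Ck 1 \<phi>" "compact_support_in UNIV \<phi>"
    and U: "Ck 1 U" "\<And>b. b \<in> Basis \<Longrightarrow> Ck 1 (\<lambda>x. grad U x \<bullet> b)" "\<And>x. U x > 0"
    and F: "\<And>x. F x = - (\<Sum>b\<in>Basis. grad (\<lambda>x. grad U x \<bullet> b) x \<bullet> b)"
  shows "integrable lborel (\<lambda>x. (\<phi> x)\<^sup>2 / U x * F x)"
    and "(\<integral>x. (\<phi> x)\<^sup>2 / U x * F x \<partial>lborel) \<le> dirichlet \<phi>"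
proof -
  obtain K where K: "compact K" "\<And>x. x \<notin> K \<Longrightarrow> \<phi> x = 0" "\<And>x. x \<notin> K \<Longrightarrow> grad \<phi> x = 0"
    using compact_support_inE[OF \<phi>(2)] by metis
  \<comment> \<open>The quotient \<phi>^2 / U, written as a product with a real power so that
    closure under products and powers yields its regularity.\<close>
  define P where "P x = \<phi> x * \<phi> x * U x powr (-1)" for x
  have P: "Ck 1 P" unfolding P_def[abs_def] by (intro Ck_mult Ck_powr \<phi> U)
  have P_eq: "P x = (\<phi> x)\<^sup>2 / U x" for x
    using U(3)[of x] by (simp add: P_def powr_minus power2_eq_square divide_inverse less_imp_le)
  have P0: "P x = 0" if "x \<notin> K" for x using K(2)[OF that] by (simp add: P_def)
  have gP0: "grad P x = 0" if "x \<notin> K" for x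
    using grad_zero_nbhd[of "- K" P x] P0 that K(1) compact_imp_closed by blast
  have gP: "grad P x = (2 * \<phi> x / U x) *\<^sub>R grad \<phi> x - ((\<phi> x)\<^sup>2 / (U x)\<^sup>2) *\<^sub>R grad U x" for x
  proof (rule grad_eqI)
    have U0: "U x \<noteq> 0" using U(3)[of x] by simp
    have "((\<lambda>x. (\<phi> x)\<^sup>2 / U x) has_derivative
       (\<lambda>h. ((2 * \<phi> x / U x) *\<^sub>R grad \<phi> x - ((\<phi> x)\<^sup>2 / (U x)\<^sup>2) *\<^sub>R grad U x) \<bullet> h)) (at x)"
      by (rule has_derivative_eq_rhs[OF has_derivative_divide[OF has_derivative_power[OF Ck_1_has_derivative[OF \<phi>(1)]]
            Ck_1_has_derivative[OF U(1)] U0]])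
         (use U0 in \<open>auto simp: inner_diff_left field_simps power2_eq_square\<close>)
    then show "(P has_derivative
       (\<lambda>h. ((2 * \<phi> x / U x) *\<^sub>R grad \<phi> x - ((\<phi> x)\<^sup>2 / (U x)\<^sup>2) *\<^sub>R grad U x) \<bullet> h)) (at x)"
      by (simp add: P_eq[abs_def])
  qed
  have c: "continuous_on UNIV P" "continuous_on UNIV (grad P)" "continuous_on UNIV (grad U)"
    "b \<in> Basis \<Longrightarrow> continuous_on UNIV (grad (\<lambda>x. grad U x \<bullet> b))" for b
    using P U by (auto intro: Ck_1_continuous Ck_1_continuous_grad)
  have "integrable lborel (\<lambda>x. P x * F x)"
    unfolding F by (rule integrable_compact_support[OF _ K(1)]) (auto intro!: continuous_intros c simp: P0)
  then show "integrable lborel (\<lambda>x. (\<phi> x)\<^sup>2 / U x * F x)" by (simp add: P_eq)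
  have i1: "integrable lborel (\<lambda>x. P x * (grad (\<lambda>x. grad U x \<bullet> b) x \<bullet> b))" if "b \<in> Basis" for b
    by (rule integrable_compact_support[OF _ K(1)]) (use that in \<open>auto intro!: continuous_intros c simp: P0\<close>)
  have i2: "integrable lborel (\<lambda>x. (grad U x \<bullet> b) * (grad P x \<bullet> b))" for b
    by (rule integrable_compact_support[OF _ K(1)]) (auto intro!: continuous_intros c simp: gP0)
  have i3: "integrable lborel (\<lambda>x. grad U x \<bullet> grad P x)"
    by (rule integrable_compact_support[OF _ K(1)]) (auto intro!: continuous_intros c simp: gP0)
  have "(\<integral>x. P x * F x \<partial>lborel) = (\<integral>x. - (\<Sum>b\<in>Basis. P x * (grad (\<lambda>x. grad U x \<bullet> b) x \<bullet> b)) \<partial>lborel)"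
    by (simp add: F sum_distrib_left)
  also have "\<dots> = - (\<Sum>b\<in>Basis. \<integral>x. P x * (grad (\<lambda>x. grad U x \<bullet> b) x \<bullet> b) \<partial>lborel)"
    using i1 by (simp add: Bochner_Integration.integral_sum)
  also have "\<dots> = (\<Sum>b\<in>Basis. \<integral>x. (grad U x \<bullet> b) * (grad P x \<bullet> b) \<partial>lborel)"
    using integration_by_parts[OF P U(2) K(1) P0] by (simp add: sum_negf)
  also have "\<dots> = (\<integral>x. grad U x \<bullet> grad P x \<partial>lborel)"
  proof -
    have "(\<lambda>x. grad U x \<bullet> grad P x) = (\<lambda>x. \<Sum>b\<in>Basis. (grad U x \<bullet> b) * (grad P x \<bullet> b))"
      by (rule ext, rule euclidean_inner)
    then show ?thesis using i2 by (simp add: Bochner_Integration.integral_sum)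
  qed
  also have "\<dots> \<le> dirichlet \<phi>"
    unfolding dirichlet_def
  proof (rule integral_mono[OF i3 C1c_integrable_grad_square[OF \<phi>]])
    fix x
    define s where "s = \<phi> x / U x"
    have "grad U x \<bullet> grad P x = 2 * (grad \<phi> x \<bullet> (s *\<^sub>R grad U x)) - (norm (s *\<^sub>R grad U x))\<^sup>2"
      by (simp add: gP s_def inner_diff_right power_mult_distrib power_divide dot_square_norm inner_commute)
    also have "\<dots> \<le> (norm (grad \<phi> x))\<^sup>2"
    proof -
      have "0 \<le> (norm (grad \<phi> x - s *\<^sub>R grad U x))\<^sup>2" by simp
      then show ?thesis unfolding power2_norm_eq_inner by (simp add: inner_diff_left inner_diff_right inner_commute)
    qed
    finally show "grad U x \<bullet> grad P x \<le> (norm (grad \<phi> x))\<^sup>2" .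
  qed
  finally show "(\<integral>x. (\<phi> x)\<^sup>2 / U x * F x \<partial>lborel) \<le> dirichlet \<phi>" by (simp add: P_eq)
qed

section \<open>The regularised Newton kernel\<close>

context
  fixes \<epsilon> :: real assumes \<epsilon>: "\<epsilon> > 0"
begin

text \<open>For \<open>a = (2 - d) / 2\<close> this is the Newton kernel |z|^(2-d) smoothed at scale
  \<epsilon>. The exponent is a parameter because differentiation lowers it by one and produces a
  factor \<open>z\<close>.\<close>

definition rker :: "real \<Rightarrow> 'a::euclidean_space \<Rightarrow> real" where
  "rker a z = ((norm z)\<^sup>2 + \<epsilon>\<^sup>2) powr a"

lemma rker_base_pos: "(norm z)\<^sup>2 + \<epsilon>\<^sup>2 > 0"
  using \<epsilon> by (simp add: add_nonneg_pos)

lemma Ck_rker: "Ck k (rker a)"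
  unfolding rker_def[abs_def] by (intro Ck_powr Ck_add Ck_norm_square Ck_const rker_base_pos)

lemma grad_rker: "grad (rker a) z = (2 * a * rker (a - 1) z) *\<^sub>R z"
proof (rule grad_eqI)
  have "((\<lambda>t. t powr a) has_real_derivative a * ((norm z)\<^sup>2 + \<epsilon>\<^sup>2) powr (a - 1)) (at ((norm z)\<^sup>2 + \<epsilon>\<^sup>2))"
    using rker_base_pos by (rule has_real_derivative_powr)
  moreover have "((\<lambda>z. (norm z)\<^sup>2 + \<epsilon>\<^sup>2) has_derivative (\<lambda>h. 2 * (z \<bullet> h))) (at z)"
    unfolding power2_norm_eq_inner by (auto intro!: derivative_eq_intros simp: inner_commute)
  ultimately have "((\<lambda>z. ((norm z)\<^sup>2 + \<epsilon>\<^sup>2) powr a) has_derivative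
      (\<lambda>h. 2 * (z \<bullet> h) * (a * ((norm z)\<^sup>2 + \<epsilon>\<^sup>2) powr (a - 1)))) (at z)"
    by (rule DERIV_compose_FDERIV)
  then show "(rker a has_derivative (\<lambda>h. ((2 * a * rker (a - 1) z) *\<^sub>R z) \<bullet> h)) (at z)"
    by (simp add: rker_def[abs_def] mult_ac)
qed

lemma rker_pos: "rker a z > 0"
  using \<epsilon> by (simp add: rker_def)

lemma rker_le: "a \<le> 0 \<Longrightarrow> rker a z \<le> \<epsilon>\<^sup>2 powr a"
  unfolding rker_def using \<epsilon> by (intro powr_mono2') auto

text \<open>A factor \<open>norm z\<close> costs half a unit of the exponent. This compensates the
  factors \<open>z\<close> in the derivatives, which are thus bounded by kernels of nonpositive
  exponent, hence by constants.\<close>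

lemma rker_norm_le: "rker a z * norm z \<le> rker (a + 1 / 2) z"
proof -
  have "norm z \<le> sqrt ((norm z)\<^sup>2 + \<epsilon>\<^sup>2)" by (simp add: real_le_rsqrt)
  also have "\<dots> = ((norm z)\<^sup>2 + \<epsilon>\<^sup>2) powr (1 / 2)" by (rule powr_half_sqrt[symmetric]) simp
  finally show ?thesis unfolding rker_def powr_add by (intro mult_left_mono) auto
qed

lemma Ck_grad_rker: "Ck k (\<lambda>z. grad (rker a) z \<bullet> b)"
  unfolding grad_rker inner_scaleR_left by (intro Ck_mult Ck_const Ck_rker Ck_inner)

lemma grad_grad_rker:
  "grad (\<lambda>z. grad (rker a) z \<bullet> b) z = (2 * a) *\<^sub>R (rker (a - 1) z *\<^sub>R b + (2 * (a - 1) * rker (a - 2) z * (z \<bullet> b)) *\<^sub>R z)"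
proof -
  have d: "rker (a - 1) differentiable at z" by (rule Ck_1_differentiable[OF Ck_rker])
  have "grad (\<lambda>z. rker (a - 1) z * (z \<bullet> b)) z = rker (a - 1) z *\<^sub>R b + (z \<bullet> b) *\<^sub>R grad (rker (a - 1)) z"
    by (subst grad_mult[OF d]) (auto simp: grad_inner_coordinate)
  moreover have "grad (\<lambda>z. (2 * a) * (rker (a - 1) z * (z \<bullet> b)) + 0 * 0) z =
      (2 * a) *\<^sub>R grad (\<lambda>z. rker (a - 1) z * (z \<bullet> b)) z + 0 *\<^sub>R grad (\<lambda>x. 0::real) z"
    by (rule grad_lincomb) (auto intro!: derivative_intros d)
  ultimately show ?thesis
    by (simp add: grad_rker mult.assoc mult.left_commute[of "z \<bullet> b"] mult.commute[of "z \<bullet> b"])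
qed

lemma grad_rker_bounded:
  assumes "a \<le> 0"
  shows "\<exists>B. \<forall>z. norm (grad (rker a) z) \<le> B"
proof -
  have "norm (grad (rker a) z) \<le> \<bar>2 * a\<bar> * \<epsilon>\<^sup>2 powr (a - 1 / 2)" for z
  proof -
    have "norm (grad (rker a) z) = \<bar>2 * a\<bar> * (rker (a - 1) z * norm z)"
      using rker_pos[of "a - 1" z] by (simp add: grad_rker abs_mult)
    also have "rker (a - 1) z * norm z \<le> rker (a - 1 / 2) z" using rker_norm_le[of "a - 1" z] by simp
    also have "\<dots> \<le> \<epsilon>\<^sup>2 powr (a - 1 / 2)" using assms by (intro rker_le) simp
    finally show ?thesis by (simp add: mult_left_mono)
  qed
  then show ?thesis by blast
qed

lemma grad_grad_rker_bounded:
  assumes "a \<le> 0" "b \<in> Basis"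
  shows "\<exists>B. \<forall>z. norm (grad (\<lambda>z. grad (rker a) z \<bullet> b) z) \<le> B"
proof -
  have "norm (grad (\<lambda>z. grad (rker a) z \<bullet> b) z) \<le> \<bar>2 * a\<bar> * (\<epsilon>\<^sup>2 powr (a - 1) + \<bar>2 * (a - 1)\<bar> * \<epsilon>\<^sup>2 powr (a - 1))" for z
  proof -
    have "rker (a - 2) z * norm z * norm z \<le> rker (a - 3 / 2) z * norm z"
      using rker_norm_le[of "a - 2" z] by (intro mult_right_mono) auto
    also have "\<dots> \<le> rker (a - 1) z" using rker_norm_le[of "a - 3 / 2" z] by simp
    also have le: "\<dots> \<le> \<epsilon>\<^sup>2 powr (a - 1)" using assms by (intro rker_le) simp
    finally have 1: "rker (a - 2) z * norm z * norm z \<le> \<epsilon>\<^sup>2 powr (a - 1)" .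
    have "norm (rker (a - 1) z *\<^sub>R b + (2 * (a - 1) * rker (a - 2) z * (z \<bullet> b)) *\<^sub>R z) \<le>
        norm (rker (a - 1) z *\<^sub>R b) + norm ((2 * (a - 1) * rker (a - 2) z * (z \<bullet> b)) *\<^sub>R z)"
      by (rule norm_triangle_ineq)
    also have "norm (rker (a - 1) z *\<^sub>R b) \<le> \<epsilon>\<^sup>2 powr (a - 1)"
      using le rker_pos[of "a - 1" z] assms(2) by simp
    also have "norm ((2 * (a - 1) * rker (a - 2) z * (z \<bullet> b)) *\<^sub>R z) =
        \<bar>2 * (a - 1)\<bar> * (rker (a - 2) z * \<bar>z \<bullet> b\<bar> * norm z)"
      using rker_pos[of "a - 2" z] by (simp add: abs_mult mult.assoc)
    also have "\<dots> \<le> \<bar>2 * (a - 1)\<bar> * (rker (a - 2) z * norm z * norm z)"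
      using rker_pos[of "a - 2" z] Basis_le_norm[OF assms(2), of z]
      by (intro mult_left_mono mult_right_mono) auto
    also have "\<dots> \<le> \<bar>2 * (a - 1)\<bar> * \<epsilon>\<^sup>2 powr (a - 1)" using 1 by (intro mult_left_mono) auto
    finally show ?thesis unfolding grad_grad_rker norm_scaleR by (simp add: mult_left_mono)
  qed
  then show ?thesis by blast
qed

text \<open>For this exponent the terms in |z|^2 cancel and only \<epsilon>^2 survives. What
  remains, up to sign, is a positive kernel concentrating at 0 as \<epsilon> tends to 0, the smooth
  counterpart of the point mass in -\<Delta>|z|^(2-d).\<close>

lemma laplacian_rker:
  fixes z :: "'a::euclidean_space"
  assumes "a = (2 - real DIM('a)) / 2"
  shows "(\<Sum>b\<in>Basis. grad (\<lambda>z. grad (rker a) z \<bullet> b) z \<bullet> b) =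
    - (real DIM('a) * (real DIM('a) - 2) * \<epsilon>\<^sup>2 * rker (a - 2) z)"
proof -
  have s: "rker (a - 1) z = rker (a - 2) z * ((norm z)\<^sup>2 + \<epsilon>\<^sup>2)"
    using powr_add[of "(norm z)\<^sup>2 + \<epsilon>\<^sup>2" "a - 2" 1] rker_base_pos[of z] by (simp add: rker_def)
  have "(\<Sum>b\<in>Basis. grad (\<lambda>z. grad (rker a) z \<bullet> b) z \<bullet> b) =
     (\<Sum>b\<in>Basis. 2 * a * rker (a - 1) z + 2 * a * (2 * (a - 1) * rker (a - 2) z) * ((z \<bullet> b) * (z \<bullet> b)))"
    by (intro sum.cong) (auto simp: grad_grad_rker inner_add_left inner_same_Basis algebra_simps)
  also have "\<dots> = real DIM('a) * (2 * a * rker (a - 1) z) + 2 * a * (2 * (a - 1) * rker (a - 2) z) * (z \<bullet> z)"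
    by (simp add: sum.distrib euclidean_inner[of z z] flip: sum_distrib_left)
  also have "\<dots> = - (real DIM('a) * (real DIM('a) - 2) * \<epsilon>\<^sup>2 * rker (a - 2) z)"
  proof -
    have a: "2 * a = 2 - real DIM('a)" "2 * (a - 1) = - real DIM('a)" using assms by simp_all
    show ?thesis unfolding s a by (simp add: dot_square_norm algebra_simps)
  qed
  finally show ?thesis .
qed

end

section \<open>Newton potentials of subsets of a slab\<close>

lemma nn_integral_lborel_reflect_translate:
  fixes f :: "'a::euclidean_space \<Rightarrow> ennreal"
  assumes [measurable]: "f \<in> borel_measurable borel"
  shows "(\<integral>\<^sup>+x. f (x - y) \<partial>lborel) = integral\<^sup>N lborel f"
proof -
  have "lborel = distr lborel borel (\<lambda>x::'a. - y + 1 *\<^sub>R x)"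
    using lborel_affine[of 1 "- y"] by (simp add: density_1)
  then have "integral\<^sup>N lborel f = integral\<^sup>N (distr lborel borel (\<lambda>x::'a. - y + 1 *\<^sub>R x)) f" by simp
  also have "\<dots> = (\<integral>\<^sup>+x. f (x - y) \<partial>lborel)" by (subst nn_integral_distr) auto
  finally show ?thesis by simp
qed

lemma Tonelli_lborel:
  fixes f :: "'a::euclidean_space \<Rightarrow> 'b::euclidean_space \<Rightarrow> ennreal"
  assumes "(\<lambda>(x, y). f x y) \<in> borel_measurable (borel \<Otimes>\<^sub>M borel)"
  shows "(\<integral>\<^sup>+y. \<integral>\<^sup>+x. f x y \<partial>lborel \<partial>lborel) = (\<integral>\<^sup>+x. \<integral>\<^sup>+y. f x y \<partial>lborel \<partial>lborel)"
proof -
  have psf: "pair_sigma_finite (lborel :: 'a measure) (lborel :: 'b measure)" by unfold_locales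
  have "(\<lambda>(x, y). f x y) \<in> borel_measurable (lborel \<Otimes>\<^sub>M lborel)"
    using assms by (simp cong: measurable_cong_sets sets_pair_measure_cong)
  from pair_sigma_finite.Fubini[OF psf this] show ?thesis by simp
qed

text \<open>Averages the indicator function of \<open>A\<close> over the translations by \<open>t * e\<close> with \<open>\<bar>t\<bar> < s\<close>:
  each point is covered during a time at most \<open>w\<close>, and all translates lie in a ball of radius \<open>2 * s\<close>.\<close>

lemma measure_slab_ball_le:
  fixes A :: "'a::euclidean_space set"
  assumes A: "A \<in> sets borel" "\<And>x. x \<in> A \<Longrightarrow> a < x \<bullet> e \<and> x \<bullet> e < a + w" and "w > 0" "norm e = 1" "s > 0"
  shows "measure lborel (A \<inter> ball x s) \<le> w * 2 ^ (DIM('a) - 1) * measure lborel (ball (0::'a) 1) * s ^ (DIM('a) - 1)"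
proof -
  let ?n = "DIM('a)"
  define B where "B = A \<inter> ball x s"
  have B[measurable]: "B \<in> sets borel" unfolding B_def using A(1) by auto
  have finB: "emeasure lborel B < \<infinity>"
    by (rule emeasure_bounded_finite) (auto simp: B_def intro: bounded_subset[OF bounded_ball])
  define f :: "'a \<Rightarrow> real \<Rightarrow> ennreal" where "f z t = (if \<bar>t\<bar> < s then indicator B (z - t *\<^sub>R e) else 0)" for z t
  have meas: "(\<lambda>(z, t). f z t) \<in> borel_measurable (borel \<Otimes>\<^sub>M borel)"
    unfolding f_def by measurable
  have "(\<integral>\<^sup>+t. \<integral>\<^sup>+z. f z t \<partial>lborel \<partial>lborel) = (\<integral>\<^sup>+t. emeasure lborel B * indicator {-s<..<s} t \<partial>lborel)"
  proof (intro nn_integral_cong)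
    fix t :: real
    show "(\<integral>\<^sup>+z. f z t \<partial>lborel) = emeasure lborel B * indicator {-s<..<s} t"
    proof (cases "\<bar>t\<bar> < s")
      case True
      then have "(\<integral>\<^sup>+z. f z t \<partial>lborel) = (\<integral>\<^sup>+z. indicator B (z - t *\<^sub>R e) \<partial>lborel)" by (simp add: f_def)
      also have "\<dots> = emeasure lborel B"
        by (subst nn_integral_lborel_reflect_translate) auto
      finally show ?thesis using True by (simp add: abs_less_iff)
    qed (auto simp: f_def indicator_def)
  qed
  also have "\<dots> = emeasure lborel B * ennreal (2 * s)"
    using \<open>s > 0\<close> by (subst nn_integral_cmult) auto
  finally have 1: "(\<integral>\<^sup>+z. \<integral>\<^sup>+t. f z t \<partial>lborel \<partial>lborel) = emeasure lborel B * ennreal (2 * s)"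
    using Tonelli_lborel[OF meas] by simp
  have "(\<integral>\<^sup>+z. \<integral>\<^sup>+t. f z t \<partial>lborel \<partial>lborel) \<le> (\<integral>\<^sup>+z. ennreal w * indicator (ball x (2 * s)) z \<partial>lborel)"
  proof (intro nn_integral_mono)
    fix z :: 'a
    show "(\<integral>\<^sup>+t. f z t \<partial>lborel) \<le> ennreal w * indicator (ball x (2 * s)) z"
    proof (cases "z \<in> ball x (2 * s)")
      case True
      have "f z t \<le> indicator {z \<bullet> e - a - w<..<z \<bullet> e - a} t" for t
        using A(2)[of "z - t *\<^sub>R e"] \<open>norm e = 1\<close>
        by (auto simp: f_def indicator_def B_def inner_diff_left norm_eq_1)
      then have "(\<integral>\<^sup>+t. f z t \<partial>lborel) \<le> (\<integral>\<^sup>+t. indicator {z \<bullet> e - a - w<..<z \<bullet> e - a} t \<partial>lborel)"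
        by (intro nn_integral_mono)
      then show ?thesis using True \<open>w > 0\<close> by simp
    next
      case False
      have "f z t = 0" for t
      proof -
        have "z - t *\<^sub>R e \<notin> ball x s" if "\<bar>t\<bar> < s"
        proof
          assume "z - t *\<^sub>R e \<in> ball x s"
          moreover have "dist x z \<le> dist x (z - t *\<^sub>R e) + dist (z - t *\<^sub>R e) z" by (rule dist_triangle)
          moreover have "dist (z - t *\<^sub>R e) z = \<bar>t\<bar>" using \<open>norm e = 1\<close> by (simp add: dist_norm)
          ultimately show False using that False unfolding mem_ball by linarith
        qed
        then show ?thesis by (auto simp: f_def B_def)
      qed
      then show ?thesis by simp
    qed
  qed
  also have "\<dots> = ennreal w * emeasure lborel (ball x (2 * s))"
    by (subst nn_integral_cmult_indicator) auto
  also have "emeasure lborel (ball x (2 * s)) = ennreal (measure lborel (ball x (2 * s)))"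
    using emeasure_bounded_finite[OF bounded_ball] by (intro emeasure_eq_ennreal_measure) (simp add: less_top[symmetric])
  finally have 2: "emeasure lborel B * ennreal (2 * s) \<le> ennreal w * ennreal (measure lborel (ball x (2 * s)))"
    unfolding 1 .
  have "emeasure lborel B = ennreal (measure lborel B)"
    using finB by (intro emeasure_eq_ennreal_measure) (simp add: less_top[symmetric])
  with 2 have "measure lborel B * (2 * s) \<le> w * measure lborel (ball x (2 * s))"
    using \<open>s > 0\<close> \<open>w > 0\<close> by (simp add: ennreal_mult[symmetric])
  also have "measure lborel (ball x (2 * s)) = (2 * s) ^ ?n * measure lborel (ball (0::'a) 1)"
    using \<open>s > 0\<close> by (intro content_ball_conv_unit_ball) simp
  \<comment> \<open>One factor \<open>2 * s\<close> cancels the duration of the averaging, which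
    leaves the power \<open>DIM('a) - 1\<close>.\<close>
  also have "(2 * s) ^ ?n = (2 * s) * (2 * s) ^ (?n - 1)"
    using DIM_positive[where 'a='a] by (cases ?n) auto
  finally have "(2 * s) * measure lborel B \<le> (2 * s) * (w * ((2 * s) ^ (?n - 1) * measure lborel (ball (0::'a) 1)))"
    by (simp add: mult_ac)
  then have "measure lborel B \<le> w * ((2 * s) ^ (?n - 1) * measure lborel (ball (0::'a) 1))"
    using \<open>s > 0\<close> by (simp only: mult_le_cancel_left_pos mult_pos_pos zero_less_numeral)
  then show ?thesis by (simp add: B_def power_mult_distrib mult_ac)
qed

text \<open>A decreasing radial function, written as the tail integral of a density
  \<open>q\<close>, is integrated over \<open>A\<close> by exchanging the order of integration; only
  the measures of \<open>A\<close> in balls remain. It serves for the upper bound of the potential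
  and, in place of polar coordinates, for the lower bound of the kernel mass.\<close>

lemma nn_integral_layer_cake:
  fixes A :: "'a::euclidean_space set"
  assumes [measurable]: "A \<in> sets borel" "q \<in> borel_measurable borel"
  shows "(\<integral>\<^sup>+z. (\<integral>\<^sup>+s. q s * indicator {norm (z - x)<..} s \<partial>lborel) * indicator A z \<partial>lborel) =
    (\<integral>\<^sup>+s. q s * emeasure lborel (A \<inter> ball x s) \<partial>lborel)"
proof -
  define f :: "'a \<Rightarrow> real \<Rightarrow> ennreal" where "f z s = (if norm (z - x) < s then q s * indicator A z else 0)" for z s
  have meas: "(\<lambda>(z, s). f z s) \<in> borel_measurable (borel \<Otimes>\<^sub>M borel)"
    unfolding f_def by measurable
  have "(\<integral>\<^sup>+s. q s * indicator {norm (z - x)<..} s \<partial>lborel) * indicator A z = (\<integral>\<^sup>+s. f z s \<partial>lborel)" for z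
  proof (cases "z \<in> A")
    case True
    then show ?thesis by (auto simp: f_def indicator_def intro!: nn_integral_cong)
  next
    case False
    then have "f z = (\<lambda>s. 0)" by (auto simp: f_def)
    then show ?thesis using False by simp
  qed
  then have "(\<integral>\<^sup>+z. (\<integral>\<^sup>+s. q s * indicator {norm (z - x)<..} s \<partial>lborel) * indicator A z \<partial>lborel) =
      (\<integral>\<^sup>+z. \<integral>\<^sup>+s. f z s \<partial>lborel \<partial>lborel)" by simp
  also have "\<dots> = (\<integral>\<^sup>+s. \<integral>\<^sup>+z. f z s \<partial>lborel \<partial>lborel)" using Tonelli_lborel[OF meas] by simp
  moreover have "(\<integral>\<^sup>+z. f z s \<partial>lborel) = q s * emeasure lborel (A \<inter> ball x s)" for s
  proof -
    have "f z s = q s * indicator (A \<inter> ball x s) z" for z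
      by (auto simp: f_def indicator_def dist_norm norm_minus_commute)
    then show ?thesis by (simp add: nn_integral_cmult_indicator)
  qed
  ultimately show ?thesis by simp
qed

text \<open>The tail integral from \<open>sqrt ((norm z)\<^sup>2 + \<epsilon>\<^sup>2)\<close> on
  equals the kernel; starting at \<open>norm z\<close> only enlarges it and removes \<epsilon>. At
  \<open>z = 0\<close> the right-hand side is infinite, which extended nonnegative integrals
  allow.\<close>

lemma newton_kernel_le_tail:
  fixes z :: "'a::euclidean_space"
  assumes "\<epsilon> > 0" and d: "d > 2"
  shows "ennreal (rker \<epsilon> ((2 - d) / 2) z) \<le>
    (\<integral>\<^sup>+s. ennreal ((d - 2) * s powr (1 - d)) * indicator {norm z<..} s \<partial>lborel)"
proof -
  define r where "r = sqrt ((norm z)\<^sup>2 + \<epsilon>\<^sup>2)"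
  have pos: "(norm z)\<^sup>2 + \<epsilon>\<^sup>2 > 0" using assms(1) by (simp add: add_nonneg_pos)
  have r: "r > 0" unfolding r_def using pos by (rule real_sqrt_gt_zero)
  have rz: "norm z < r" unfolding r_def using assms(1) by (intro real_less_rsqrt) simp
  have "r powr (2 - d) = ((norm z)\<^sup>2 + \<epsilon>\<^sup>2) powr ((2 - d) / 2)"
    using pos by (simp add: r_def powr_half_sqrt[symmetric] powr_powr less_imp_le)
  then have "ennreal (rker \<epsilon> ((2 - d) / 2) z) = ennreal (0 - (- (r powr (2 - d))))"
    using assms(1) by (simp add: rker_def)
  also have "\<dots> = (\<integral>\<^sup>+s. ennreal ((d - 2) * s powr (1 - d)) * indicator {r..} s \<partial>lborel)"
  proof (rule nn_integral_FTC_atLeast[symmetric])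
    show "((\<lambda>s. - (s powr (2 - d))) has_real_derivative (d - 2) * s powr (1 - d)) (at s)" if "r \<le> s" for s
      using that r by (auto intro!: derivative_eq_intros simp: algebra_simps)
    have "((\<lambda>s. s powr (2 - d)) \<longlongrightarrow> 0) at_top"
      using d by (intro tendsto_neg_powr filterlim_ident) auto
    from tendsto_minus[OF this] show "((\<lambda>s. - (s powr (2 - d))) \<longlongrightarrow> 0) at_top" by simp
  qed (use d in auto)
  also have "\<dots> \<le> (\<integral>\<^sup>+s. ennreal ((d - 2) * s powr (1 - d)) * indicator {norm z<..} s \<partial>lborel)"
    using rz by (intro nn_integral_mono) (auto simp: indicator_def)
  finally show ?thesis .
qed

lemma tail_integral_powr:
  assumes "R > 0" "d > 2" "c \<ge> 0"
  shows "(\<integral>\<^sup>+s. ennreal (c * ((d - 2) * s powr (1 - d))) * indicator {R..} s \<partial>lborel) = ennreal (c * R powr (2 - d))"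
proof -
  have "(\<integral>\<^sup>+s. ennreal (c * ((d - 2) * s powr (1 - d))) * indicator {R..} s \<partial>lborel) =
      ennreal (0 - (- (c * R powr (2 - d))))"
  proof (rule nn_integral_FTC_atLeast)
    show "((\<lambda>s. - (c * s powr (2 - d))) has_real_derivative c * ((d - 2) * s powr (1 - d))) (at s)" if "R \<le> s" for s
      using that assms(1) by (auto intro!: derivative_eq_intros simp: algebra_simps)
    have "((\<lambda>s. s powr (2 - d)) \<longlongrightarrow> 0) at_top"
      using assms(2) by (intro tendsto_neg_powr filterlim_ident) auto
    from tendsto_minus[OF tendsto_mult[OF tendsto_const[of c] this]] show "((\<lambda>s. - (c * s powr (2 - d))) \<longlongrightarrow> 0) at_top" by simp
  qed (use assms in auto)
  then show ?thesis by simp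
qed

text \<open>In the layer-cake integral the density (d - 2) s^(1-d) exactly cancels the growth
  \<beta> s^(d-1) up to radius \<open>R\<close>, which gives the first term; beyond \<open>R\<close>
  the whole measure of \<open>A\<close> is used. The bound depends neither on \<open>x\<close> nor
  on \<epsilon>, and \<open>R\<close> is left open for optimisation.\<close>

lemma newton_potential_le:
  fixes A :: "'a::euclidean_space set"
  assumes A: "A \<in> sets borel" "bounded A" and d: "d = real DIM('a)" "d > 2" and "\<epsilon> > 0" "R > 0"
    and \<beta>: "\<beta> \<ge> 0" "\<And>s. s > 0 \<Longrightarrow> measure lborel (A \<inter> ball x s) \<le> \<beta> * s ^ (DIM('a) - 1)"
  shows "(\<integral>\<^sup>+y. ennreal (rker \<epsilon> ((2 - d) / 2) (x - y)) * indicator A y \<partial>lborel) \<le>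
    ennreal ((d - 2) * \<beta> * R + measure lborel A * R powr (2 - d))"
proof -
  let ?q = "\<lambda>s. ennreal ((d - 2) * s powr (1 - d))"
  let ?m = "measure lborel A"
  have em: "emeasure lborel (A \<inter> B) = ennreal (measure lborel (A \<inter> B))" for B
    using emeasure_bounded_finite[OF bounded_subset[OF A(2)], of "A \<inter> B"]
    by (intro emeasure_eq_ennreal_measure) (simp add: less_top[symmetric])
  have "(\<integral>\<^sup>+y. ennreal (rker \<epsilon> ((2 - d) / 2) (x - y)) * indicator A y \<partial>lborel) \<le>
     (\<integral>\<^sup>+y. (\<integral>\<^sup>+s. ?q s * indicator {norm (y - x)<..} s \<partial>lborel) * indicator A y \<partial>lborel)"
  proof (intro nn_integral_mono mult_right_mono)
    show "ennreal (rker \<epsilon> ((2 - d) / 2) (x - y)) \<le> (\<integral>\<^sup>+s. ?q s * indicator {norm (y - x)<..} s \<partial>lborel)" for y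
      using newton_kernel_le_tail[OF \<open>\<epsilon> > 0\<close> d(2), of "x - y"] by (simp add: norm_minus_commute)
  qed simp
  also have "\<dots> = (\<integral>\<^sup>+s. ?q s * emeasure lborel (A \<inter> ball x s) \<partial>lborel)"
    using A(1) by (intro nn_integral_layer_cake) auto
  also have "\<dots> \<le> (\<integral>\<^sup>+s. ennreal ((d - 2) * \<beta>) * indicator {0..R} s + ennreal (?m * ((d - 2) * s powr (1 - d))) * indicator {R..} s \<partial>lborel)"
  proof (intro nn_integral_mono)
    fix s :: real
    show "?q s * emeasure lborel (A \<inter> ball x s) \<le>
      ennreal ((d - 2) * \<beta>) * indicator {0..R} s + ennreal (?m * ((d - 2) * s powr (1 - d))) * indicator {R..} s"
    proof (cases "s \<le> 0")
      case True
      then have "A \<inter> ball x s = {}" using ball_empty by blast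
      then show ?thesis by simp
    next
      case False
      then have s: "s > 0" by simp
      have q: "?q s * emeasure lborel (A \<inter> ball x s) = ennreal ((d - 2) * s powr (1 - d) * measure lborel (A \<inter> ball x s))"
        using d(2) by (simp add: em ennreal_mult)
      show ?thesis
      proof (cases "s \<le> R")
        case True
        have "s powr (1 - d) * s ^ (DIM('a) - 1) = s powr (1 - d) * s powr (d - 1)"
          using s d by (simp add: powr_realpow[symmetric] of_nat_diff)
        also have "\<dots> = 1" using s by (simp flip: powr_add)
        finally have 1: "s powr (1 - d) * s ^ (DIM('a) - 1) = 1" .
        have "(d - 2) * s powr (1 - d) * measure lborel (A \<inter> ball x s) \<le> (d - 2) * s powr (1 - d) * (\<beta> * s ^ (DIM('a) - 1))"
          using \<beta>(2)[OF s] d(2) by (intro mult_left_mono) auto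
        also have "\<dots> = (d - 2) * \<beta> * (s powr (1 - d) * s ^ (DIM('a) - 1))" by (simp only: mult_ac)
        finally have "(d - 2) * s powr (1 - d) * measure lborel (A \<inter> ball x s) \<le> (d - 2) * \<beta>" unfolding 1 by simp
        then have "?q s * emeasure lborel (A \<inter> ball x s) \<le> ennreal ((d - 2) * \<beta>)"
          unfolding q by (rule ennreal_leI)
        also have "\<dots> \<le> ennreal ((d - 2) * \<beta>) * indicator {0..R} s + ennreal (?m * ((d - 2) * s powr (1 - d))) * indicator {R..} s"
          using True s by simp
        finally show ?thesis .
      next
        case False
        have "measure lborel (A \<inter> ball x s) \<le> ?m"
          using A by (intro measure_mono_fmeasurable fmeasurable_lborel_bounded) auto
        then have "(d - 2) * s powr (1 - d) * measure lborel (A \<inter> ball x s) \<le> (d - 2) * s powr (1 - d) * ?m"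
          using d(2) by (intro mult_left_mono) auto
        then have "?q s * emeasure lborel (A \<inter> ball x s) \<le> ennreal (?m * ((d - 2) * s powr (1 - d)))"
          unfolding q by (intro ennreal_leI) (simp add: mult_ac)
        then show ?thesis using False s by simp
      qed
    qed
  qed
  also have "\<dots> = ennreal ((d - 2) * \<beta>) * ennreal R + ennreal (?m * R powr (2 - d))"
    using \<open>R > 0\<close> d(2) by (subst nn_integral_add) (auto simp: nn_integral_cmult_indicator tail_integral_powr)
  also have "\<dots> = ennreal ((d - 2) * \<beta> * R + ?m * R powr (2 - d))"
    using \<open>R > 0\<close> d(2) \<beta>(1) by (simp add: ennreal_mult ennreal_plus)
  finally show ?thesis .
qed

text \<open>Quantifies the concentration of the negative Laplacian at 0: for fixed \<delta> the
  lower bound tends to the volume of the unit ball as \<epsilon> tends to 0. Its form is the value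
  at \<delta> of the antiderivative of the layer-cake integrand.\<close>

lemma newton_kernel_mass_ge:
  assumes d: "d = real DIM('a::euclidean_space)" and "\<epsilon> > 0" "\<delta> > 0"
  shows "ennreal (measure lborel (ball (0::'a) 1) * (\<delta> ^ (DIM('a) + 2) * (\<delta>\<^sup>2 + \<epsilon>\<^sup>2) powr (- (d + 2) / 2)))
    \<le> (\<integral>\<^sup>+z. ennreal (\<epsilon>\<^sup>2 * rker \<epsilon> (- (d + 2) / 2) (z::'a)) * indicator (ball 0 \<delta>) z \<partial>lborel)"
proof -
  let ?n = "DIM('a)"
  let ?\<omega> = "measure lborel (ball (0::'a) 1)"
  define S where "S s = s\<^sup>2 + \<epsilon>\<^sup>2" for s :: real
  have S: "S s > 0" for s unfolding S_def using \<open>\<epsilon> > 0\<close> by (simp add: add_nonneg_pos)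
  have dS: "(S has_real_derivative 2 * s) (at s)" for s
    unfolding S_def[abs_def] by (auto intro!: derivative_eq_intros)
  have dP: "((\<lambda>s. S s powr a) has_real_derivative a * S s powr (a - 1) * (2 * s)) (at s)" for s a
    using DERIV_chain2[OF has_real_derivative_powr[OF S] dS] .
  have e: "- (d + 2) / 2 - 1 = - (d + 4) / 2" by (simp add: field_simps)
  have [measurable]: "S \<in> borel_measurable borel" unfolding S_def[abs_def] by measurable
  \<comment> \<open>Minus the derivative of the radial profile
    \<open>\<epsilon>\<^sup>2 * S s powr (- (d + 2) / 2)\<close> of the kernel.\<close>
  define q where "q s = \<epsilon>\<^sup>2 * ((d + 2) * s * S s powr (- (d + 4) / 2))" for s
  have q: "q s \<ge> 0" if "s \<ge> 0" for s using that d by (simp add: q_def)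
  have [measurable]: "q \<in> borel_measurable borel" unfolding q_def[abs_def] by measurable
  let ?q = "\<lambda>s. ennreal (q s) * indicator {0..\<delta>} s"
  have "ennreal (?\<omega> * (\<delta> ^ (?n + 2) * S \<delta> powr (- (d + 2) / 2))) =
      (\<integral>\<^sup>+s. ennreal (?\<omega> * (q s * s ^ ?n)) * indicator {0..\<delta>} s \<partial>lborel)"
  proof -
    let ?H = "\<lambda>s. ?\<omega> * (s ^ (?n + 2) * S s powr (- (d + 2) / 2))"
    have "(\<integral>\<^sup>+s. ennreal (?\<omega> * (q s * s ^ ?n)) * indicator {0..\<delta>} s \<partial>lborel) = ennreal (?H \<delta> - ?H 0)"
    proof (rule nn_integral_FTC_Icc)
      fix s :: real assume "s \<in> {0..\<delta>}"
      then have "0 \<le> s" by simp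
      show "0 \<le> ?\<omega> * (q s * s ^ ?n)" using q[OF \<open>0 \<le> s\<close>] \<open>0 \<le> s\<close> by simp
      have "(?H has_real_derivative ?\<omega> * (s ^ (?n + 2) * ((- (d + 2) / 2) * S s powr (- (d + 2) / 2 - 1) * (2 * s)) +
          (real (?n + 2) * s ^ (?n + 1)) * S s powr (- (d + 2) / 2))) (at s)"
      proof (intro DERIV_cmult DERIV_mult' dP)
        show "((\<lambda>s. s ^ (?n + 2)) has_real_derivative real (?n + 2) * s ^ (?n + 1)) (at s)"
          using DERIV_pow[of "?n + 2" s] by simp
      qed
      moreover have "S s powr (- (d + 2) / 2) = S s powr (- (d + 4) / 2) * S s"
      proof -
        have "- (d + 2) / 2 = - (d + 4) / 2 + 1" by (simp add: field_simps)
        then show ?thesis using S[of s] by (simp only: powr_add powr_one)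
      qed
      ultimately have "(?H has_real_derivative ?\<omega> * (s ^ (?n + 2) * ((- (d + 2) / 2) * S s powr (- (d + 4) / 2) * (2 * s)) +
          (real (?n + 2) * s ^ (?n + 1)) * (S s powr (- (d + 4) / 2) * S s))) (at s)"
        unfolding e by simp
      also have "?\<omega> * (s ^ (?n + 2) * ((- (d + 2) / 2) * S s powr (- (d + 4) / 2) * (2 * s)) +
          (real (?n + 2) * s ^ (?n + 1)) * (S s powr (- (d + 4) / 2) * S s)) = ?\<omega> * (q s * s ^ ?n)"
      proof -
        have h: "(- (d + 2) / 2) * X * (2 * s) = - (d + 2) * X * s" for X by (simp add: field_simps)
        show ?thesis unfolding q_def h by (simp add: S_def d algebra_simps power2_eq_square)
      qed
      finally show "(?H has_real_derivative ?\<omega> * (q s * s ^ ?n)) (at s)" .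
    qed (use \<open>\<delta> > 0\<close> in auto)
    then show ?thesis by simp
  qed
  also have "\<dots> \<le> (\<integral>\<^sup>+s. ?q s * emeasure lborel (ball 0 \<delta> \<inter> ball (0::'a) s) \<partial>lborel)"
  proof (intro nn_integral_mono)
    fix s :: real
    show "ennreal (?\<omega> * (q s * s ^ ?n)) * indicator {0..\<delta>} s \<le> ?q s * emeasure lborel (ball 0 \<delta> \<inter> ball (0::'a) s)"
    proof (cases "s \<in> {0..\<delta>}")
      case True
      then have "ball 0 \<delta> \<inter> ball (0::'a) s = ball 0 s" by auto
      moreover have "emeasure lborel (ball (0::'a) s) = ennreal (measure lborel (ball (0::'a) s))"
        using emeasure_bounded_finite[OF bounded_ball] by (intro emeasure_eq_ennreal_measure) (simp add: less_top[symmetric])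
      moreover have "measure lborel (ball (0::'a) s) = s ^ ?n * ?\<omega>"
        using True by (intro content_ball_conv_unit_ball) simp
      ultimately show ?thesis using True q[of s] by (simp add: ennreal_mult[symmetric] mult_ac)
    qed simp
  qed
  also have "\<dots> = (\<integral>\<^sup>+z. (\<integral>\<^sup>+s. ?q s * indicator {norm (z - 0)<..} s \<partial>lborel) * indicator (ball (0::'a) \<delta>) z \<partial>lborel)"
    by (rule nn_integral_layer_cake[symmetric]) auto
  also have "\<dots> \<le> (\<integral>\<^sup>+z. ennreal (\<epsilon>\<^sup>2 * rker \<epsilon> (- (d + 2) / 2) (z::'a)) * indicator (ball 0 \<delta>) z \<partial>lborel)"
  proof (intro nn_integral_mono)
    fix z :: 'a
    show "(\<integral>\<^sup>+s. ?q s * indicator {norm (z - 0)<..} s \<partial>lborel) * indicator (ball 0 \<delta>) z \<le>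
       ennreal (\<epsilon>\<^sup>2 * rker \<epsilon> (- (d + 2) / 2) z) * indicator (ball 0 \<delta>) z"
    proof (cases "z \<in> ball 0 \<delta>")
      case True
      then have z: "norm z \<le> \<delta>" by simp
      let ?H = "\<lambda>s. - (\<epsilon>\<^sup>2 * S s powr (- (d + 2) / 2))"
      have "(\<integral>\<^sup>+s. ?q s * indicator {norm (z - 0)<..} s \<partial>lborel) \<le> (\<integral>\<^sup>+s. ennreal (q s) * indicator {norm z..\<delta>} s \<partial>lborel)"
        by (intro nn_integral_mono) (auto simp: indicator_def)
      also have "\<dots> = ennreal (?H \<delta> - ?H (norm z))"
      proof (rule nn_integral_FTC_Icc)
        fix s :: real assume "s \<in> {norm z..\<delta>}"
        then have "norm z \<le> s" by simp
        then show "0 \<le> q s" using q[of s] norm_ge_zero[of z] by linarith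
        have "(?H has_real_derivative - (\<epsilon>\<^sup>2 * ((- (d + 2) / 2) * S s powr (- (d + 2) / 2 - 1) * (2 * s)))) (at s)"
          by (intro DERIV_cmult DERIV_minus dP)
        moreover have "- (\<epsilon>\<^sup>2 * ((- (d + 2) / 2) * S s powr (- (d + 2) / 2 - 1) * (2 * s))) = q s"
        proof -
          have h: "(- (d + 2) / 2) * X * (2 * s) = - (d + 2) * X * s" for X by (simp add: field_simps)
          show ?thesis unfolding e q_def h by (simp add: algebra_simps)
        qed
        ultimately show "(?H has_real_derivative q s) (at s)" by simp
      qed (use z in auto)
      also have "\<dots> \<le> ennreal (\<epsilon>\<^sup>2 * rker \<epsilon> (- (d + 2) / 2) z)"
        using \<open>\<epsilon> > 0\<close> by (intro ennreal_leI) (simp add: rker_def S_def)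
      finally show ?thesis using True by simp
    qed simp
  qed
  finally show ?thesis by (simp add: S_def)
qed


text \<open>The potential U of \<open>A\<close> is at most the factor multiplying
  \<open>dirichlet \<phi>\<close>. Regularisation spreads -\<Delta>U beyond \<open>A\<close>, but
  the part within distance \<delta> of its source meets only points where \<phi> is at least 1.
  There \<phi>^2/U is bounded below, and letting \<epsilon> tend to 0 recovers the full mass. This
  is where admissibility on a neighbourhood, not only on the set, enters.\<close>

lemma dirichlet_ge_newton_potential:
  fixes A :: "'a::euclidean_space set"
  assumes A: "A \<in> sets borel" "bounded A" "measure lborel A > 0"
    and d: "d = real DIM('a)" "d > 2" and "R > 0"
    and \<beta>: "\<beta> \<ge> 0" "\<And>x s. s > 0 \<Longrightarrow> measure lborel (A \<inter> ball x s) \<le> \<beta> * s ^ (DIM('a) - 1)"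
    and adm: "cap_admissible A \<phi>"
  shows "d * (d - 2) * measure lborel (ball (0::'a) 1) * measure lborel A \<le>
    dirichlet \<phi> * ((d - 2) * \<beta> * R + measure lborel A * R powr (2 - d))"
proof -
  let ?n = "DIM('a)" and ?m = "measure lborel A" and ?\<omega> = "measure lborel (ball (0::'a) 1)"
  define M where "M = (d - 2) * \<beta> * R + ?m * R powr (2 - d)"
  have M: "M > 0" unfolding M_def using A(3) d(2) \<beta>(1) \<open>R > 0\<close> by (intro add_nonneg_pos mult_pos_pos mult_nonneg_nonneg) auto
  obtain \<delta> where \<phi>: "Ck 1 \<phi>" "compact_support_in UNIV \<phi>" and \<delta>: "\<delta> > 0"
    and \<phi>1: "\<And>x y. y \<in> A \<Longrightarrow> dist y x < \<delta> \<Longrightarrow> \<phi> x \<ge> 1"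
    using adm unfolding cap_admissible_def by auto
  define w where "w = indicat_real A"
  have finA: "emeasure lborel A < \<infinity>" by (rule emeasure_bounded_finite[OF A(2)])
  have w: "integrable lborel w" unfolding w_def using A(1) finA by (intro integrable_real_indicator) auto
  have [measurable]: "w \<in> borel_measurable borel" "A \<in> sets borel" using w A by auto
  have emA: "emeasure lborel A = ennreal ?m" using finA by (intro emeasure_eq_ennreal_measure) (simp add: less_top[symmetric])
  have main: "d * (d - 2) * (?\<omega> * (\<delta> ^ (?n + 2) * (\<delta>\<^sup>2 + \<epsilon>\<^sup>2) powr (- (d + 2) / 2))) * ?m \<le> dirichlet \<phi> * M"
    if \<epsilon>: "\<epsilon> > 0" for \<epsilon>
  proof -
    define a where "a = (2 - d) / 2"
    have a: "a \<le> 0" "a = (2 - real DIM('a)) / 2" "a - 2 = - (d + 2) / 2"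
      using d by (simp_all add: a_def field_simps)
    let ?k = "rker \<epsilon> a :: 'a \<Rightarrow> real"
    define p where "p z = d * (d - 2) * \<epsilon>\<^sup>2 * rker \<epsilon> (a - 2) z" for z :: 'a
    have p_pos: "p z > 0" for z unfolding p_def using d(2) \<epsilon> rker_pos[OF \<epsilon>] by (intro mult_pos_pos) auto
    have kc: "continuous_on UNIV (rker \<epsilon> c :: 'a \<Rightarrow> real)" for c using Ck_rker[OF \<epsilon>, of 0] by simp
    then have [measurable]: "(rker \<epsilon> c :: 'a \<Rightarrow> real) \<in> borel_measurable borel" for c by (rule borel_measurable_continuous_onI)
    have [measurable]: "p \<in> borel_measurable borel" unfolding p_def[abs_def] by measurable
    have kB: "\<bar>?k z\<bar> \<le> \<epsilon>\<^sup>2 powr a" for z using rker_le[OF \<epsilon> a(1), of z] rker_pos[OF \<epsilon>, of a z] by simp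
    obtain L where kL: "\<And>z. norm (grad ?k z) \<le> L" using grad_rker_bounded[OF \<epsilon> a(1)] by blast
    define U where "U x = (\<integral>y. ?k (x - y) * w y \<partial>lborel)" for x
    have U1: "Ck 1 U" and gradU: "grad U x \<bullet> h = (\<integral>y. (grad ?k (x - y) \<bullet> h) * w y \<partial>lborel)" for x h
      unfolding U_def[abs_def] by (rule convolution_Ck_1[OF Ck_rker[OF \<epsilon>] kB kL w])+
    have kb: "\<bar>grad ?k z \<bullet> b\<bar> \<le> L" if "b \<in> Basis" for z b
      using abs_inner_le[OF kL, of z b] that by simp
    have kbL: "\<exists>B. \<forall>z. norm (grad (\<lambda>z. grad ?k z \<bullet> b) z) \<le> B" if "b \<in> Basis" for b
      by (rule grad_grad_rker_bounded[OF \<epsilon> a(1) that])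
    have U2: "Ck 1 (\<lambda>x. grad U x \<bullet> b)"
      and lapU: "grad (\<lambda>x. grad U x \<bullet> b) x \<bullet> b = (\<integral>y. (grad (\<lambda>z. grad ?k z \<bullet> b) (x - y) \<bullet> b) * w y \<partial>lborel)"
      and lap_int: "integrable lborel (\<lambda>y. (grad (\<lambda>z. grad ?k z \<bullet> b) (x - y) \<bullet> b) * w y)"
      if b: "b \<in> Basis" for b x
    proof -
      obtain B where B: "\<And>z. norm (grad (\<lambda>z. grad ?k z \<bullet> b) z) \<le> B" using kbL[OF b] by blast
      note c = convolution_Ck_1[OF Ck_grad_rker[OF \<epsilon>] kb[OF b] B w]
      show "Ck 1 (\<lambda>x. grad U x \<bullet> b)"
        "grad (\<lambda>x. grad U x \<bullet> b) x \<bullet> b = (\<integral>y. (grad (\<lambda>z. grad ?k z \<bullet> b) (x - y) \<bullet> b) * w y \<partial>lborel)"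
        unfolding gradU by (rule c)+
      show "integrable lborel (\<lambda>y. (grad (\<lambda>z. grad ?k z \<bullet> b) (x - y) \<bullet> b) * w y)"
        by (rule convolution_integrable[OF _ abs_inner_le[OF B] w])
           (intro continuous_intros Ck_1_continuous_grad Ck_grad_rker[OF \<epsilon>])
    qed
    define F where "F x = (\<integral>y. p (x - y) * w y \<partial>lborel)" for x
    have F: "F x = - (\<Sum>b\<in>Basis. grad (\<lambda>x. grad U x \<bullet> b) x \<bullet> b)" for x
    proof -
      have "(\<Sum>b\<in>Basis. grad (\<lambda>x. grad U x \<bullet> b) x \<bullet> b) =
          (\<integral>y. (\<Sum>b\<in>Basis. (grad (\<lambda>z. grad ?k z \<bullet> b) (x - y) \<bullet> b) * w y) \<partial>lborel)"
        using lap_int by (subst Bochner_Integration.integral_sum) (auto simp: lapU)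
      also have "\<dots> = (\<integral>y. - (p (x - y) * w y) \<partial>lborel)"
        unfolding sum_distrib_right[symmetric] laplacian_rker[OF \<epsilon> a(2)] by (simp add: p_def d(1))
      finally show ?thesis by (simp add: F_def)
    qed
    have Uint: "integrable lborel (\<lambda>y. ?k (x - y) * w y)" for x
      by (rule convolution_integrable[OF kc kB w])
    have kw: "?k (x - y) * w y \<ge> 0" for x y using rker_pos[OF \<epsilon>, of a "x - y"] by (simp add: w_def)
    have U_pos: "U x > 0" for x
    proof -
      have "U x \<noteq> 0"
      proof
        assume "U x = 0"
        then have "AE y in lborel. ?k (x - y) * w y = 0"
          unfolding U_def using integral_nonneg_eq_0_iff_AE[OF Uint] kw by simp
        then have "AE y in lborel. y \<notin> A"
        proof eventually_elim
          fix y assume "?k (x - y) * w y = 0"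
          then show "y \<notin> A" using rker_pos[OF \<epsilon>, of a "x - y"] by (auto simp: w_def)
        qed
        then have "emeasure lborel A = 0"
          by (subst (asm) AE_iff_measurable[OF _ refl]) (auto simp: A)
        then show False using A(3) by (simp add: measure_def)
      qed
      moreover have "U x \<ge> 0" unfolding U_def using kw by simp
      ultimately show ?thesis by simp
    qed
    have UM: "U x \<le> M" for x
    proof -
      have "ennreal (U x) = (\<integral>\<^sup>+y. ennreal (?k (x - y) * w y) \<partial>lborel)"
        unfolding U_def by (rule nn_integral_eq_integral[symmetric, OF Uint]) (use kw in auto)
      also have "\<dots> = (\<integral>\<^sup>+y. ennreal (?k (x - y)) * indicator A y \<partial>lborel)"
        by (intro nn_integral_cong) (auto simp: w_def indicator_def)
      also have "\<dots> \<le> ennreal M"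
        unfolding M_def a_def by (rule newton_potential_le[OF A(1,2) d \<epsilon> \<open>R > 0\<close> \<beta>])
      finally show ?thesis using M by (simp add: ennreal_le_iff2)
    qed
    have pint: "integrable lborel (\<lambda>y. p (x - y) * w y)" for x
    proof (rule convolution_integrable[OF _ _ w])
      show "continuous_on UNIV p" unfolding p_def[abs_def] by (intro continuous_intros kc)
      show "\<bar>p z\<bar> \<le> d * (d - 2) * \<epsilon>\<^sup>2 * \<epsilon>\<^sup>2 powr (a - 2)" for z
        using p_pos[of z] rker_le[OF \<epsilon>, of "a - 2" z] a(1) d(2) unfolding p_def
        by (simp add: mult_left_mono)
    qed
    have eF: "ennreal (F x) = (\<integral>\<^sup>+y. ennreal (p (x - y)) * indicator A y \<partial>lborel)" for x
    proof -
      have "ennreal (F x) = (\<integral>\<^sup>+y. ennreal (p (x - y) * w y) \<partial>lborel)"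
        unfolding F_def by (rule nn_integral_eq_integral[symmetric, OF pint]) (use p_pos in \<open>auto simp: w_def less_imp_le\<close>)
      then show ?thesis
        by (auto simp: w_def indicator_def intro!: nn_integral_cong)
    qed
    have F_nonneg: "F x \<ge> 0" for x unfolding F_def using p_pos by (simp add: w_def less_imp_le)
    note H = dirichlet_ge_superharmonic[OF \<phi> U1 U2 U_pos F]
    define c where "c = (\<integral>\<^sup>+z. ennreal (p z) * indicator (ball 0 \<delta>) z \<partial>lborel)"
    \<comment> \<open>The part of the density of -\<Delta>U at \<open>x\<close> whose source
      \<open>y\<close> in \<open>A\<close> lies within \<delta>; it vanishes unless \<phi> is at
      least 1 at \<open>x\<close>.\<close>
    define f where "f x y = ennreal (p (x - y)) * indicator (ball 0 \<delta>) (x - y) * indicator A y" for x y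
    have [measurable]: "ball (0::'a) \<delta> \<in> sets borel" by simp
    have f_meas: "(\<lambda>(x, y). f x y) \<in> borel_measurable (borel \<Otimes>\<^sub>M borel)"
      unfolding f_def by measurable
    have "ennreal (1 / M) * (c * ennreal ?m) = ennreal (1 / M) * (\<integral>\<^sup>+y. c * indicator A y \<partial>lborel)"
      using emA A(1) by (simp add: nn_integral_cmult_indicator)
    also have "(\<integral>\<^sup>+y. c * indicator A y \<partial>lborel) = (\<integral>\<^sup>+y. \<integral>\<^sup>+x. f x y \<partial>lborel \<partial>lborel)"
    proof (intro nn_integral_cong)
      fix y
      have "(\<integral>\<^sup>+x. f x y \<partial>lborel) = (\<integral>\<^sup>+x. ennreal (p (x - y)) * indicator (ball 0 \<delta>) (x - y) \<partial>lborel) * indicator A y"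
        unfolding f_def by (rule nn_integral_multc) measurable
      also have "(\<integral>\<^sup>+x. ennreal (p (x - y)) * indicator (ball 0 \<delta>) (x - y) \<partial>lborel) = c"
        unfolding c_def by (rule nn_integral_lborel_reflect_translate) measurable
      finally show "c * indicator A y = (\<integral>\<^sup>+x. f x y \<partial>lborel)" by simp
    qed
    also have "\<dots> = (\<integral>\<^sup>+x. \<integral>\<^sup>+y. f x y \<partial>lborel \<partial>lborel)" by (rule Tonelli_lborel[OF f_meas])
    also have "ennreal (1 / M) * \<dots> = (\<integral>\<^sup>+x. ennreal (1 / M) * (\<integral>\<^sup>+y. f x y \<partial>lborel) \<partial>lborel)"
      by (rule nn_integral_cmult[symmetric]) (use f_meas in \<open>auto intro!: lborel.borel_measurable_nn_integral\<close>)
    also have "\<dots> \<le> (\<integral>\<^sup>+x. ennreal ((\<phi> x)\<^sup>2 / U x * F x) \<partial>lborel)"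
    proof (intro nn_integral_mono)
      fix x
      show "ennreal (1 / M) * (\<integral>\<^sup>+y. f x y \<partial>lborel) \<le> ennreal ((\<phi> x)\<^sup>2 / U x * F x)"
      proof (cases "\<phi> x \<ge> 1")
        case True
        have "(\<integral>\<^sup>+y. f x y \<partial>lborel) \<le> ennreal (F x)"
          unfolding eF f_def by (intro nn_integral_mono) (auto simp: indicator_def)
        then have "ennreal (1 / M) * (\<integral>\<^sup>+y. f x y \<partial>lborel) \<le> ennreal (1 / M) * ennreal (F x)"
          by (intro mult_left_mono) auto
        also have "\<dots> = ennreal (1 / M * F x)" using M F_nonneg by (intro ennreal_mult[symmetric]) auto
        also have "\<dots> \<le> ennreal ((\<phi> x)\<^sup>2 / U x * F x)"
        proof (intro ennreal_leI mult_right_mono F_nonneg)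
          have "1 / M \<le> 1 / U x" using UM[of x] U_pos[of x] by (simp add: frac_le)
          also have "\<dots> \<le> (\<phi> x)\<^sup>2 / U x" using True U_pos[of x] by (intro divide_right_mono) (auto simp: one_le_power)
          finally show "1 / M \<le> (\<phi> x)\<^sup>2 / U x" .
        qed
        finally show ?thesis .
      next
        case False
        have "f x y = 0" for y
          using \<phi>1[of y x] False by (auto simp: f_def indicator_def dist_norm norm_minus_commute)
        then show ?thesis by simp
      qed
    qed
    also have "\<dots> = ennreal (\<integral>x. (\<phi> x)\<^sup>2 / U x * F x \<partial>lborel)"
      by (rule nn_integral_eq_integral[OF H(1)]) (use U_pos F_nonneg in \<open>auto simp: less_imp_le\<close>)
    also have "\<dots> \<le> ennreal (dirichlet \<phi>)" using H(2) by (rule ennreal_leI)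
    finally have 1: "ennreal (1 / M) * (c * ennreal ?m) \<le> ennreal (dirichlet \<phi>)" .
    define \<theta> where "\<theta> = ?\<omega> * (\<delta> ^ (?n + 2) * (\<delta>\<^sup>2 + \<epsilon>\<^sup>2) powr (- (d + 2) / 2))"
    have \<theta>: "\<theta> \<ge> 0" unfolding \<theta>_def using \<delta> by simp
    have dd: "d * (d - 2) \<ge> 0" using d(2) by simp
    have "ennreal (d * (d - 2)) * ennreal \<theta> \<le> ennreal (d * (d - 2)) *
       (\<integral>\<^sup>+z. ennreal (\<epsilon>\<^sup>2 * rker \<epsilon> (- (d + 2) / 2) (z::'a)) * indicator (ball 0 \<delta>) z \<partial>lborel)"
      unfolding \<theta>_def by (intro mult_left_mono newton_kernel_mass_ge[OF d(1) \<epsilon> \<delta>]) simp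
    also have "\<dots> = c"
      unfolding c_def
    proof (subst nn_integral_cmult[symmetric])
      show "(\<lambda>z::'a. ennreal (\<epsilon>\<^sup>2 * rker \<epsilon> (- (d + 2) / 2) z) * indicator (ball 0 \<delta>) z) \<in> borel_measurable lborel"
        by measurable
      show "(\<integral>\<^sup>+z. ennreal (d * (d - 2)) * (ennreal (\<epsilon>\<^sup>2 * rker \<epsilon> (- (d + 2) / 2) (z::'a)) * indicator (ball 0 \<delta>) z) \<partial>lborel)
        = (\<integral>\<^sup>+z. ennreal (p z) * indicator (ball 0 \<delta>) z \<partial>lborel)"
        using dd unfolding p_def a(3)[symmetric]
        by (intro nn_integral_cong) (simp add: ennreal_mult'[symmetric] mult.assoc flip: mult.assoc[of "ennreal _" "ennreal _"])
    qed
    finally have "ennreal (d * (d - 2) * \<theta>) \<le> c" using dd by (simp add: ennreal_mult')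
    then have "ennreal (1 / M) * (ennreal (d * (d - 2) * \<theta>) * ennreal ?m) \<le> ennreal (1 / M) * (c * ennreal ?m)"
      by (intro mult_left_mono mult_right_mono) auto
    with 1 have "ennreal (1 / M) * (ennreal (d * (d - 2) * \<theta>) * ennreal ?m) \<le> ennreal (dirichlet \<phi>)" by (rule order_trans[rotated])
    then have "ennreal (1 / M * (d * (d - 2) * \<theta> * ?m)) \<le> ennreal (dirichlet \<phi>)"
      using M dd \<theta> by (simp only: ennreal_mult[symmetric] mult_nonneg_nonneg measure_nonneg zero_le_divide_1_iff less_imp_le)
    then have "1 / M * (d * (d - 2) * \<theta> * ?m) \<le> dirichlet \<phi>" by (simp only: ennreal_le_iff[OF dirichlet_nonneg])
    then show ?thesis using M by (simp add: \<theta>_def field_simps)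
  qed
  \<comment> \<open>The neighbourhood width \<delta> belongs to \<phi> and stays fixed, so the mass
    factor tends to 1 with \<epsilon>.\<close>
  have "((\<lambda>\<epsilon>. d * (d - 2) * (?\<omega> * (\<delta> ^ (?n + 2) * (\<delta>\<^sup>2 + \<epsilon>\<^sup>2) powr (- (d + 2) / 2))) * ?m) \<longlongrightarrow>
     d * (d - 2) * (?\<omega> * (\<delta> ^ (?n + 2) * (\<delta>\<^sup>2 + 0\<^sup>2) powr (- (d + 2) / 2))) * ?m) (at_right 0)"
    using \<delta> by (intro tendsto_intros) auto
  then have "d * (d - 2) * (?\<omega> * (\<delta> ^ (?n + 2) * (\<delta>\<^sup>2 + 0\<^sup>2) powr (- (d + 2) / 2))) * ?m \<le> dirichlet \<phi> * M"
  proof (rule tendsto_upperbound)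
    show "\<forall>\<^sub>F \<epsilon> in at_right 0. d * (d - 2) * (?\<omega> * (\<delta> ^ (?n + 2) * (\<delta>\<^sup>2 + \<epsilon>\<^sup>2) powr (- (d + 2) / 2))) * ?m \<le> dirichlet \<phi> * M"
      unfolding eventually_at_right_field using main by (intro exI[of _ 1]) auto
  qed auto
  also have "\<delta> ^ (?n + 2) * (\<delta>\<^sup>2 + 0\<^sup>2) powr (- (d + 2) / 2) = 1"
  proof -
    have "(\<delta>\<^sup>2 + 0\<^sup>2) powr (- (d + 2) / 2) = \<delta> powr (- (d + 2))"
    proof -
      have "(\<delta>\<^sup>2 + 0\<^sup>2) powr (- (d + 2) / 2) = (\<delta> powr 2) powr (- (d + 2) / 2)" using \<delta> by simp
      also have "\<dots> = \<delta> powr (2 * (- (d + 2) / 2))" by (rule powr_powr)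
      also have "2 * (- (d + 2) / 2) = - (d + 2)" by (simp add: field_simps)
      finally show ?thesis .
    qed
    moreover have "\<delta> ^ (?n + 2) = \<delta> powr (d + 2)"
      using \<delta> powr_realpow[of \<delta> "?n + 2"] d(1) by (simp add: add.commute)
    ultimately show ?thesis using \<delta> by (simp flip: powr_add)
  qed
  finally show ?thesis by (simp add: M_def)
qed

section \<open>Width and inradius\<close>

lemma open_convex_interior_closure:
  fixes \<Omega> :: "'a::euclidean_space set"
  assumes "convex \<Omega>" "open \<Omega>"
  shows "interior (closure \<Omega>) = \<Omega>"
  using convex_interior_closure[OF assms(1)] interior_open[OF assms(2)] by simp

text \<open>For each unit vector \<open>e\<close> let \<open>K e\<close> be the part of \<open>closure \<Omega>\<close> at distance at least
  \<open>W / (DIM + 1)\<close> from the supporting hyperplane with normal \<open>e\<close>. The centroid of the points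
  extremal in the directions \<open>- e\<^sub>i\<close> lies in all of \<open>K e\<^sub>0, \<dots>, K e\<^sub>d\<close>, so by Helly's theorem the
  sets \<open>K e\<close> have a common point.\<close>

lemma convex_ball_of_width:
  fixes \<Omega> :: "'a::euclidean_space set"
  assumes \<Omega>: "convex \<Omega>" "open \<Omega>" "bounded \<Omega>" "\<Omega> \<noteq> {}" and "W > 0"
    and width: "\<And>e. norm e = 1 \<Longrightarrow> \<exists>x\<in>closure \<Omega>. \<exists>y\<in>closure \<Omega>. e \<bullet> x - e \<bullet> y \<ge> W"
  obtains x where "x \<in> \<Omega>" "ball x (W / (real DIM('a) + 1)) \<subseteq> \<Omega>"
proof -
  let ?n = "DIM('a) + 1"
  define C where "C = closure \<Omega>"
  have C: "compact C" "convex C" "C \<noteq> {}"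
    using \<Omega> by (auto simp: C_def compact_closure convex_closure)
  define r where "r = W / real ?n"
  have r: "r > 0" using \<open>W > 0\<close> by (simp add: r_def)
  have "\<exists>p\<in>C. \<forall>y\<in>C. e \<bullet> p \<le> e \<bullet> y" for e
    using continuous_attains_inf[OF C(1,3), of "\<lambda>y. e \<bullet> y", OF continuous_on_inner[OF continuous_on_const continuous_on_id]]
    by blast
  then obtain lo where lo: "\<And>e. lo e \<in> C" "\<And>e y. y \<in> C \<Longrightarrow> e \<bullet> lo e \<le> e \<bullet> y" by metis
  have "\<exists>p\<in>C. \<forall>y\<in>C. e \<bullet> y \<le> e \<bullet> p" for e
    using continuous_attains_sup[OF C(1,3), of "\<lambda>y. e \<bullet> y", OF continuous_on_inner[OF continuous_on_const continuous_on_id]]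
    by blast
  then obtain hi where hi: "\<And>e. hi e \<in> C" "\<And>e y. y \<in> C \<Longrightarrow> e \<bullet> y \<le> e \<bullet> hi e" by metis
  have W: "e \<bullet> hi e - e \<bullet> lo e \<ge> W" if e: "norm e = 1" for e
  proof -
    obtain x y where "x \<in> C" "y \<in> C" "e \<bullet> x - e \<bullet> y \<ge> W" using width[OF e] by (auto simp: C_def)
    then show ?thesis using lo(2)[of y e] hi(2)[of x e] by linarith
  qed
  define K where "K e = C \<inter> {x. e \<bullet> x \<le> e \<bullet> hi e - r}" for e
  have K: "compact (K e)" "convex (K e)" for e
    unfolding K_def using C by (auto intro!: compact_Int_closed closed_halfspace_le convex_Int convex_halfspace_le)
  have inter: "\<Inter>(K ` E) \<noteq> {}" if E: "finite E" "card E \<le> ?n" "\<And>e. e \<in> E \<Longrightarrow> norm e = 1" for E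
  proof (cases "E = {}")
    case False
    define x where "x = (\<Sum>e\<in>E. (1 / real (card E)) *\<^sub>R lo e)"
    have cE: "card E > 0" using E(1) False by (simp add: card_gt_0_iff)
    have xC: "x \<in> C"
      unfolding x_def by (rule convex_sum[OF E(1) C(2)]) (use cE lo in auto)
    have "x \<in> K i" if i: "i \<in> E" for i
    proof -
      have "i \<bullet> x = (\<Sum>e\<in>E. (1 / real (card E)) * (i \<bullet> lo e))" by (simp add: x_def inner_sum_right)
      also have "\<dots> = (1 / real (card E)) * (i \<bullet> lo i) + (\<Sum>e\<in>E - {i}. (1 / real (card E)) * (i \<bullet> lo e))"
        using E(1) i by (rule sum.remove)
      \<comment> \<open>The extremal point of direction \<open>i\<close> itself lies at least
        \<open>W\<close> below the maximum, the others lie at most at the maximum; averaging gains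
        \<open>W / card E\<close>.\<close>
      also have "\<dots> \<le> (1 / real (card E)) * (i \<bullet> hi i - W) + (\<Sum>e\<in>E - {i}. (1 / real (card E)) * (i \<bullet> hi i))"
        using W[OF E(3)[OF i]] hi(2)[OF lo(1)] by (intro add_mono mult_left_mono sum_mono) auto
      also have "\<dots> = (\<Sum>e\<in>E. (1 / real (card E)) * (i \<bullet> hi i)) - W / real (card E)"
        using E(1) i by (subst sum.remove[of E i]) (auto simp: algebra_simps)
      also have "\<dots> = i \<bullet> hi i - W / real (card E)" using cE by simp
      finally have 1: "i \<bullet> x \<le> i \<bullet> hi i - W / real (card E)" .
      have "W / real (card E) \<ge> r"
        unfolding r_def using cE E(2) \<open>W > 0\<close> by (intro divide_left_mono) auto
      with 1 show ?thesis using xC by (simp add: K_def)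
    qed
    then show ?thesis by blast
  qed simp
  \<comment> \<open>Distinct directions may give the same set, so injective representatives are
    chosen. Helly's theorem asks for at least \<open>DIM('a) + 1\<close> sets; smaller families are
    settled by the centroid directly.\<close>
  have fin_inter: "\<Inter>(K ` E) \<noteq> {}" if E: "finite E" "\<And>e. e \<in> E \<Longrightarrow> norm e = 1" for E
  proof (cases "card (K ` E) \<ge> ?n")
    case True
    show ?thesis
    proof (rule Helly)
      fix T assume T: "T \<subseteq> K ` E" "card T = DIM('a) + 1"
      then obtain E' where E': "E' \<subseteq> E" "T = K ` E'" "inj_on K E'" by (meson subset_image_inj)
      then have "card E' = ?n" using T(2) card_image by metis
      then show "\<Inter>T \<noteq> {}" unfolding E'(2) using E' E finite_subset by (intro inter) auto
    qed (use True K in auto)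
  next
    case False
    obtain E' where E': "E' \<subseteq> E" "K ` E = K ` E'" "inj_on K E'" by (meson subset_image_inj order_refl)
    then have "card E' \<le> ?n" using False card_image[OF E'(3)] by simp
    then show ?thesis unfolding E'(2) using E' E finite_subset by (intro inter) auto
  qed
  have "C \<inter> \<Inter>(K ` sphere 0 1) \<noteq> {}"
  proof (rule compact_imp_fip[OF C(1)])
    show "closed T" if "T \<in> K ` sphere 0 1" for T using that K(1) compact_imp_closed by auto
    fix F assume F: "finite F" "F \<subseteq> K ` sphere 0 1"
    then obtain E where E: "finite E" "E \<subseteq> sphere 0 1" "F = K ` E" by (meson finite_subset_image)
    \<comment> \<open>An additional direction forces the common point into \<open>C\<close> even
      when \<open>E\<close> is empty.\<close>
    obtain e :: 'a where e: "norm e = 1" using vector_choose_size[of 1] by auto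
    have "\<Inter>(K ` (insert e E)) \<noteq> {}" using E e by (intro fin_inter) auto
    then obtain x where x: "x \<in> K e" "\<And>i. i \<in> E \<Longrightarrow> x \<in> K i" by auto
    then have "x \<in> C \<inter> \<Inter>F" unfolding E(3) by (auto simp: K_def)
    then show "C \<inter> \<Inter>F \<noteq> {}" by blast
  qed
  then obtain x where "x \<in> C" "x \<in> \<Inter>(K ` sphere 0 1)" by blast
  then have x: "x \<in> C" "\<And>e. norm e = 1 \<Longrightarrow> x \<in> K e" by auto
  \<comment> \<open>A point of the ball outside \<open>C\<close> is separated from \<open>C\<close>
    by a hyperplane; with its outer unit normal \<open>e\<close> this contradicts that
    \<open>x\<close> lies at least \<open>r\<close> below the maximum of \<open>e\<close> on
    \<open>C\<close>.\<close>
  have ball: "ball x r \<subseteq> C"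
  proof (rule ccontr)
    assume "\<not> ball x r \<subseteq> C"
    then obtain z where z: "z \<in> ball x r" "z \<notin> C" by blast
    obtain a b where ab: "a \<bullet> z < b" "\<And>y. y \<in> C \<Longrightarrow> a \<bullet> y > b"
      using separating_hyperplane_closed_point[OF C(2) compact_imp_closed[OF C(1)] z(2)] by blast
    have "a \<noteq> 0" using ab(1) ab(2)[OF x(1)] by auto
    define e where "e = - (1 / norm a) *\<^sub>R a"
    have e: "norm e = 1" using \<open>a \<noteq> 0\<close> by (simp add: e_def)
    have "e \<bullet> hi e < e \<bullet> z"
    proof -
      have "a \<bullet> z < a \<bullet> hi e" using ab(1) ab(2)[OF hi(1)[of e]] by linarith
      then show ?thesis using \<open>a \<noteq> 0\<close> by (simp add: e_def divide_strict_right_mono)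
    qed
    moreover have "e \<bullet> z - e \<bullet> x \<le> norm (z - x)"
      using norm_cauchy_schwarz[of e "z - x"] e by (simp add: inner_diff_right)
    moreover have "norm (z - x) < r" using z(1) by (simp add: dist_norm norm_minus_commute)
    moreover have "e \<bullet> x \<le> e \<bullet> hi e - r" using x(2)[OF e] by (simp add: K_def)
    ultimately show False by linarith
  qed
  have "ball x r \<subseteq> \<Omega>"
    using interior_mono[OF ball] open_convex_interior_closure[OF \<Omega>(1,2)] by (simp add: C_def)
  moreover have "x \<in> \<Omega>" using calculation r by (meson centre_in_ball subsetD)
  ultimately show thesis using that by (simp add: r_def add.commute)
qed

lemma
  fixes A :: "'a::euclidean_space set"
  assumes "open A" "bounded A" "A \<noteq> {}"
  shows inradius_pos: "inradius A > 0"
    and inradius_upper: "\<And>x r. ball x r \<subseteq> A \<Longrightarrow> r > 0 \<Longrightarrow> r \<le> inradius A"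
    and inradius_approx: "\<And>r. r < inradius A \<Longrightarrow> \<exists>x s. s > 0 \<and> s > r \<and> x \<in> A \<and> ball x s \<subseteq> A"
proof -
  let ?S = "{r. 0 \<le> r \<and> (\<exists>x\<in>A. ball x r \<subseteq> A)}"
  obtain B where B: "\<And>x. x \<in> A \<Longrightarrow> norm x \<le> B" using assms(2) unfolding bounded_iff by auto
  obtain b :: 'a where b: "norm b = 1" using vector_choose_size[of 1] by auto
  have bdd: "bdd_above ?S"
  proof (rule bdd_aboveI)
    fix r assume "r \<in> ?S"
    then obtain x where x: "0 \<le> r" "x \<in> A" "ball x r \<subseteq> A" by auto
    have "r / 2 \<le> 2 * B + 1"
    proof (cases "r = 0")
      case True
      then show ?thesis using B[OF x(2)] norm_ge_zero[of x] by linarith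
    next
      case False
      then have "x + (r / 2) *\<^sub>R b \<in> A" using x b by (intro subsetD[OF x(3)]) (auto simp: dist_norm)
      from B[OF this] B[OF x(2)] show ?thesis
        using norm_triangle_ineq4[of "x + (r / 2) *\<^sub>R b" x] b x(1) by simp
    qed
    then show "r \<le> 4 * B + 2" by simp
  qed
  show upper: "r \<le> inradius A" if "ball x r \<subseteq> A" "r > 0" for x r
    unfolding inradius_def
  proof (rule cSup_upper[OF _ bdd])
    have "x \<in> A" using that by (meson centre_in_ball subsetD)
    then show "r \<in> ?S" using that by auto
  qed
  obtain x s where xs: "x \<in> A" "s > 0" "ball x s \<subseteq> A" using assms(1,3) open_contains_ball by blast
  show pos: "inradius A > 0" using upper[OF xs(3,2)] xs(2) by simp
  show "\<exists>x s. s > 0 \<and> s > r \<and> x \<in> A \<and> ball x s \<subseteq> A" if "r < inradius A" for r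
  proof -
    \<comment> \<open>The maximum with 0 makes the radius found positive even for negative
      \<open>r\<close>.\<close>
    have lt: "max r 0 < Sup ?S" using that pos by (simp add: inradius_def)
    have ne: "?S \<noteq> {}" using xs less_imp_le[OF xs(2)] by blast
    obtain t where t: "t \<in> ?S" "max r 0 < t" using less_cSupD[OF ne lt] by (elim bexE)
    then obtain y where "y \<in> A" "ball y t \<subseteq> A" by blast
    then show ?thesis using t(2) by (intro exI[of _ y] exI[of _ t]) simp
  qed
qed

text \<open>If every direction had width at least \<open>W\<close>, some ball of radius W/(d + 1),
  larger than the inradius, would fit inside.\<close>

lemma convex_in_slab:
  fixes \<Omega> :: "'a::euclidean_space set"
  assumes "convex_domain \<Omega>" and W: "W > (real DIM('a) + 1) * inradius \<Omega>"
  obtains e a where "norm e = 1" "\<And>x. x \<in> \<Omega> \<Longrightarrow> a < x \<bullet> e \<and> x \<bullet> e < a + W"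
proof -
  have \<Omega>: "convex \<Omega>" "open \<Omega>" "bounded \<Omega>" "\<Omega> \<noteq> {}" using assms(1) by (auto simp: convex_domain_def)
  have W0: "W > 0" using W inradius_pos[OF \<Omega>(2-4)] by (smt (verit) mult_nonneg_nonneg of_nat_0_le_iff)
  have "\<exists>e. norm e = 1 \<and> (\<forall>x\<in>closure \<Omega>. \<forall>y\<in>closure \<Omega>. e \<bullet> x - e \<bullet> y < W)"
  proof (rule ccontr)
    assume "\<not> ?thesis"
    then have "\<And>e. norm e = 1 \<Longrightarrow> \<exists>x\<in>closure \<Omega>. \<exists>y\<in>closure \<Omega>. e \<bullet> x - e \<bullet> y \<ge> W" by (auto simp: not_less)
    from convex_ball_of_width[OF \<Omega> W0 this]
    obtain x where "ball x (W / (real DIM('a) + 1)) \<subseteq> \<Omega>" by blast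
    then have "W / (real DIM('a) + 1) \<le> inradius \<Omega>" using W0 by (intro inradius_upper[OF \<Omega>(2-4)]) auto
    then show False using W by (simp add: field_simps)
  qed
  then obtain e where e: "norm e = 1" "\<And>x y. x \<in> closure \<Omega> \<Longrightarrow> y \<in> closure \<Omega> \<Longrightarrow> e \<bullet> x - e \<bullet> y < W" by blast
  have C: "compact (closure \<Omega>)" "closure \<Omega> \<noteq> {}" using \<Omega> by (auto simp: compact_closure)
  obtain p where p: "p \<in> closure \<Omega>" "\<And>y. y \<in> closure \<Omega> \<Longrightarrow> e \<bullet> p \<le> e \<bullet> y"
    using continuous_attains_inf[OF C, of "\<lambda>y. e \<bullet> y", OF continuous_on_inner[OF continuous_on_const continuous_on_id]]
    by blast
  obtain q where q: "q \<in> closure \<Omega>" "\<And>y. y \<in> closure \<Omega> \<Longrightarrow> e \<bullet> y \<le> e \<bullet> q"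
    using continuous_attains_sup[OF C, of "\<lambda>y. e \<bullet> y", OF continuous_on_inner[OF continuous_on_const continuous_on_id]]
    by blast
  show thesis
  proof (rule that[OF e(1)])
    \<comment> \<open>The slab is centred on the range of \<open>e\<close>; as the width is strictly
      below \<open>W\<close>, both inequalities become strict.\<close>
    let ?a = "(e \<bullet> p + e \<bullet> q - W) / 2"
    fix x assume "x \<in> \<Omega>"
    then have "x \<in> closure \<Omega>" using closure_subset by blast
    from p(2)[OF this] q(2)[OF this] e(2)[OF q(1) p(1)]
    show "?a < x \<bullet> e \<and> x \<bullet> e < ?a + W" by (auto simp: inner_commute field_simps)
  qed
qed

section \<open>The functional \<open>G\<close> on convex domains\<close>

lemma convex_domainD:
  assumes "convex_domain \<Omega>"
  shows "\<Omega> \<noteq> {}" "open \<Omega>" "bounded \<Omega>" "convex \<Omega>"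
  using assms by (auto simp: convex_domain_def)

lemma measure_open_pos:
  assumes "open A" "bounded A" "A \<noteq> {}"
  shows "measure lborel A > 0"
proof -
  obtain x r where "r > 0" "ball x r \<subseteq> A" using assms(1,3) open_contains_ball by blast
  moreover have "measure lborel (ball x r) > 0" using \<open>r > 0\<close> by simp
  moreover have "measure lborel (ball x r) \<le> measure lborel A"
    using assms calculation(2) by (intro measure_mono_fmeasurable fmeasurable_lborel_bounded) auto
  ultimately show ?thesis by linarith
qed

lemma newtonian_capacity_slab_ge:
  fixes A :: "'a::euclidean_space set"
  assumes A: "A \<in> sets borel" "bounded A" "measure lborel A > 0" and d: "d = real DIM('a)" "d > 2"
    and slab: "\<And>x. x \<in> A \<Longrightarrow> a < x \<bullet> e \<and> x \<bullet> e < a + w" and w: "w > 0" "norm e = 1"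
  shows "newtonian_capacity (closure A) \<ge> d * (d - 2) / (d - 1) * measure lborel (ball (0::'a) 1) *
    (measure lborel A / (w * 2 ^ (DIM('a) - 1) * measure lborel (ball (0::'a) 1))) powr ((d - 2) / (d - 1))"
proof -
  let ?n = "DIM('a)" and ?m = "measure lborel A" and ?\<omega> = "measure lborel (ball (0::'a) 1)"
  have \<omega>: "?\<omega> > 0" by simp
  define \<beta> where "\<beta> = w * 2 ^ (?n - 1) * ?\<omega>"
  have \<beta>: "\<beta> > 0" unfolding \<beta>_def using w \<omega> by (intro mult_pos_pos) auto
  \<comment> \<open>The minimiser of (d - 2) \<beta> R + |A| R^(2-d), where |A| = \<beta> R^(d-1);
    both terms are then multiples of \<beta> R. The root of order d - 1 produces the exponent (d -
    2)/(d - 1).\<close>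
  define R where "R = (?m / \<beta>) powr (1 / (d - 1))"
  have R: "R > 0" using A(3) \<beta> by (simp add: R_def)
  have R1: "R powr (d - 1) = ?m / \<beta>" using A(3) \<beta> d(2) by (simp add: R_def powr_powr)
  have R2: "R powr (d - 2) = (?m / \<beta>) powr ((d - 2) / (d - 1))" by (simp add: R_def powr_powr)
  have mR: "?m = \<beta> * R powr (d - 1)" using R1 \<beta> by simp
  have MR: "(d - 2) * \<beta> * R + ?m * R powr (2 - d) = (d - 1) * \<beta> * R"
  proof -
    have "R powr (d - 1) * R powr (2 - d) = R" using R by (simp flip: powr_add)
    then have "?m * R powr (2 - d) = \<beta> * R" by (simp add: mR mult.assoc)
    then show ?thesis by (simp add: algebra_simps)
  qed
  have bound: "measure lborel (A \<inter> ball x s) \<le> \<beta> * s ^ (?n - 1)" if "s > 0" for x s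
    using measure_slab_ball_le[OF A(1) slab w that, of x] by (simp add: \<beta>_def)
  have "newtonian_capacity (closure A) \<ge> d * (d - 2) / (d - 1) * ?\<omega> * R powr (d - 2)"
  proof (rule newtonian_capacity_ge)
    show "bounded (closure A)" using A(2) by (rule bounded_closure)
    fix \<phi> assume "cap_admissible (closure A) \<phi>"
    then have adm: "cap_admissible A \<phi>" unfolding cap_admissible_def using closure_subset[of A] by blast
    have "d * (d - 2) * ?\<omega> * ?m \<le> dirichlet \<phi> * ((d - 1) * \<beta> * R)"
      unfolding MR[symmetric]
      by (rule dirichlet_ge_newton_potential[OF A d R less_imp_le[OF \<beta>] bound adm])
    moreover have "?m = \<beta> * R * R powr (d - 2)"
    proof -
      have "R powr (d - 1) = R powr (1 + (d - 2))" by simp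
      also have "\<dots> = R * R powr (d - 2)" using R by (subst powr_add) simp
      finally show ?thesis using mR by simp
    qed
    ultimately have "(d * (d - 2) * ?\<omega> * R powr (d - 2)) * (\<beta> * R) \<le> (dirichlet \<phi> * (d - 1)) * (\<beta> * R)"
      by (simp add: mult_ac)
    then have "d * (d - 2) * ?\<omega> * R powr (d - 2) \<le> dirichlet \<phi> * (d - 1)"
      using \<beta> R by (simp only: mult_le_cancel_right_pos mult_pos_pos)
    then show "d * (d - 2) / (d - 1) * ?\<omega> * R powr (d - 2) \<le> dirichlet \<phi>"
      using d(2) by (simp add: field_simps)
  qed
  then show ?thesis unfolding R2 \<beta>_def .
qed

text \<open>Slabs are available only for widths strictly above (d + 1) times the inradius; the bound
  is continuous in the width, and the limit closes the gap.\<close>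

lemma newtonian_capacity_convex_ge:
  fixes \<Omega> :: "'a::euclidean_space set"
  assumes \<Omega>: "convex_domain \<Omega>" and d: "d = real DIM('a)" "d > 2"
  shows "newtonian_capacity (closure \<Omega>) \<ge> d * (d - 2) / (d - 1) * measure lborel (ball (0::'a) 1) *
    (measure lborel \<Omega> / ((d + 1) * inradius \<Omega> * 2 ^ (DIM('a) - 1) * measure lborel (ball (0::'a) 1))) powr ((d - 2) / (d - 1))"
proof -
  note D = convex_domainD[OF \<Omega>]
  let ?\<omega> = "measure lborel (ball (0::'a) 1)" and ?m = "measure lborel \<Omega>"
  let ?f = "\<lambda>w. d * (d - 2) / (d - 1) * ?\<omega> * (?m / (w * 2 ^ (DIM('a) - 1) * ?\<omega>)) powr ((d - 2) / (d - 1))"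
  have \<rho>: "inradius \<Omega> > 0" by (rule inradius_pos[OF D(2,3,1)])
  have m: "?m > 0" by (rule measure_open_pos[OF D(2,3,1)])
  let ?W = "(d + 1) * inradius \<Omega>"
  have W: "?W > 0" using \<rho> d(2) by simp
  have main: "?f w \<le> newtonian_capacity (closure \<Omega>)" if "w > ?W" for w
  proof -
    obtain e a where ea: "norm e = 1" "\<And>x. x \<in> \<Omega> \<Longrightarrow> a < x \<bullet> e \<and> x \<bullet> e < a + w"
      using convex_in_slab[OF \<Omega>, of w] \<open>w > ?W\<close> d(1) by auto
    show ?thesis
      using that W D by (intro newtonian_capacity_slab_ge[OF _ _ m d ea(2) _ ea(1)]) auto
  qed
  have "(?f \<longlongrightarrow> ?f ?W) (at_right ?W)"
    using W m d by (intro tendsto_intros) auto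
  then show ?thesis
  proof (rule tendsto_upperbound)
    show "\<forall>\<^sub>F w in at_right ?W. ?f w \<le> newtonian_capacity (closure \<Omega>)"
      unfolding eventually_at_right_field using main by (intro exI[of _ "?W + 1"]) auto
  qed auto
qed

text \<open>The inradius is a supremum, so balls of smaller radius are used and the radius then
  tends to it from below.\<close>

lemma tors_ge_inradius:
  fixes \<Omega> :: "'a::euclidean_space set"
  assumes \<Omega>: "convex_domain \<Omega>"
  shows "tors \<Omega> \<ge> (inradius \<Omega>)\<^sup>2 * measure lborel \<Omega> / 4 ^ (DIM('a) + 1)"
proof -
  note D = convex_domainD[OF \<Omega>]
  let ?f = "\<lambda>r. r\<^sup>2 * measure lborel \<Omega> / 4 ^ (DIM('a) + 1)"
  have \<rho>: "inradius \<Omega> > 0" by (rule inradius_pos[OF D(2,3,1)])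
  have main: "?f r \<le> tors \<Omega>" if r: "0 < r" "r < inradius \<Omega>" for r
  proof -
    obtain x s where xs: "s > r" "ball x s \<subseteq> \<Omega>" using inradius_approx[OF D(2,3,1) r(2)] by blast
    then have "ball x r \<subseteq> \<Omega>" using subset_ball[of r s x] by simp
    then show ?thesis using r by (intro tors_ge_convex D) auto
  qed
  have "(?f \<longlongrightarrow> ?f (inradius \<Omega>)) (at_left (inradius \<Omega>))" by (intro tendsto_intros) auto
  then show ?thesis
  proof (rule tendsto_upperbound)
    show "\<forall>\<^sub>F r in at_left (inradius \<Omega>). ?f r \<le> tors \<Omega>"
      unfolding eventually_at_left_field using main \<rho> by (intro exI[of _ 0]) auto
  qed auto
qed

text \<open>Compares the upper bound \<open>2 ^ n\<close> for the unit ball with the lower bound for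
  convex sets, both per unit ball volume; the quotient costs \<open>d powr d\<close>. For d at least
  4 the crude bounds (d + 1)^\<gamma> at most d + 1 and 4^n at most d^n suffice. For d = 3 the
  latter fails, but \<gamma> = 1/2 and (d + 1)^\<gamma> = 2 can be computed.\<close>

lemma capacity_constant:
  assumes d: "d = real n" and n: "n \<ge> 3"
  shows "2 ^ n / d powr d \<le> d * (d - 2) / (d - 1) * (1 / ((d + 1) * 2 ^ (n - 1))) powr ((d - 2) / (d - 1))"
proof -
  define \<gamma> where "\<gamma> = (d - 2) / (d - 1)"
  have d3: "d \<ge> 3" using n d by simp
  have \<gamma>: "0 < \<gamma>" "\<gamma> \<le> 1" using d3 by (auto simp: \<gamma>_def)
  have two: "(2 ^ (n - 1) :: real) powr \<gamma> = 2 ^ (n - 2)"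
  proof -
    have "(2 ^ (n - 1) :: real) powr \<gamma> = 2 powr (real (n - 1) * \<gamma>)" by (simp add: powr_realpow[symmetric] powr_powr)
    also have "real (n - 1) * \<gamma> = real (n - 2)" using n d by (simp add: \<gamma>_def of_nat_diff)
    also have "(2::real) powr real (n - 2) = 2 ^ (n - 2)" by (rule powr_realpow) simp
    finally show ?thesis .
  qed
  have dn: "d powr d = d ^ n" using d3 d by (simp add: powr_realpow)
  have key: "2 ^ n * ((d - 1) * (2 ^ (n - 2) * (d + 1) powr \<gamma>)) \<le> d ^ n * (d * (d - 2))"
  proof (cases "n = 3")
    case True
    then have "d = 3" "\<gamma> = 1 / 2" using d by (auto simp: \<gamma>_def)
    then have "(d + 1) powr \<gamma> = (3 + 1) powr (1 / 2)" by (simp only:)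
    also have "\<dots> = 2" by (simp add: powr_half_sqrt)
    finally have "(d + 1) powr \<gamma> = 2" .
    then show ?thesis using True \<open>d = 3\<close> by simp
  next
    case False
    then have d4: "d \<ge> 4" using n d by simp
    have "(d + 1) powr \<gamma> \<le> d + 1" using powr_mono[of \<gamma> 1 "d + 1"] \<gamma> d3 by simp
    then have "2 ^ n * ((d - 1) * (2 ^ (n - 2) * (d + 1) powr \<gamma>)) \<le> 2 ^ n * ((d - 1) * (2 ^ (n - 2) * (d + 1)))"
      using d3 by (intro mult_left_mono) auto
    also have "\<dots> = 4 ^ (n - 1) * ((d - 1) * (d + 1))"
    proof -
      have "(2::real) ^ n * 2 ^ (n - 2) = 2 ^ (2 * (n - 1))"
        using n by (subst power_add[symmetric]) (rule arg_cong[where f = "\<lambda>k. 2 ^ k"], simp)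
      also have "\<dots> = 4 ^ (n - 1)" by (simp add: power_mult)
      finally have "(2::real) ^ n * 2 ^ (n - 2) = 4 ^ (n - 1)" .
      then show ?thesis by (simp add: mult_ac)
    qed
    also have "\<dots> \<le> 4 ^ (n - 1) * (4 * (d * (d - 2)))"
    proof -
      \<comment> \<open>This product is 4 d (d - 2) - (d - 1)(d + 1) - 17.\<close>
      have "0 \<le> (d - 4) * (3 * d + 4)" using d4 by (intro mult_nonneg_nonneg) auto
      then have "(d - 1) * (d + 1) \<le> 4 * (d * (d - 2))" using d4 by (simp add: algebra_simps)
      then show ?thesis by (intro mult_left_mono) auto
    qed
    also have "\<dots> = 4 ^ n * (d * (d - 2))" using n by (cases n) auto
    also have "\<dots> \<le> d ^ n * (d * (d - 2))" using d4 by (intro mult_right_mono power_mono) auto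
    finally show ?thesis .
  qed
  have "(1 / ((d + 1) * 2 ^ (n - 1))) powr \<gamma> = 1 / ((d + 1) powr \<gamma> * 2 ^ (n - 2))"
    using d3 by (simp add: powr_divide powr_mult two[unfolded One_nat_def])
  moreover define Q where "Q = (d + 1) powr \<gamma> * 2 ^ (n - 2)"
  ultimately have X: "(1 / ((d + 1) * 2 ^ (n - 1))) powr \<gamma> = 1 / Q" by simp
  have Q: "Q > 0" using d3 by (simp add: Q_def)
  have "2 ^ n * ((d - 1) * Q) \<le> d ^ n * (d * (d - 2))" using key by (simp add: Q_def mult_ac)
  then have "2 ^ n / d ^ n \<le> d * (d - 2) / ((d - 1) * Q)"
    using Q d3 by (simp add: divide_simps mult_ac)
  then show ?thesis unfolding dn \<gamma>_def[symmetric] X by simp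
qed

lemma G_eq_tors:
  fixes \<Omega> :: "'a::euclidean_space set"
  assumes "open \<Omega>" "bounded \<Omega>"
  shows "G q \<Omega> = newtonian_capacity (closure \<Omega>) * tors \<Omega> powr q /
     measure lborel \<Omega> powr (1 + q + 2 * (q - 1) / real DIM('a))"
  using assms by (simp add: G_def torsional_rigidity_eq_tors)

lemma G_nonneg: "open \<Omega> \<Longrightarrow> bounded \<Omega> \<Longrightarrow> G q \<Omega> \<ge> 0"
  by (auto simp: G_eq_tors intro!: divide_nonneg_nonneg mult_nonneg_nonneg newtonian_capacity_nonneg bounded_closure)

text \<open>Capacity scales with exponent d - 2, torsion with d + 2, volume with d; the exponent
  \<open>E\<close> of the volume satisfies d E = d - 2 + (d + 2) q, so the powers of
  \<open>c\<close> cancel.\<close>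

lemma G_affine:
  fixes \<Omega> :: "'a::euclidean_space set"
  assumes \<Omega>: "open \<Omega>" "bounded \<Omega>" and "c > 0" and n: "DIM('a) \<ge> 2"
  shows "G q ((\<lambda>x. a + c *\<^sub>R x) ` \<Omega>) = G q \<Omega>"
proof -
  let ?d = "real DIM('a)" 
  define E where "E = 1 + q + 2 * (q - 1) / real DIM('a)"
  let ?\<Omega> = "(\<lambda>x. a + c *\<^sub>R x) ` \<Omega>"
  have cl: "closure ?\<Omega> = (\<lambda>x. a + c *\<^sub>R x) ` closure \<Omega>"
  proof -
    have "closure ?\<Omega> = closure ((+) a ` (*\<^sub>R) c ` \<Omega>)" by (simp add: image_image)
    also have "\<dots> = (+) a ` (*\<^sub>R) c ` closure \<Omega>" by (simp only: closure_translation closure_scaleR)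
    finally show ?thesis by (simp add: image_image)
  qed
  have cap: "newtonian_capacity (closure ?\<Omega>) = c powr (?d - 2) * newtonian_capacity (closure \<Omega>)"
    using newtonian_capacity_affine[OF bounded_closure[OF \<Omega>(2)] \<open>c > 0\<close> n, of a] assms
    by (simp add: cl powr_realpow[symmetric] of_nat_diff)
  have tors: "tors ?\<Omega> powr q = c powr ((?d + 2) * q) * tors \<Omega> powr q"
  proof -
    have "c ^ (DIM('a) + 2) = c powr (?d + 2)"
      using powr_realpow[OF \<open>c > 0\<close>, of "DIM('a) + 2"] by (simp add: add.commute)
    then have "tors ?\<Omega> = c powr (?d + 2) * tors \<Omega>" using tors_affine[OF \<Omega> \<open>c > 0\<close>, of a] by (simp only:)
    then show ?thesis using tors_nonneg[OF \<Omega>] by (simp add: powr_mult powr_powr)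
  qed
  have meas: "measure lborel ?\<Omega> powr E = c powr (?d * E) * measure lborel \<Omega> powr E"
    using measure_affine_image(2)[of c \<Omega> a] \<Omega>(1) \<open>c > 0\<close>
    by (simp add: powr_mult powr_powr powr_realpow[symmetric])
  have "?d * E = ?d - 2 + (?d + 2) * q" using n by (simp add: E_def field_simps)
  then have "c powr (?d * E) = c powr (?d - 2) * c powr ((?d + 2) * q)" by (simp only: powr_add)
  then show ?thesis
    using \<open>c > 0\<close>
    unfolding G_eq_tors[OF \<Omega>] G_eq_tors[OF open_bounded_affine[OF \<Omega> \<open>c > 0\<close>]] E_def[symmetric] cap tors meas
    by simp
qed

lemma G_unit_ball:
  assumes "DIM('a::euclidean_space) \<ge> 2"
  shows "G q (ball (c::'a) 1) = G q (ball (0::'a) 1)"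
  using G_affine[of "ball (0::'a) 1" 1 q c] assms by (simp add: image_add_ball flip: add_0_right)

text \<open>With \<open>|\<Omega>| = \<omega> * s ^ d\<close>, where \<open>\<omega>\<close> is the volume of the unit ball.\<close>

lemma G_ge_inradius:
  fixes \<Omega> :: "'a::euclidean_space set"
  assumes \<Omega>: "convex_domain \<Omega>" and d: "d = real DIM('a)" "d \<ge> 3" and q: "q > 0"
    and s: "s > 0" "measure lborel \<Omega> = s ^ DIM('a) * measure lborel (ball (0::'a) 1)"
  shows "G q \<Omega> \<ge> 1 / d powr (d + (d + 2) * q) * (inradius \<Omega> / s) powr (2 * q - (d - 2) / (d - 1)) * G q (ball (0::'a) 1)"
proof -
  note D = convex_domainD[OF \<Omega>]
  let ?n = "DIM('a)" and ?\<omega> = "measure lborel (ball (0::'a) 1)" and ?m = "measure lborel \<Omega>"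
  define E where "E = 1 + q + 2 * (q - 1) / d"
  define \<gamma> where "\<gamma> = (d - 2) / (d - 1)"
  define \<rho> where "\<rho> = inradius \<Omega>"
  define t where "t = \<rho> / s"
  define capB where "capB = newtonian_capacity (cball (0::'a) 1)"
  define TB where "TB = tors (ball (0::'a) 1)"
  have \<omega>: "?\<omega> > 0" by simp
  have n: "?n \<ge> 3" using d by simp
  have \<rho>: "\<rho> > 0" unfolding \<rho>_def by (rule inradius_pos[OF D(2,3,1)])
  have t: "t > 0" using \<rho> s by (simp add: t_def)
  have \<gamma>: "\<gamma> \<ge> 0" using d by (simp add: \<gamma>_def)
  have capB: "0 \<le> capB" "capB \<le> 2 ^ ?n * ?\<omega>"
    using newtonian_capacity_nonneg[of "cball (0::'a) 1"] newtonian_capacity_ball_le[where 'a='a] n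
    by (simp_all add: capB_def)
  have TB: "0 \<le> TB" "TB \<le> ?\<omega> / d\<^sup>2"
    using tors_nonneg[of "ball (0::'a) 1"] tors_unit_ball_le[where 'a='a] d by (simp_all add: TB_def)
  \<comment> \<open>In terms of \<open>s\<close> the capacity bound splits into the scaling factor
    s^(d-2), shared with the ball of the same volume, and the gain t^(-\<gamma>) from
    thinness.\<close>
  have cap: "newtonian_capacity (closure \<Omega>) \<ge> 1 / d powr d * (s powr (d - 2) * t powr (- \<gamma>)) * capB"
  proof -
    have "(?m / ((d + 1) * \<rho> * 2 ^ (?n - 1) * ?\<omega>)) powr \<gamma> =
        ((s powr (d - 1) * (1 / t)) * (1 / ((d + 1) * 2 ^ (?n - 1)))) powr \<gamma>"
    proof -
      have "s ^ ?n = s * s powr (d - 1)"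
        using s(1) d powr_realpow[OF s(1), of ?n] powr_add[of s 1 "d - 1"] by simp
      then have "?m / ((d + 1) * \<rho> * 2 ^ (?n - 1) * ?\<omega>) = (s powr (d - 1) * (1 / t)) * (1 / ((d + 1) * 2 ^ (?n - 1)))"
      proof -
        have "?m / ((d + 1) * \<rho> * 2 ^ (?n - 1) * ?\<omega>) = (s * s powr (d - 1) * ?\<omega>) / ((d + 1) * \<rho> * 2 ^ (?n - 1) * ?\<omega>)"
          by (simp only: s(2) \<open>s ^ ?n = s * s powr (d - 1)\<close>)
        also have "\<dots> = s * s powr (d - 1) / ((d + 1) * \<rho> * 2 ^ (?n - 1))"
          using \<omega> by (intro nonzero_mult_divide_mult_cancel_right) simp
        finally show ?thesis by (simp add: t_def mult_ac)
      qed
      then show ?thesis by (rule arg_cong)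
    qed
    also have "\<dots> = (s powr (d - 1) * (1 / t)) powr \<gamma> * (1 / ((d + 1) * 2 ^ (?n - 1))) powr \<gamma>"
      using t d by (intro powr_mult)
    also have "(s powr (d - 1) * (1 / t)) powr \<gamma> = s powr (d - 2) * t powr (- \<gamma>)"
    proof -
      have "(d - 1) * \<gamma> = d - 2" using d by (simp add: \<gamma>_def)
      then show ?thesis using t by (simp add: powr_mult powr_powr powr_divide powr_minus_divide)
    qed
    finally have e: "(?m / ((d + 1) * \<rho> * 2 ^ (?n - 1) * ?\<omega>)) powr \<gamma> =
      s powr (d - 2) * t powr (- \<gamma>) * (1 / ((d + 1) * 2 ^ (?n - 1))) powr \<gamma>" .
    have "1 / d powr d * (s powr (d - 2) * t powr (- \<gamma>)) * capB \<le> 1 / d powr d * (s powr (d - 2) * t powr (- \<gamma>)) * (2 ^ ?n * ?\<omega>)"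
      using capB by (intro mult_left_mono) auto
    also have "\<dots> = (2 ^ ?n / d powr d) * (?\<omega> * (s powr (d - 2) * t powr (- \<gamma>)))" by simp
    also have "\<dots> \<le> (d * (d - 2) / (d - 1) * (1 / ((d + 1) * 2 ^ (?n - 1))) powr \<gamma>) * (?\<omega> * (s powr (d - 2) * t powr (- \<gamma>)))"
      unfolding \<gamma>_def by (intro mult_right_mono capacity_constant[OF d(1) n]) auto
    also have "\<dots> = d * (d - 2) / (d - 1) * ?\<omega> * (?m / ((d + 1) * \<rho> * 2 ^ (?n - 1) * ?\<omega>)) powr \<gamma>"
      unfolding e by (simp only: mult_ac)
    also have "\<dots> \<le> newtonian_capacity (closure \<Omega>)"
      unfolding \<rho>_def \<gamma>_def using d by (intro newtonian_capacity_convex_ge[OF \<Omega>]) auto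
    finally show ?thesis .
  qed
  \<comment> \<open>The constant 4^(-d-1) for convex sets meets the upper bound \<omega>/d^2 for the
    ball; as 4^(d+1) is at most d^(d+4), the quotient costs d^(d+2).\<close>
  have tors: "tors \<Omega> \<ge> (t powr 2 * s powr (d + 2) * (1 / d powr (d + 2))) * TB"
  proof -
    have "4 ^ (?n + 1) \<le> d powr (d + 4)"
    proof (cases "?n = 3")
      case True
      then have "d = 3" using d by simp
      then have "d powr (d + 4) = 3 ^ 7" by (simp add: powr_realpow[symmetric])
      then show ?thesis using True by simp
    next
      case False
      then have "d \<ge> 4" using d n by simp
      then have "(4::real) ^ (?n + 1) \<le> d ^ (?n + 1)" by (intro power_mono) auto
      also have "\<dots> = d powr (d + 1)" using d powr_realpow[of d "?n + 1"] by (simp add: add.commute)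
      also have "\<dots> \<le> d powr (d + 4)" using d by (intro powr_mono) auto
      finally show ?thesis .
    qed
    then have four: "d powr (d + 4) \<ge> 4 ^ (?n + 1)" .
    have "(t powr 2 * s powr (d + 2) * (1 / d powr (d + 2))) * TB \<le> (t powr 2 * s powr (d + 2) * (1 / d powr (d + 2))) * (?\<omega> / d\<^sup>2)"
      using TB by (intro mult_left_mono) auto
    also have "\<dots> = t powr 2 * s powr (d + 2) * ?\<omega> / d powr (d + 4)"
    proof -
      have "d powr (d + 4) = d powr (d + 2) * d\<^sup>2"       proof -
        have "d + 4 = (d + 2) + 2" by simp
        then have "d powr (d + 4) = d powr ((d + 2) + 2)" by (rule arg_cong)
        also have "\<dots> = d powr (d + 2) * d powr 2" by (rule powr_add)
        also have "d powr 2 = d\<^sup>2" using d(2) by simp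
        finally show ?thesis .
      qed
      then show ?thesis by simp
    qed
    also have "\<dots> \<le> t powr 2 * s powr (d + 2) * ?\<omega> / 4 ^ (?n + 1)"
      using four d(2) by (intro divide_left_mono) (auto intro!: mult_pos_pos)
    also have "t powr 2 * s powr (d + 2) * ?\<omega> = \<rho>\<^sup>2 * ?m"
    proof -
      have "t powr 2 = \<rho>\<^sup>2 / s\<^sup>2" using t by (simp add: t_def power_divide)
      moreover have "s powr (d + 2) = s ^ ?n * s\<^sup>2" using s(1) d powr_add[of s d 2] powr_realpow[OF s(1), of ?n] by simp
      ultimately show ?thesis using s by simp
    qed
    also have "\<rho>\<^sup>2 * ?m / 4 ^ (?n + 1) \<le> tors \<Omega>" unfolding \<rho>_def by (rule tors_ge_inradius[OF \<Omega>])
    finally show ?thesis .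
  qed
  have GB: "G q (ball (0::'a) 1) = capB * TB powr q / ?\<omega> powr E"
    by (simp add: G_eq_tors capB_def TB_def E_def d(1))
  have m: "?m powr E = ?\<omega> powr E * s powr (d - 2 + (d + 2) * q)"
  proof -
    have "?m powr E = s powr (d * E) * ?\<omega> powr E"
      using s powr_realpow[OF s(1), of ?n] by (simp add: powr_mult powr_powr d(1)[symmetric] flip: powr_realpow)
    also have "d * E = d - 2 + (d + 2) * q" using d(2) by (simp add: E_def field_simps)
    finally show ?thesis by simp
  qed
  have "1 / d powr (d + (d + 2) * q) * t powr (2 * q - \<gamma>) * G q (ball (0::'a) 1) =
     (1 / d powr d * (s powr (d - 2) * t powr (- \<gamma>)) * capB) *
      ((t powr 2 * s powr (d + 2) * (1 / d powr (d + 2))) * TB) powr q / ?m powr E"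
  proof -
    have "((t powr 2 * s powr (d + 2) * (1 / d powr (d + 2))) * TB) powr q =
        t powr (2 * q) * s powr ((d + 2) * q) * (1 / d powr ((d + 2) * q)) * TB powr q"
      using TB d by (simp add: powr_mult powr_powr powr_divide)
    moreover have "s powr (d - 2 + (d + 2) * q) = s powr (d - 2) * s powr ((d + 2) * q)" by (rule powr_add)
    moreover have "t powr (2 * q - \<gamma>) = t powr (2 * q) * t powr (- \<gamma>)" by (simp flip: powr_add)
    moreover have "d powr (d + (d + 2) * q) = d powr d * d powr ((d + 2) * q)" by (rule powr_add)
    ultimately show ?thesis unfolding GB m using s(1) by (simp add: mult_ac)
  qed
  also have "\<dots> \<le> newtonian_capacity (closure \<Omega>) * tors \<Omega> powr q / ?m powr E"
    using cap tors TB capB q newtonian_capacity_nonneg[OF bounded_closure[OF D(3)]]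
    by (intro divide_right_mono mult_mono powr_mono2) auto
  also have "\<dots> = G q \<Omega>" using D by (simp add: G_eq_tors E_def d(1))
  finally show ?thesis by (simp add: t_def \<rho>_def \<gamma>_def)
qed

section \<open>Volume and diameter\<close>

lemma volume_radius_exists:
  fixes \<Omega> :: "'a::euclidean_space set"
  assumes "measure lborel \<Omega> > 0"
  obtains s where "s > 0" "measure lborel \<Omega> = s ^ DIM('a) * measure lborel (ball (0::'a) 1)"
proof
  let ?x = "measure lborel \<Omega> / measure lborel (ball (0::'a) 1)"
  have x: "?x > 0" using assms by simp
  then show "root DIM('a) ?x > 0" by simp
  have "root DIM('a) ?x ^ DIM('a) = ?x" using x by (intro real_root_pow_pos2) auto
  then show "measure lborel \<Omega> = root DIM('a) ?x ^ DIM('a) * measure lborel (ball (0::'a) 1)" by simp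
qed

text \<open>Disjoint balls of radius \<open>s / 2\<close> are placed along the first half of the segment from
  \<open>x\<close> to \<open>p\<close>.\<close>

lemma convex_dist_volume:
  fixes \<Omega> :: "'a::euclidean_space set"
  assumes \<Omega>: "convex \<Omega>" "open \<Omega>" "bounded \<Omega>" and s: "ball x s \<subseteq> \<Omega>" "s > 0" and p: "p \<in> \<Omega>"
  shows "norm (p - x) * s ^ (DIM('a) - 1) * measure lborel (ball (0::'a) 1) \<le> 2 ^ (DIM('a) + 1) * measure lborel \<Omega>"
proof (cases "p = x")
  case False
  let ?n = "DIM('a)" and ?\<omega> = "measure lborel (ball (0::'a) 1)"
  define L where "L = norm (p - x)"
  have L: "L > 0" using False by (simp add: L_def)
  \<comment> \<open>Centres at spacing \<open>s\<close> along at most half the segment, so that the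
    shrunk inscribed balls still have radius at least s/2. The count N + 1 includes the centre
    \<open>x\<close> itself and is at least L/(2s).\<close>
  define N where "N = nat \<lfloor>L / (2 * s)\<rfloor>"
  define B where "B i = ball (x + (real i * s / L) *\<^sub>R (p - x)) (s / 2)" for i :: nat
  have "B i \<subseteq> \<Omega>" if i: "i \<le> N" for i
  proof -
    have "real i \<le> L / (2 * s)"
    proof -
      have "real N \<le> L / (2 * s)" unfolding N_def using L s by (intro of_nat_floor) auto
      then show ?thesis using i by linarith
    qed
    then have t: "real i * s / L \<le> 1 / 2" using L s by (simp add: field_simps)
    define t where "t = 1 - real i * s / L"
    have "ball (t *\<^sub>R x + (1 - t) *\<^sub>R p) (t * s) \<subseteq> \<Omega>"
      using t L s by (intro convex_shrink_ball[OF \<Omega>(1) s(1) p]) (auto simp: t_def)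
    moreover have "t *\<^sub>R x + (1 - t) *\<^sub>R p = x + (real i * s / L) *\<^sub>R (p - x)"
      by (simp add: t_def algebra_simps)
    moreover have "s / 2 \<le> t * s"
    proof -
      have "1 / 2 * s \<le> t * s" using t s by (intro mult_right_mono) (auto simp: t_def)
      then show ?thesis by simp
    qed
    ultimately show ?thesis unfolding B_def using subset_ball by fastforce
  qed
  moreover have "pairwise (\<lambda>i j. disjnt (B i) (B j)) {..N}"
  proof (rule pairwiseI)
    fix i j :: nat assume "i \<noteq> j"
    have "dist (x + (real i * s / L) *\<^sub>R (p - x)) (x + (real j * s / L) *\<^sub>R (p - x)) = \<bar>real i - real j\<bar> * s"
    proof -
      have "dist (x + (real i * s / L) *\<^sub>R (p - x)) (x + (real j * s / L) *\<^sub>R (p - x)) =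
         norm ((real i * s / L - real j * s / L) *\<^sub>R (p - x))" by (simp add: dist_norm scaleR_left_diff_distrib)
      also have "\<dots> = \<bar>(real i - real j) * s / L\<bar> * L"
        by (simp add: L_def left_diff_distrib diff_divide_distrib)
      also have "\<dots> = \<bar>real i - real j\<bar> * s" using L s by (simp add: abs_mult)
      finally show ?thesis .
    qed
    moreover have "\<bar>real i - real j\<bar> \<ge> 1" using \<open>i \<noteq> j\<close> by linarith
    then have "\<bar>real i - real j\<bar> * s \<ge> 1 * s" using s by (intro mult_right_mono) auto
    ultimately show "disjnt (B i) (B j)"
      unfolding B_def disjnt_def by (intro disjoint_ballI) simp
  qed
  ultimately have "measure lborel (\<Union>i\<in>{..N}. B i) = (\<Sum>i\<in>{..N}. measure lborel (B i))"
    by (intro measure_UNION') (auto simp: B_def intro!: fmeasurable_lborel_bounded)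
  also have "\<dots> = real (N + 1) * ((s / 2) ^ ?n * ?\<omega>)"
    unfolding B_def using s by (subst content_ball_conv_unit_ball) auto
  finally have "real (N + 1) * ((s / 2) ^ ?n * ?\<omega>) = measure lborel (\<Union>i\<in>{..N}. B i)" by simp
  also have "\<dots> \<le> measure lborel \<Omega>"
    using \<Omega> \<open>\<And>i. i \<le> N \<Longrightarrow> B i \<subseteq> \<Omega>\<close>
    by (intro measure_mono_fmeasurable fmeasurable_lborel_bounded) (auto simp: B_def)
  finally have 1: "real (N + 1) * ((s / 2) ^ ?n * ?\<omega>) \<le> measure lborel \<Omega>" .
  have "L / (2 * s) \<le> real (N + 1)" unfolding N_def by linarith
  then have "L / (2 * s) * ((s / 2) ^ ?n * ?\<omega>) \<le> real (N + 1) * ((s / 2) ^ ?n * ?\<omega>)"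
    using s by (intro mult_right_mono) auto
  with 1 have "L / (2 * s) * ((s / 2) ^ ?n * ?\<omega>) \<le> measure lborel \<Omega>" by linarith
  moreover have "s ^ ?n = s * s ^ (?n - 1)" using DIM_positive[where 'a='a] by (cases ?n) auto
  ultimately show ?thesis using s by (simp add: L_def power_divide field_simps)
qed simp

lemma G_pos:
  fixes \<Omega> :: "'a::euclidean_space set"
  assumes \<Omega>: "convex_domain \<Omega>" and n: "DIM('a) \<ge> 3"
  shows "G q \<Omega> > 0"
proof -
  note D = convex_domainD[OF \<Omega>]
  have m: "measure lborel \<Omega> > 0" by (rule measure_open_pos[OF D(2,3,1)])
  have \<rho>: "inradius \<Omega> > 0" by (rule inradius_pos[OF D(2,3,1)])
  define d where "d = real DIM('a)"
  have d: "d > 2" using n by (simp add: d_def)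
  have "0 < d * (d - 2) / (d - 1) * measure lborel (ball (0::'a) 1) *
    (measure lborel \<Omega> / ((d + 1) * inradius \<Omega> * 2 ^ (DIM('a) - 1) * measure lborel (ball (0::'a) 1))) powr ((d - 2) / (d - 1))"
    using d m \<rho> by (intro mult_pos_pos divide_pos_pos) (auto simp: powr_gt_zero)
  also have "\<dots> \<le> newtonian_capacity (closure \<Omega>)" by (rule newtonian_capacity_convex_ge[OF \<Omega> d_def d])
  finally have cap: "newtonian_capacity (closure \<Omega>) > 0" .
  have "0 < (inradius \<Omega>)\<^sup>2 * measure lborel \<Omega> / 4 ^ (DIM('a) + 1)" using \<rho> m by simp
  also have "\<dots> \<le> tors \<Omega>" by (rule tors_ge_inradius[OF \<Omega>])
  finally show ?thesis using cap m by (simp add: G_eq_tors D)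
qed

section \<open>Existence of minimisers\<close>

text \<open>Arzela-Ascoli applies to the distance functions, which are 1-Lipschitz and bounded on
  the large ball. If two are uniformly closer than \<open>e\<close>, a point of one set is y + e z
  with y in the other and z in the unit ball, hence also in the other; convexity puts it into the
  dilate by 1 + e. This multiplicative closeness suits a dilation-invariant functional.\<close>

lemma blaschke_selection:
  fixes \<Omega> :: "nat \<Rightarrow> 'a::euclidean_space set"
  assumes conv: "\<And>k. convex (\<Omega> k)" and ball: "\<And>k. ball 0 1 \<subseteq> \<Omega> k" and bdd: "\<And>k. \<Omega> k \<subseteq> cball 0 D"
  obtains \<sigma> :: "nat \<Rightarrow> nat" where "strict_mono \<sigma>"
    "\<And>e. e > 0 \<Longrightarrow> \<exists>N. \<forall>m\<ge>N. \<forall>n\<ge>N. \<Omega> (\<sigma> m) \<subseteq> (\<lambda>x. (1 + e) *\<^sub>R x) ` \<Omega> (\<sigma> n)"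
proof -
  let ?f = "\<lambda>k x. infdist x (\<Omega> k)"
  have zero: "0 \<in> \<Omega> k" for k using ball[of k] by auto
  have ne: "\<Omega> k \<noteq> {}" for k using zero by blast
  have bound: "norm (?f k x) \<le> D" if "x \<in> cball 0 D" for k x
    using infdist_le[OF zero, of x k] that by (simp add: infdist_nonneg)
  have equi: "\<exists>\<delta>>0. \<forall>k y. y \<in> cball 0 D \<and> norm (x - y) < \<delta> \<longrightarrow> norm (?f k x - ?f k y) < e"
    if "e > 0" for x e
  proof (intro exI[of _ e] conjI allI impI that)
    fix k y assume "y \<in> cball 0 D \<and> norm (x - y) < e"
    then show "norm (?f k x - ?f k y) < e"
      using infdist_triangle_abs[of x "\<Omega> k" y] by (simp add: dist_norm)
  qed
  obtain g \<sigma> where \<sigma>: "strict_mono (\<sigma> :: nat \<Rightarrow> nat)"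
    and lim: "\<And>e. 0 < e \<Longrightarrow> \<exists>N. \<forall>n x. n \<ge> N \<and> x \<in> cball 0 D \<longrightarrow> norm (?f (\<sigma> n) x - g x) < e"
  proof (rule Arzela_Ascoli[of "cball 0 D" ?f D])
    fix g and \<sigma> :: "nat \<Rightarrow> nat"
    assume "strict_mono \<sigma>" "\<And>e. 0 < e \<Longrightarrow> \<exists>N. \<forall>n x. n \<ge> N \<and> x \<in> cball 0 D \<longrightarrow> norm (?f (\<sigma> n) x - g x) < e"
    then show thesis by (rule that)
  qed (rule compact_cball, erule bound, rule equi)
  have "\<exists>N. \<forall>m\<ge>N. \<forall>n\<ge>N. \<Omega> (\<sigma> m) \<subseteq> (\<lambda>x. (1 + e) *\<^sub>R x) ` \<Omega> (\<sigma> n)" if e: "e > 0" for e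
  proof -
    obtain N where N: "\<And>n x. n \<ge> N \<Longrightarrow> x \<in> cball 0 D \<Longrightarrow> norm (?f (\<sigma> n) x - g x) < e / 2"
      using lim[of "e / 2"] e by auto
    show ?thesis
    proof (intro exI[of _ N] allI impI subsetI)
      fix m n x assume mn: "m \<ge> N" "n \<ge> N" and x: "x \<in> \<Omega> (\<sigma> m)"
      have xD: "x \<in> cball 0 D" using bdd x by blast
      have "?f (\<sigma> m) x = 0" using x by simp
      then have "?f (\<sigma> n) x < e" using N[OF mn(1) xD] N[OF mn(2) xD] unfolding real_norm_def by linarith
      then obtain y where y: "y \<in> \<Omega> (\<sigma> n)" "dist x y < e"
        using infdist_notempty[OF ne, of x] cInf_lessD[of "dist x ` \<Omega> (\<sigma> n)" e] ne by auto
      define z where "z = (1 / e) *\<^sub>R (x - y)"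
      have "norm z = norm (x - y) / e" using e by (simp add: z_def)
      then have "z \<in> ball 0 1" using y(2) e by (simp add: dist_norm)
      then have z: "z \<in> \<Omega> (\<sigma> n)" using ball by blast
      have "(1 / (1 + e)) *\<^sub>R y + (e / (1 + e)) *\<^sub>R z \<in> \<Omega> (\<sigma> n)"
        using conv y(1) z e by (intro convexD) (auto simp: field_simps)
      moreover have "x = (1 + e) *\<^sub>R ((1 / (1 + e)) *\<^sub>R y + (e / (1 + e)) *\<^sub>R z)"
        using e by (simp add: z_def scaleR_add_right)
      ultimately show "x \<in> (\<lambda>x. (1 + e) *\<^sub>R x) ` \<Omega> (\<sigma> n)" by blast
    qed
  qed
  with \<sigma> show thesis by (rule that)
qed

lemma mem_scaled_image:
  fixes x :: "'a::real_vector"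
  assumes "c \<noteq> 0"
  shows "x \<in> (\<lambda>x. c *\<^sub>R x) ` A \<longleftrightarrow> (1 / c) *\<^sub>R x \<in> A"
proof
  assume "(1 / c) *\<^sub>R x \<in> A"
  then have "c *\<^sub>R ((1 / c) *\<^sub>R x) \<in> (\<lambda>x. c *\<^sub>R x) ` A" by (rule imageI)
  then show "x \<in> (\<lambda>x. c *\<^sub>R x) ` A" using assms by simp
qed (use assms in auto)

text \<open>The limit is the interior of the set of points that eventually stay in the sequence. A
  point of it lies in some late set, hence in the dilate of every late set. Conversely a late set
  divided by 1 + e lies in all late sets and is open, so it lies in that interior.\<close>

lemma convex_limit:
  fixes \<Omega> :: "nat \<Rightarrow> 'a::euclidean_space set"
  assumes conv: "\<And>k. convex (\<Omega> k)" "\<And>k. open (\<Omega> k)" and ball: "\<And>k. ball 0 1 \<subseteq> \<Omega> k" and bdd: "\<And>k. \<Omega> k \<subseteq> cball 0 D"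
    and cauchy: "\<And>e. e > 0 \<Longrightarrow> \<exists>N. \<forall>m\<ge>N. \<forall>n\<ge>N. \<Omega> m \<subseteq> (\<lambda>x. (1 + e) *\<^sub>R x) ` \<Omega> n"
  obtains A where "convex_domain A"
    "\<And>e. e > 0 \<Longrightarrow> \<exists>N. \<forall>n\<ge>N. A \<subseteq> (\<lambda>x. (1 + e) *\<^sub>R x) ` \<Omega> n \<and> \<Omega> n \<subseteq> (\<lambda>x. (1 + e) *\<^sub>R x) ` A"
proof -
  define K where "K = {x. \<forall>\<^sub>F n in sequentially. x \<in> \<Omega> n}"
  define A where "A = interior K"
  have "convex K"
  proof (rule convexI)
    fix x y and u v :: real
    assume "x \<in> K" "y \<in> K" and uv: "0 \<le> u" "0 \<le> v" "u + v = 1"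
    then have "\<forall>\<^sub>F n in sequentially. x \<in> \<Omega> n" "\<forall>\<^sub>F n in sequentially. y \<in> \<Omega> n" by (auto simp: K_def)
    then have "\<forall>\<^sub>F n in sequentially. u *\<^sub>R x + v *\<^sub>R y \<in> \<Omega> n"
      by eventually_elim (use conv uv in \<open>auto intro: convexD\<close>)
    then show "u *\<^sub>R x + v *\<^sub>R y \<in> K" by (simp add: K_def)
  qed
  moreover have "ball 0 1 \<subseteq> K" using ball by (auto simp: K_def intro!: always_eventually)
  then have bA: "ball 0 1 \<subseteq> A" unfolding A_def by (simp add: interior_maximal)
  moreover have "K \<subseteq> cball 0 D"
  proof
    fix x assume "x \<in> K"
    then obtain N where "\<And>n. n \<ge> N \<Longrightarrow> x \<in> \<Omega> n" by (auto simp: K_def eventually_sequentially)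
    then show "x \<in> cball 0 D" using bdd by blast
  qed
  then have "bounded A" unfolding A_def by (meson bounded_cball bounded_subset interior_subset)
  moreover have "A \<noteq> {}" using bA by (metis centre_in_ball empty_iff subsetD zero_less_one)
  ultimately have 1: "convex_domain A" by (auto simp: convex_domain_def A_def convex_interior)
  have 2: "\<exists>N. \<forall>n\<ge>N. A \<subseteq> (\<lambda>x. (1 + e) *\<^sub>R x) ` \<Omega> n \<and> \<Omega> n \<subseteq> (\<lambda>x. (1 + e) *\<^sub>R x) ` A" if e: "e > 0" for e
  proof -
    have e0: "1 + e \<noteq> 0" using e by simp
    obtain N where N: "\<And>m n. m \<ge> N \<Longrightarrow> n \<ge> N \<Longrightarrow> \<Omega> m \<subseteq> (\<lambda>x. (1 + e) *\<^sub>R x) ` \<Omega> n" using cauchy[OF e] by blast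
    show ?thesis
    proof (intro exI[of _ N] allI impI conjI)
      fix n assume n: "n \<ge> N"
      show "A \<subseteq> (\<lambda>x. (1 + e) *\<^sub>R x) ` \<Omega> n"
      proof
        fix x assume "x \<in> A"
        then have "\<forall>\<^sub>F n in sequentially. x \<in> \<Omega> n" using interior_subset by (auto simp: A_def K_def)
        then obtain M where "\<And>n. n \<ge> M \<Longrightarrow> x \<in> \<Omega> n" by (auto simp: eventually_sequentially)
        then have "x \<in> \<Omega> (max M N)" by simp
        then show "x \<in> (\<lambda>x. (1 + e) *\<^sub>R x) ` \<Omega> n" using N[OF _ n, of "max M N"] by auto
      qed
      have "(\<lambda>x. (1 / (1 + e)) *\<^sub>R x) ` \<Omega> n \<subseteq> A"
        unfolding A_def
      proof (rule interior_maximal)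
        show "open ((\<lambda>x. (1 / (1 + e)) *\<^sub>R x) ` \<Omega> n)" using conv(2) e0 by (intro open_scaling) auto
        show "(\<lambda>x. (1 / (1 + e)) *\<^sub>R x) ` \<Omega> n \<subseteq> K"
        proof
          fix y assume "y \<in> (\<lambda>x. (1 / (1 + e)) *\<^sub>R x) ` \<Omega> n"
          then obtain x where x: "x \<in> \<Omega> n" "y = (1 / (1 + e)) *\<^sub>R x" by blast
          have "(1 / (1 + e)) *\<^sub>R x \<in> \<Omega> m" if "m \<ge> N" for m
            using N[OF n that] x mem_scaled_image[OF e0, of x "\<Omega> m"] by blast
          then show "y \<in> K" unfolding x(2) K_def eventually_sequentially by blast
        qed
      qed
      then show "\<Omega> n \<subseteq> (\<lambda>x. (1 + e) *\<^sub>R x) ` A" using mem_scaled_image[OF e0] by blast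
    qed
  qed
  show thesis by (rule that[OF 1 2])
qed

text \<open>Capacity and torsion grow with the set, so the first inclusion bounds the numerator of
  \<open>G q A\<close> by that of the dilate of \<open>B\<close>. The volume of this dilate exceeds
  that of \<open>A\<close> by at most c^(2d), one factor c^d from the dilation and one from the
  second inclusion. Invariance of \<open>G\<close> then removes the dilation.\<close>

lemma G_le_sandwich:
  fixes A B :: "'a::euclidean_space set"
  assumes A: "convex_domain A" and B: "convex_domain B" and c: "c \<ge> 1"
    and AB: "A \<subseteq> (\<lambda>x. c *\<^sub>R x) ` B" "B \<subseteq> (\<lambda>x. c *\<^sub>R x) ` A" and q: "q \<ge> 0" and n: "DIM('a) \<ge> 2"
  shows "G q A \<le> c powr (2 * (real DIM('a) - 2 + (real DIM('a) + 2) * q)) * G q B"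
proof -
  note DA = convex_domainD[OF A] and DB = convex_domainD[OF B]
  define E where "E = 1 + q + 2 * (q - 1) / real DIM('a)"
  have dE: "real DIM('a) * E = real DIM('a) - 2 + (real DIM('a) + 2) * q" using n by (simp add: E_def field_simps)
  have "real DIM('a) * E \<ge> 0" unfolding dE using q n by simp
  then have E: "E \<ge> 0" using n by (simp add: zero_le_mult_iff)
  define B' where "B' = (\<lambda>x. 0 + c *\<^sub>R x) ` B"
  have c0: "c > 0" using c by simp
  have B': "open B'" "bounded B'" unfolding B'_def by (rule open_bounded_affine[OF DB(2,3) c0])+
  have AB': "A \<subseteq> B'" using AB(1) by (simp add: B'_def)
  have cap: "newtonian_capacity (closure A) \<le> newtonian_capacity (closure B')"
    using AB' B' by (intro newtonian_capacity_mono closure_mono bounded_closure)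
  have tors: "tors A \<le> tors B'" by (rule tors_mono[OF AB' B'])
  have mA: "measure lborel A > 0" and mB: "measure lborel B > 0"
    using measure_open_pos[OF DA(2,3,1)] measure_open_pos[OF DB(2,3,1)] .
  have mB': "measure lborel B' = c ^ DIM('a) * measure lborel B"
    unfolding B'_def using DB c0 by (intro measure_affine_image(2)) auto
  have "measure lborel B \<le> c ^ DIM('a) * measure lborel A"
  proof -
    have "measure lborel B \<le> measure lborel ((\<lambda>x. 0 + c *\<^sub>R x) ` A)"
      using AB(2) DB open_bounded_affine[OF DA(2,3) c0, of 0]
      by (intro measure_mono_fmeasurable fmeasurable_lborel_bounded) auto
    also have "\<dots> = c ^ DIM('a) * measure lborel A"
      using DA c0 by (intro measure_affine_image(2)) auto
    finally show ?thesis .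
  qed
  then have "measure lborel B' \<le> c ^ DIM('a) * (c ^ DIM('a) * measure lborel A)"
    unfolding mB' using c0 by (intro mult_left_mono) auto
  also have "\<dots> = c powr (2 * real DIM('a)) * measure lborel A"
  proof -
    have "c powr (2 * real DIM('a)) = c powr (real DIM('a) + real DIM('a))"
      by (rule arg_cong[of _ _ "\<lambda>y. c powr y"]) simp
    also have "\<dots> = c ^ DIM('a) * c ^ DIM('a)" using c0 by (simp only: powr_add powr_realpow)
    finally show ?thesis by simp
  qed
  finally have "measure lborel B' powr E \<le> (c powr (2 * real DIM('a)) * measure lborel A) powr E"
    using E by (intro powr_mono2) auto
  also have "\<dots> = c powr (2 * (real DIM('a) * E)) * measure lborel A powr E"
    using mA by (simp add: powr_mult powr_powr mult.assoc)
  finally have m: "measure lborel B' powr E \<le> c powr (2 * (real DIM('a) * E)) * measure lborel A powr E" .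
  have mB'0: "measure lborel B' > 0" using mB c0 by (simp add: mB')
  have "G q A = newtonian_capacity (closure A) * tors A powr q / measure lborel A powr E"
    using DA by (simp add: G_eq_tors E_def)
  also have "\<dots> \<le> newtonian_capacity (closure B') * tors B' powr q / measure lborel A powr E"
    using cap tors q tors_nonneg[OF DA(2,3)] newtonian_capacity_nonneg[OF bounded_closure[OF B'(2)]]
    by (intro divide_right_mono mult_mono powr_mono2) auto
  also have "\<dots> = newtonian_capacity (closure B') * tors B' powr q * (1 / measure lborel A powr E)" by simp
  also have "\<dots> \<le> newtonian_capacity (closure B') * tors B' powr q * (c powr (2 * (real DIM('a) * E)) / measure lborel B' powr E)"
  proof (intro mult_left_mono)
    show "1 / measure lborel A powr E \<le> c powr (2 * (real DIM('a) * E)) / measure lborel B' powr E"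
      using m mA mB'0 by (simp add: divide_simps)
  qed (use newtonian_capacity_nonneg[OF bounded_closure[OF B'(2)]] in auto)
  also have "\<dots> = c powr (2 * (real DIM('a) * E)) * G q B'"
    unfolding G_eq_tors[OF B'] E_def[symmetric] by simp
  also have "G q B' = G q B" unfolding B'_def by (rule G_affine[OF DB(2,3) c0 n])
  finally show ?thesis unfolding dE .
qed

lemma inradius_le_volume_radius:
  fixes \<Omega> :: "'a::euclidean_space set"
  assumes \<Omega>: "convex_domain \<Omega>" and s: "s > 0" "measure lborel \<Omega> = s ^ DIM('a) * measure lborel (ball (0::'a) 1)"
  shows "inradius \<Omega> \<le> s"
proof (rule ccontr)
  note D = convex_domainD[OF \<Omega>]
  assume "\<not> inradius \<Omega> \<le> s"
  then obtain x r where r: "r > s" "ball x r \<subseteq> \<Omega>" using inradius_approx[OF D(2,3,1), of s] by auto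
  have "measure lborel (ball x r) \<le> measure lborel \<Omega>"
    using r D by (intro measure_mono_fmeasurable fmeasurable_lborel_bounded) auto
  then have "r ^ DIM('a) * measure lborel (ball (0::'a) 1) \<le> s ^ DIM('a) * measure lborel (ball (0::'a) 1)"
    using r s content_ball_conv_unit_ball[of r x] by simp
  then have "r ^ DIM('a) \<le> s ^ DIM('a)" by (rule mult_right_le_imp_le) simp
  then have "r \<le> s" using s by (meson DIM_positive less_imp_le power_le_imp_le_base power_mono_iff r(1) order_trans)
  then show False using r by simp
qed

text \<open>Any two points are each within 2^(d+1) s^d / r^(d-1) of the centre of an inscribed ball
  of radius \<open>r\<close>; the triangle inequality doubles this, and \<open>r\<close> tends to
  the inradius.\<close>

lemma diameter_le_inradius:
  fixes \<Omega> :: "'a::euclidean_space set"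
  assumes \<Omega>: "convex_domain \<Omega>" and s: "s > 0" "measure lborel \<Omega> = s ^ DIM('a) * measure lborel (ball (0::'a) 1)"
  shows "diameter \<Omega> / inradius \<Omega> \<le> 2 ^ (DIM('a) + 2) * (s / inradius \<Omega>) ^ DIM('a)"
proof -
  note D = convex_domainD[OF \<Omega>]
  let ?n = "DIM('a)" and ?\<omega> = "measure lborel (ball (0::'a) 1)" and ?\<rho> = "inradius \<Omega>"
  have \<rho>: "?\<rho> > 0" by (rule inradius_pos[OF D(2,3,1)])
  let ?f = "\<lambda>r. 2 ^ (?n + 2) * s ^ ?n / r ^ (?n - 1)"
  have "norm (p - p') \<le> ?f ?\<rho>" if p: "p \<in> \<Omega>" "p' \<in> \<Omega>" for p p'
  proof -
    have main: "norm (p - p') \<le> ?f r" if r: "0 < r" "r < ?\<rho>" for r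
    proof -
      obtain x t where "t > r" "ball x t \<subseteq> \<Omega>" using inradius_approx[OF D(2,3,1) r(2)] by blast
      then have b: "ball x r \<subseteq> \<Omega>" using subset_ball[of r t x] by simp
      have dist: "norm (y - x) \<le> 2 ^ (?n + 1) * s ^ ?n / r ^ (?n - 1)" if "y \<in> \<Omega>" for y
      proof -
        have "(norm (y - x) * r ^ (?n - 1)) * ?\<omega> \<le> (2 ^ (?n + 1) * s ^ ?n) * ?\<omega>"
          using convex_dist_volume[OF D(4,2,3) b r(1) that] unfolding s(2) by (simp add: mult.assoc)
        then have "norm (y - x) * r ^ (?n - 1) \<le> 2 ^ (?n + 1) * s ^ ?n" by (rule mult_right_le_imp_le) simp
        then show ?thesis using r(1) by (simp add: pos_le_divide_eq)
      qed
      have "norm (p - p') \<le> norm (p - x) + norm (p' - x)"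
        using norm_triangle_ineq4[of "p - x" "p' - x"] by simp
      then show ?thesis using dist[OF p(1)] dist[OF p(2)] by simp
    qed
    have "(?f \<longlongrightarrow> ?f ?\<rho>) (at_left ?\<rho>)" using \<rho> by (intro tendsto_intros) auto
    then show ?thesis
    proof (rule tendsto_lowerbound)
      show "\<forall>\<^sub>F r in at_left ?\<rho>. norm (p - p') \<le> ?f r"
        unfolding eventually_at_left_field using main \<rho> by (intro exI[of _ 0]) auto
    qed auto
  qed
  then have "diameter \<Omega> \<le> ?f ?\<rho>" using D(1) by (intro diameter_le) auto
  then have "diameter \<Omega> / ?\<rho> \<le> ?f ?\<rho> / ?\<rho>" using \<rho> by (intro divide_right_mono) auto
  also have "\<dots> = 2 ^ (?n + 2) * (s / ?\<rho>) ^ ?n"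
  proof -
    have "?\<rho> ^ ?n = ?\<rho> ^ (?n - 1) * ?\<rho>" using DIM_positive[where 'a='a] by (cases ?n) auto
    then show ?thesis by (simp add: power_divide)
  qed
  finally show ?thesis .
qed

lemma convex_domain_ball: "convex_domain (ball (c::'a::euclidean_space) 1)"
  by (auto simp: convex_domain_def)

lemma I_inf_le:
  fixes \<Omega> :: "'a::euclidean_space set"
  assumes "convex_domain \<Omega>"
  shows "I_inf TYPE('a) q \<le> G q \<Omega>"
  unfolding I_inf_def
  by (rule cInf_lower) (use assms in \<open>auto intro!: bdd_belowI[of _ 0] G_nonneg simp: convex_domain_def\<close>)

lemma I_inf_ge:
  assumes "\<And>\<Omega> :: ('a::euclidean_space) set. convex_domain \<Omega> \<Longrightarrow> c \<le> G q \<Omega>"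
  shows "c \<le> I_inf TYPE('a) q"
  unfolding I_inf_def by (rule cInf_greatest) (use assms convex_domain_ball in auto)

lemma I_inf_approx:
  assumes "I_inf TYPE('a::euclidean_space) q < c"
  obtains \<Omega> :: "'a::euclidean_space set" where "convex_domain \<Omega>" "G q \<Omega> < c"
proof -
  have ne: "{G q \<Omega> | \<Omega> :: 'a set. convex_domain \<Omega>} \<noteq> {}" using convex_domain_ball by auto
  obtain x where "x \<in> {G q \<Omega> | \<Omega> :: 'a set. convex_domain \<Omega>}" "x < c"
    using cInf_lessD[OF ne assms[unfolded I_inf_def]] by (elim bexE)
  then show thesis using that by auto
qed

section \<open>Degeneration along thin boxes\<close>

lemma thin_box:
  fixes b\<^sub>0 :: "'a::euclidean_space"
  assumes b\<^sub>0: "b\<^sub>0 \<in> Basis" and e: "0 < e" "e \<le> 1"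
  defines "u \<equiv> \<Sum>b\<in>Basis. (if b = b\<^sub>0 then e else 1) *\<^sub>R b"
  shows "convex_domain (box (- u) u)" "measure lborel (box (- u) u) = 2 ^ DIM('a) * e"
    "box (- u) u \<subseteq> cball 0 (real DIM('a))" "\<And>x. x \<in> box (- u) u \<Longrightarrow> \<bar>x \<bullet> b\<^sub>0\<bar> \<le> e"
proof -
  have ub: "u \<bullet> b = (if b = b\<^sub>0 then e else 1)" if "b \<in> Basis" for b
    unfolding u_def using that by simp
  have mem: "\<bar>x \<bullet> b\<bar> \<le> (if b = b\<^sub>0 then e else 1)" if "x \<in> box (- u) u" "b \<in> Basis" for x b
    using that ub[OF that(2)] by (auto simp: mem_box abs_le_iff dest!: bspec[OF _ that(2)])
  then show "\<And>x. x \<in> box (- u) u \<Longrightarrow> \<bar>x \<bullet> b\<^sub>0\<bar> \<le> e" using b\<^sub>0 by fastforce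
  show "box (- u) u \<subseteq> cball 0 (real DIM('a))"
  proof
    fix x assume x: "x \<in> box (- u) u"
    have "norm x \<le> (\<Sum>b\<in>Basis. \<bar>x \<bullet> b\<bar>)" by (rule norm_le_l1)
    also have "\<dots> \<le> (\<Sum>b\<in>(Basis :: 'a set). 1)" using mem[OF x] e by (intro sum_mono) (force split: if_splits)
    finally show "x \<in> cball 0 (real DIM('a))" by simp
  qed
  have "box (- u) u \<noteq> {}" using ub e by (auto simp: box_ne_empty)
  then show "convex_domain (box (- u) u)" by (auto simp: convex_domain_def bounded_box convex_box)
  have "measure lborel (box (- u) u) = (\<Prod>b\<in>Basis. (u - (- u)) \<bullet> b)"
    using ub e by (intro measure_lborel_box) (auto simp: inner_minus_left)
  also have "\<dots> = (\<Prod>b\<in>Basis. 2 * (if b = b\<^sub>0 then e else 1))"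
    by (intro prod.cong) (auto simp: inner_add_left ub)
  also have "\<dots> = 2 ^ DIM('a) * (\<Prod>b\<in>Basis. if b = b\<^sub>0 then e else 1)" by (simp add: prod.distrib)
  also have "(\<Prod>b\<in>Basis. if b = b\<^sub>0 then e else 1) = e" using b\<^sub>0 by (simp add: prod.delta)
  finally show "measure lborel (box (- u) u) = 2 ^ DIM('a) * e" .
qed

text \<open>On boxes of half-width \<open>e\<close> in one direction the capacity stays bounded, the
  torsion is at most 2^d e^3 by the slab estimate and the volume is 2^d e. So \<open>G\<close> is of
  order e^(3q - E), and 3q - E is positive precisely above the critical q.\<close>

lemma I_inf_eq_0:
  assumes n: "DIM('a::euclidean_space) \<ge> 3" and d: "d = real DIM('a)" and q: "q > (d - 2) / (2 * (d - 1))"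
  shows "I_inf TYPE('a) q = 0"
proof (rule antisym)
  show "0 \<le> I_inf TYPE('a) q" by (rule I_inf_ge) (auto intro: G_nonneg simp: convex_domain_def)
  obtain b :: 'a where b: "b \<in> Basis" using nonempty_Basis by blast
  define C where "C = newtonian_capacity (cball (0::'a) (real DIM('a)))"
  define E where "E = 1 + q + 2 * (q - 1) / d"
  have d3: "d \<ge> 3" using n d by simp
  have "0 < (d - 2) / (2 * (d - 1))" using d3 by simp
  then have q0: "q > 0" using q by simp
  have p: "3 * q - E > 0"
  proof -
    have "d - 2 < q * (2 * (d - 1))" using q d3 by (simp add: pos_divide_less_eq)
    then have "0 < (q * (2 * (d - 1)) - (d - 2)) / d" using d3 by simp
    also have "\<dots> = 3 * q - E" using d3 by (simp add: E_def field_simps)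
    finally show ?thesis .
  qed
  let ?g = "\<lambda>e. C * ((2 ^ DIM('a)) powr q / (2 ^ DIM('a)) powr E) * e powr (3 * q - E)"
  have main: "I_inf TYPE('a) q \<le> ?g e" if e: "0 < e" "e \<le> 1" for e
  proof -
    define u :: 'a where "u = (\<Sum>i\<in>Basis. (if i = b then e else 1) *\<^sub>R i)"
    let ?\<Omega> = "box (- u) u"
    note box = thin_box[OF b e, folded u_def]
    note D = convex_domainD[OF box(1)]
    have "closure ?\<Omega> \<subseteq> cball 0 (real DIM('a))" using box(3) by (intro closure_minimal) auto
    then have cap: "newtonian_capacity (closure ?\<Omega>) \<le> C" unfolding C_def by (intro newtonian_capacity_mono) auto
    have "tors ?\<Omega> \<le> e\<^sup>2 * (2 ^ DIM('a) * e)" using tors_le_slab[OF D(2,3) b box(4)] box(2) by simp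
    then have "tors ?\<Omega> powr q \<le> (2 ^ DIM('a) * e powr 3) powr q"
      using q0 tors_nonneg[OF D(2,3)] e by (intro powr_mono2) (auto simp: power2_eq_square power3_eq_cube mult_ac)
    also have "\<dots> = (2 ^ DIM('a)) powr q * e powr (3 * q)" by (simp add: powr_mult powr_powr)
    finally have T: "tors ?\<Omega> powr q \<le> (2 ^ DIM('a)) powr q * e powr (3 * q)" .
    have "G q ?\<Omega> = newtonian_capacity (closure ?\<Omega>) * tors ?\<Omega> powr q / (2 ^ DIM('a) * e) powr E"
      using D by (simp add: G_eq_tors box(2) E_def d)
    also have "\<dots> \<le> C * ((2 ^ DIM('a)) powr q * e powr (3 * q)) / (2 ^ DIM('a) * e) powr E"
      using cap T newtonian_capacity_nonneg[OF bounded_closure[OF D(3)]]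
      by (intro divide_right_mono mult_mono) auto
    also have "\<dots> = ?g e" using e by (simp add: powr_mult powr_diff)
    finally show ?thesis using I_inf_le[OF box(1), of q] by linarith
  qed
  have "((\<lambda>e. e powr (3 * q - E)) \<longlongrightarrow> 0) (at_right 0)"
  proof -
    have "continuous_on {0..} (\<lambda>e::real. e powr (3 * q - E))"
      using p by (intro continuous_on_powr') (auto intro!: continuous_intros)
    then have "((\<lambda>e. e powr (3 * q - E)) \<longlongrightarrow> 0 powr (3 * q - E)) (at 0 within {0..})"
      unfolding continuous_on_def by (rule bspec) simp
    also have "0 powr (3 * q - E) = 0" by simp
    finally have "((\<lambda>e. e powr (3 * q - E)) \<longlongrightarrow> 0) (at 0 within {0..})" .
    then show ?thesis by (rule tendsto_within_subset) auto
  qed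
  from tendsto_mult[OF tendsto_const[of "C * ((2 ^ DIM('a)) powr q / (2 ^ DIM('a)) powr E)"] this]
  have "(?g \<longlongrightarrow> 0) (at_right 0)" by simp
  then show "I_inf TYPE('a) q \<le> 0"
  proof (rule tendsto_lowerbound)
    show "\<forall>\<^sub>F e in at_right 0. I_inf TYPE('a) q \<le> ?g e"
      unfolding eventually_at_right_field using main by (intro exI[of _ 1]) auto
  qed auto
qed

text \<open>A minimising sequence, normalised to contain the unit ball, stays bounded since \<open>G\<close> controls
  the inradius from below and the inradius and the volume control the diameter.\<close>

lemma minimiser_exists:
  assumes n: "DIM('a::euclidean_space) \<ge> 3" and d: "d = real DIM('a)"
    and q: "0 < q" "q < (d - 2) / (2 * (d - 1))"
  shows "\<exists>\<Omega> :: 'a set. convex_domain \<Omega> \<and> G q \<Omega> = I_inf TYPE('a) q"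
proof -
  let ?n = "DIM('a)"
  have d3: "d \<ge> 3" using n d by simp
  define \<alpha> where "\<alpha> = (d - 2) / (d - 1) - 2 * q"
  have \<alpha>: "\<alpha> > 0" using q(2) d3 by (simp add: \<alpha>_def field_simps)
  define I where "I = I_inf TYPE('a) q"
  define A where "A = 1 / d powr (d + (d + 2) * q) * G q (ball (0::'a) 1)"
  have A: "A > 0" unfolding A_def using d3 G_pos[OF convex_domain_ball n, of q 0] by (intro mult_pos_pos) auto
  have "I \<ge> 0" unfolding I_def by (rule I_inf_ge) (auto intro: G_nonneg simp: convex_domain_def)
  \<comment> \<open>Bounds the ratio of volume radius to inradius along the sequence, by solving
    \<open>(\<rho> / s) powr (- \<alpha>) * A \<le> I + 1\<close>. In \<open>D\<close> it appears as
    \<open>2 * c\<close> because the inscribed ball chosen has radius only above half the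
    inradius.\<close>
  define c where "c = ((I + 1) / A) powr (1 / \<alpha>)"
  define D where "D = 2 ^ (?n + 1) * (2 * c) ^ ?n"
  have step: "\<exists>\<Omega> :: 'a set. convex_domain \<Omega> \<and> G q \<Omega> < I + 1 / real (Suc k) \<and> ball 0 1 \<subseteq> \<Omega> \<and> \<Omega> \<subseteq> cball 0 D" for k
  proof -
    have "I < I + 1 / real (Suc k)" by simp
    then obtain \<Omega> :: "'a set" where \<Omega>: "convex_domain \<Omega>" "G q \<Omega> < I + 1 / real (Suc k)"
      using I_inf_approx[where 'a='a] unfolding I_def by metis
    note C = convex_domainD[OF \<Omega>(1)]
    let ?\<rho> = "inradius \<Omega>"
    have \<rho>: "?\<rho> > 0" by (rule inradius_pos[OF C(2,3,1)])
    obtain s where s: "s > 0" "measure lborel \<Omega> = s ^ ?n * measure lborel (ball (0::'a) 1)"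
      using volume_radius_exists[OF measure_open_pos[OF C(2,3,1)]] by blast
    have "(?\<rho> / s) powr (- \<alpha>) * A \<le> G q \<Omega>"
    proof -
      have "2 * q - (d - 2) / (d - 1) = - \<alpha>" by (simp add: \<alpha>_def)
      then show ?thesis using G_ge_inradius[OF \<Omega>(1) d d3 q(1) s] by (simp add: A_def mult_ac)
    qed
    also have "\<dots> \<le> I + 1" using \<Omega>(2) by (rule order_trans[OF less_imp_le]) simp
    finally have "(?\<rho> / s) powr (- \<alpha>) \<le> (I + 1) / A" using A by (simp add: pos_le_divide_eq)
    then have "((?\<rho> / s) powr (- \<alpha>)) powr (1 / \<alpha>) \<le> c" unfolding c_def using \<alpha> by (intro powr_mono2) auto
    moreover have "((?\<rho> / s) powr (- \<alpha>)) powr (1 / \<alpha>) = s / ?\<rho>"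
    proof -
      have "((?\<rho> / s) powr (- \<alpha>)) powr (1 / \<alpha>) = (?\<rho> / s) powr (- \<alpha> * (1 / \<alpha>))" by (rule powr_powr)
      also have "- \<alpha> * (1 / \<alpha>) = - 1" using \<alpha> by simp
      finally show ?thesis using \<rho> s(1) by (simp add: powr_minus_divide)
    qed
    ultimately have sc: "s / ?\<rho> \<le> c" by simp
    obtain x t where t: "t > ?\<rho> / 2" "x \<in> \<Omega>" "ball x t \<subseteq> \<Omega>" using inradius_approx[OF C(2,3,1), of "?\<rho> / 2"] \<rho> by auto
    have t0: "t > 0" using t \<rho> by linarith
    \<comment> \<open>The homothety taking the inscribed \<open>ball x t\<close> to the unit ball,
      which does not change \<open>G\<close>.\<close>
    let ?\<Omega> = "(\<lambda>y. (- (1 / t)) *\<^sub>R x + (1 / t) *\<^sub>R y) ` \<Omega>"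
    have mem: "(- (1 / t)) *\<^sub>R x + (1 / t) *\<^sub>R y = (1 / t) *\<^sub>R (y - x)" for y by (simp add: algebra_simps)
    have "convex_domain ?\<Omega>"
      unfolding convex_domain_def
      using t0 C(1) by (intro conjI open_bounded_affine[OF C(2,3)] convex_affinity[OF C(4)]) auto
    moreover have "G q ?\<Omega> = G q \<Omega>" using t0 n by (intro G_affine C) auto
    moreover have "ball 0 1 \<subseteq> ?\<Omega>"
    proof
      fix z :: 'a assume "z \<in> ball 0 1"
      then have "x + t *\<^sub>R z \<in> ball x t" using t0 by (simp add: dist_norm)
      then have "x + t *\<^sub>R z \<in> \<Omega>" using t(3) by blast
      moreover have "z = (- (1 / t)) *\<^sub>R x + (1 / t) *\<^sub>R (x + t *\<^sub>R z)"
        using t0 by (intro affine_bij(1)[symmetric]) simp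
      ultimately show "z \<in> ?\<Omega>" by blast
    qed
    moreover have "?\<Omega> \<subseteq> cball 0 D"
    proof
      fix z assume "z \<in> ?\<Omega>"
      then obtain y where y: "y \<in> \<Omega>" "z = (1 / t) *\<^sub>R (y - x)" unfolding mem by blast
      have "(norm (y - x) * t ^ (?n - 1)) * measure lborel (ball (0::'a) 1) \<le> (2 ^ (?n + 1) * s ^ ?n) * measure lborel (ball (0::'a) 1)"
        using convex_dist_volume[OF C(4,2,3) t(3) t0 y(1)] unfolding s(2) by (simp add: mult.assoc)
      then have 1: "norm (y - x) * t ^ (?n - 1) \<le> 2 ^ (?n + 1) * s ^ ?n" by (rule mult_right_le_imp_le) simp
      have "norm z = (norm (y - x) * t ^ (?n - 1)) / t ^ ?n"
      proof -
        have "t ^ ?n = t ^ (?n - 1) * t" using DIM_positive[where 'a='a] by (cases ?n) auto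
        then show ?thesis using t0 y(2) by simp
      qed
      also have "\<dots> \<le> 2 ^ (?n + 1) * s ^ ?n / t ^ ?n" using 1 t0 by (intro divide_right_mono) auto
      also have "\<dots> = 2 ^ (?n + 1) * (s / t) ^ ?n" by (simp add: power_divide)
      also have "\<dots> \<le> D"
      proof -
        have "s / t \<le> s / (?\<rho> / 2)" using s t \<rho> by (intro divide_left_mono) auto
        also have "\<dots> = 2 * (s / ?\<rho>)" by simp
        also have "\<dots> \<le> 2 * c" using sc by (intro mult_left_mono) auto
        finally show ?thesis unfolding D_def using s t0 by (intro mult_left_mono power_mono) auto
      qed
      finally show "z \<in> cball 0 D" by simp
    qed
    ultimately show ?thesis using \<Omega>(2) by (intro exI[of _ ?\<Omega>]) simp
  qed
  then obtain \<Omega> :: "nat \<Rightarrow> 'a set" where \<Omega>: "\<And>k. convex_domain (\<Omega> k)" "\<And>k. G q (\<Omega> k) < I + 1 / real (Suc k)"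
    "\<And>k. ball 0 1 \<subseteq> \<Omega> k" "\<And>k. \<Omega> k \<subseteq> cball 0 D"
    by metis
  note C = convex_domainD[OF \<Omega>(1)]
  obtain \<sigma> :: "nat \<Rightarrow> nat" where \<sigma>: "strict_mono \<sigma>"
    "\<And>e. e > 0 \<Longrightarrow> \<exists>N. \<forall>m\<ge>N. \<forall>n\<ge>N. \<Omega> (\<sigma> m) \<subseteq> (\<lambda>x. (1 + e) *\<^sub>R x) ` \<Omega> (\<sigma> n)"
  proof (rule blaschke_selection[of \<Omega> D, OF C(4) \<Omega>(3,4)])
    fix \<sigma> :: "nat \<Rightarrow> nat"
    assume "strict_mono \<sigma>"
      "\<And>e. e > 0 \<Longrightarrow> \<exists>N. \<forall>m\<ge>N. \<forall>n\<ge>N. \<Omega> (\<sigma> m) \<subseteq> (\<lambda>x. (1 + e) *\<^sub>R x) ` \<Omega> (\<sigma> n)"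
    then show thesis by (rule that)
  qed
  obtain L where L: "convex_domain L"
    "\<And>e. e > 0 \<Longrightarrow> \<exists>N. \<forall>n\<ge>N. L \<subseteq> (\<lambda>x. (1 + e) *\<^sub>R x) ` \<Omega> (\<sigma> n) \<and> \<Omega> (\<sigma> n) \<subseteq> (\<lambda>x. (1 + e) *\<^sub>R x) ` L"
  proof (rule convex_limit[of "\<lambda>k. \<Omega> (\<sigma> k)" D, OF C(4,2) \<Omega>(3,4) \<sigma>(2)])
    fix L :: "'a set"
    assume "convex_domain L"
      "\<And>e. e > 0 \<Longrightarrow> \<exists>N. \<forall>n\<ge>N. L \<subseteq> (\<lambda>x. (1 + e) *\<^sub>R x) ` \<Omega> (\<sigma> n) \<and> \<Omega> (\<sigma> n) \<subseteq> (\<lambda>x. (1 + e) *\<^sub>R x) ` L"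
    then show thesis by (rule that)
  qed
  define P where "P = 2 * (d - 2 + (d + 2) * q)"
  have lim: "(\<lambda>k. I + 1 / real (Suc k)) \<longlonglongrightarrow> I + 0"
    by (intro tendsto_add tendsto_const lim_inverse_n'[THEN LIMSEQ_Suc])
  \<comment> \<open>For fixed \<open>e\<close> the sequence runs to its limit, replacing its values
    by the infimum; only afterwards does \<open>e\<close> tend to 0 and the dilation factor to 1. No
    continuity of \<open>G\<close> beyond the sandwich estimate enters.\<close>
  have main: "G q L \<le> (1 + e) powr P * I" if e: "e > 0" for e
  proof -
    obtain N where N: "\<And>n. n \<ge> N \<Longrightarrow> L \<subseteq> (\<lambda>x. (1 + e) *\<^sub>R x) ` \<Omega> (\<sigma> n) \<and> \<Omega> (\<sigma> n) \<subseteq> (\<lambda>x. (1 + e) *\<^sub>R x) ` L"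
      using L(2)[OF e] by blast
    have "G q L \<le> (1 + e) powr P * (I + 1 / real (Suc k))" if "k \<ge> N" for k
    proof -
      have "G q L \<le> (1 + e) powr P * G q (\<Omega> (\<sigma> k))"
        unfolding P_def d using N[OF that] e q n by (intro G_le_sandwich L \<Omega>) auto
      also have "\<dots> \<le> (1 + e) powr P * (I + 1 / real (Suc k))"
      proof (intro mult_left_mono)
        have "1 / real (Suc (\<sigma> k)) \<le> 1 / real (Suc k)"
          using seq_suble[OF \<sigma>(1), of k] by (intro divide_left_mono) auto
        then show "G q (\<Omega> (\<sigma> k)) \<le> I + 1 / real (Suc k)" using \<Omega>(2)[of "\<sigma> k"] by linarith
      qed simp
      finally show ?thesis .
    qed
    moreover have "(\<lambda>k. (1 + e) powr P * (I + 1 / real (Suc k))) \<longlonglongrightarrow> (1 + e) powr P * (I + 0)"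
      by (intro tendsto_mult tendsto_const lim)
    ultimately show ?thesis using LIMSEQ_le_const[of _ "(1 + e) powr P * (I + 0)" "G q L"] by auto
  qed
  have "((\<lambda>e. (1 + e) powr P * I) \<longlongrightarrow> (1 + 0) powr P * I) (at_right 0)" by (intro tendsto_intros) auto
  then have "G q L \<le> (1 + 0) powr P * I"
  proof (rule tendsto_lowerbound)
    show "\<forall>\<^sub>F e in at_right 0. G q L \<le> (1 + e) powr P * I"
      unfolding eventually_at_right_field using main by (intro exI[of _ 1]) auto
  qed auto
  then have "G q L = I" using I_inf_le[OF L(1), of q] by (simp add: I_def)
  then show ?thesis using L(1) by (auto simp: I_def)
qed

theorem theorem3:
  fixes q d :: real and c :: "'a::euclidean_space"
  assumes "DIM('a) \<ge> 3" and "d = real DIM('a)"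
  shows "(q > (d - 2) / (2 * (d - 1)) \<longrightarrow> I_inf TYPE('a) q = 0) \<and>
    (0 < q \<and> q \<le> (d - 2) / (2 * (d - 1)) \<longrightarrow>
      I_inf TYPE('a) q \<ge> 1 / (2 * d powr (d + (d + 2) * q)) * G q (ball c 1)) \<and>
    (0 < q \<and> q < (d - 2) / (2 * (d - 1)) \<longrightarrow>
      (\<exists>\<Omega> :: 'a set. convex_domain \<Omega> \<and> G q \<Omega> = I_inf TYPE('a) q) \<and>
      (\<forall>\<Omega> :: 'a set. convex_domain \<Omega> \<and> G q \<Omega> = I_inf TYPE('a) q \<longrightarrow>
         diameter \<Omega> / inradius \<Omega> \<le>
           2 * d * (2 * d powr (d + (d + 2) * q)) powr
             (d * (d - 1) / (d - 2 - 2 * q * (d - 1)))))"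
proof (intro conjI impI allI; (elim conjE)?)
  have d3: "d \<ge> 3" using assms by simp
  let ?X = "d powr (d + (d + 2) * q)" and ?B = "ball (0::'a) 1" and ?n = "DIM('a)"
  have GB: "G q (ball c 1) = G q ?B" using assms(1) by (intro G_unit_ball) simp
  have GB_pos: "G q ?B > 0" by (rule G_pos[OF convex_domain_ball assms(1)])
  show "I_inf TYPE('a) q = 0" if "q > (d - 2) / (2 * (d - 1))"
    by (rule I_inf_eq_0[OF assms that])
  show "\<exists>\<Omega> :: 'a set. convex_domain \<Omega> \<and> G q \<Omega> = I_inf TYPE('a) q" if "0 < q" "q < (d - 2) / (2 * (d - 1))"
    by (rule minimiser_exists[OF assms that])
  show "I_inf TYPE('a) q \<ge> 1 / (2 * ?X) * G q (ball c 1)" if q: "0 < q" "q \<le> (d - 2) / (2 * (d - 1))"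
  proof (rule I_inf_ge)
    fix \<Omega> :: "'a set" assume \<Omega>: "convex_domain \<Omega>"
    note D = convex_domainD[OF \<Omega>]
    have \<rho>: "inradius \<Omega> > 0" by (rule inradius_pos[OF D(2,3,1)])
    obtain s where s: "s > 0" "measure lborel \<Omega> = s ^ ?n * measure lborel ?B"
      using volume_radius_exists[OF measure_open_pos[OF D(2,3,1)]] by blast
    \<comment> \<open>A nonpositive exponent on a base at most 1: the power is at least 1 and may be
      dropped from the lower bound.\<close>
    have "2 * q - (d - 2) / (d - 1) \<le> 0" using q(2) d3 by (simp add: field_simps)
    moreover have "inradius \<Omega> / s \<le> 1" using inradius_le_volume_radius[OF \<Omega> s] s by simp
    ultimately have "1 powr (2 * q - (d - 2) / (d - 1)) \<le> (inradius \<Omega> / s) powr (2 * q - (d - 2) / (d - 1))"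
      using \<rho> s by (intro powr_mono2') auto
    then have "1 / ?X * 1 * G q ?B \<le> 1 / ?X * (inradius \<Omega> / s) powr (2 * q - (d - 2) / (d - 1)) * G q ?B"
      using GB_pos by (intro mult_right_mono mult_left_mono) auto
    also have "\<dots> \<le> G q \<Omega>" by (rule G_ge_inradius[OF \<Omega> assms(2) d3 q(1) s])
    finally have "1 / ?X * G q ?B \<le> G q \<Omega>" by simp
    moreover have "1 / (2 * ?X) * G q ?B \<le> 1 / ?X * G q ?B"
      using GB_pos d3 by (intro mult_right_mono divide_left_mono) auto
    ultimately show "1 / (2 * ?X) * G q (ball c 1) \<le> G q \<Omega>" unfolding GB by linarith
  qed
  fix \<Omega> :: "'a set"
  assume q: "0 < q" "q < (d - 2) / (2 * (d - 1))" and \<Omega>: "convex_domain \<Omega>" and min: "G q \<Omega> = I_inf TYPE('a) q"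
  note D = convex_domainD[OF \<Omega>]
  let ?\<rho> = "inradius \<Omega>"
  have \<rho>: "?\<rho> > 0" by (rule inradius_pos[OF D(2,3,1)])
  obtain s where s: "s > 0" "measure lborel \<Omega> = s ^ ?n * measure lborel ?B"
    using volume_radius_exists[OF measure_open_pos[OF D(2,3,1)]] by blast
  define \<alpha> where "\<alpha> = (d - 2) / (d - 1) - 2 * q"
  have \<alpha>: "\<alpha> > 0" using q(2) d3 by (simp add: \<alpha>_def field_simps)
  have "(d - 2) / (d - 1) \<le> 1" using d3 by simp
  then have \<alpha>1: "\<alpha> \<le> 1" using q(1) by (simp add: \<alpha>_def)
  \<comment> \<open>The diameter bound contains the d-th power of \<open>t\<close>, while
    \<open>G\<close> controls its \<alpha>-th power; \<open>p\<close> converts one into the other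
    and is the exponent of the claim.\<close>
  define p where "p = d / \<alpha>"
  have p_eq: "d * (d - 1) / (d - 2 - 2 * q * (d - 1)) = p"
  proof -
    have "\<alpha> = (d - 2 - 2 * q * (d - 1)) / (d - 1)" using d3 by (simp add: \<alpha>_def diff_divide_distrib)
    then show ?thesis by (simp add: p_def)
  qed
  have pd: "p \<ge> d" using \<alpha> \<alpha>1 d3 by (simp add: p_def pos_le_divide_eq mult_left_le)
  define t where "t = s / ?\<rho>"
  have t: "t > 0" using s \<rho> by (simp add: t_def)
  \<comment> \<open>A minimiser does not exceed the ball in \<open>G\<close>, so the value of the
    ball cancels from the general lower bound.\<close>
  have "t powr \<alpha> \<le> ?X"
  proof -
    have "1 / ?X * (?\<rho> / s) powr (2 * q - (d - 2) / (d - 1)) * G q ?B \<le> G q \<Omega>"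
      by (rule G_ge_inradius[OF \<Omega> assms(2) d3 q(1) s])
    also have "\<dots> \<le> G q ?B" unfolding min by (rule I_inf_le[OF convex_domain_ball])
    finally have "(1 / ?X * (?\<rho> / s) powr (2 * q - (d - 2) / (d - 1))) * G q ?B \<le> 1 * G q ?B" by simp
    then have "1 / ?X * (?\<rho> / s) powr (2 * q - (d - 2) / (d - 1)) \<le> 1" using GB_pos by (rule mult_right_le_imp_le)
    moreover have "(?\<rho> / s) powr (2 * q - (d - 2) / (d - 1)) = t powr \<alpha>"
    proof -
      have "2 * q - (d - 2) / (d - 1) = - \<alpha>" by (simp add: \<alpha>_def)
      then show ?thesis using s \<rho> by (simp add: t_def powr_minus_divide powr_divide)
    qed
    ultimately show ?thesis using d3 by (simp add: divide_simps)
  qed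
  then have "(t powr \<alpha>) powr (d / \<alpha>) \<le> ?X powr (d / \<alpha>)" using \<alpha> d3 by (intro powr_mono2) auto
  then have "t powr d \<le> ?X powr p" using \<alpha> by (simp add: powr_powr p_def)
  then have td: "t ^ ?n \<le> ?X powr p" using t by (simp add: assms(2) powr_realpow)
  have "diameter \<Omega> / ?\<rho> \<le> 2 ^ (?n + 2) * t ^ ?n"
    unfolding t_def by (rule diameter_le_inradius[OF \<Omega> s])
  also have "\<dots> \<le> 2 ^ (?n + 2) * ?X powr p" using td by (intro mult_left_mono) auto
  also have "\<dots> \<le> (2 * d * 2 powr p) * ?X powr p"
  proof (intro mult_right_mono)
    \<comment> \<open>The numerical factor is absorbed by 4 at most 2d and, since \<alpha> is at
      most 1 and so \<open>p\<close> at least \<open>d\<close>, by 2^d at most 2^p.\<close>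
    have "(2::real) ^ (?n + 2) = 4 * 2 powr d" by (simp add: power_add assms(2) powr_realpow)
    also have "\<dots> \<le> (2 * d) * 2 powr p" using d3 pd by (intro mult_mono powr_mono) auto
    finally show "2 ^ (?n + 2) \<le> 2 * d * 2 powr p" .
  qed simp
  also have "\<dots> = 2 * d * (2 * ?X) powr p" by (simp add: powr_mult)
  finally show "diameter \<Omega> / ?\<rho> \<le> 2 * d * (2 * ?X) powr (d * (d - 1) / (d - 2 - 2 * q * (d - 1)))"
    unfolding p_eq .
qed

end
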